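(* Let $\mathfrak g$ be a Lie algebra, $\mathcal F$ a $\mathfrak g$-Hopf algebra and $V$ an induced $(\mathfrak g,\mathcal F)$-module. Then ${}^\sigma V_\delta:={}^\sigma\mathbb C_\delta\otimes V$ (identified with $V$ as a vector space) is a right-left stable anti-Yetter-Drinfeld (SAYD) module over $\mathcal F\blacktriangleright\!\!\vartriangleleft U(\mathfrak g)$ with the right action $$v\triangleleft_{(\delta,\sigma)}(f\otimes u)=\varepsilon(f)\,\delta_{\mathfrak g}(u_{(1)})\,S(u_{(2)})\cdot v$$ and the left coaction $${}^\sigma\nabla_\delta(v)=(\sigma_{\mathcal F}S(v_{\langle1\rangle})\otimes1)\otimes v_{\langle0\rangle}.$$ Here $(\delta,\sigma)=(\varepsilon\otimes\delta_{\mathfrak g},\sigma_{\mathcal F}\otimes1)$ is the canonical modular pair in involution associated to $(\mathfrak g,\mathcal F)$.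
   Context: Everything is over $\mathbb C$; Lie algebras are finite dimensional; Sweedler notation is used ($\Delta(u)=u_{(1)}\otimes u_{(2)}$, right coactions $v\mapsto v_{\langle0\rangle}\otimes v_{\langle1\rangle}$, left coactions $v\mapsto v_{\langle-1\rangle}\otimes v_{\langle0\rangle}$). **$\mathfrak g$-Hopf algebras.** Let $\mathfrak g$ have basis $X_1,\dots,X_N$, $[X_i,X_j]=\sum_k C^k_{ij}X_k$. Let $\mathcal F$ be a commutative Hopf algebra on which $\mathfrak g$ acts (from the left, $X\triangleright f$) by derivations. $\mathcal F$ is a $\mathfrak g$-Hopf algebra if: (1) $\mathcal F$ coacts on $\mathfrak g$ from the right by $\nabla_{\mathfrak g}(X_j)=\sum_iX_i\otimes f^i_j$, with $X_i\triangleright f^k_j-X_j\triangleright f^k_i=\sum_{s,r}C^k_{sr}f^r_if^s_j+\sum_lC^l_{ij}f^k_l$ for all $i,j,k$; (2) $\Delta(X\triangleright f)=X_{\langle0\rangle}\triangleright f_{(1)}\otimes X_{\langle1\rangle}f_{(2)}+f_{(1)}\otimes X\triangleright f_{(2)}$ and $\varepsilon(X\triangleright f)=0$. **Bicrossed product.** The action extends to $U(\mathfrak g)$, the coaction extends to $\nabla:U(\mathfrak g)\to U(\mathfrak g)\otimes\mathcal F$ by $\nabla(1)=1\otimes1$, $\nabla(uv)=u_{(1)\langle0\rangle}v_{\langle0\rangle}\otimes u_{(1)\langle1\rangle}(u_{(2)}\triangleright v_{\langle1\rangle})$. The Hopf algebra $\mathcal F\blacktriangleright\!\!\vartriangleleft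 U(\mathfrak g)$ is $\mathcal F\otimes U(\mathfrak g)$ with product $(f\otimes u)(g\otimes v)=f(u_{(1)}\triangleright g)\otimes u_{(2)}v$, coproduct $\Delta(f\otimes u)=(f_{(1)}\otimes u_{(1)\langle0\rangle})\otimes(f_{(2)}u_{(1)\langle1\rangle}\otimes u_{(2)})$, unit $1\otimes 1$, counit $\varepsilon\otimes\varepsilon$, antipode $S(f\otimes u)=(1\otimes S(u_{\langle0\rangle}))(S(fu_{\langle1\rangle})\otimes1)$. **Canonical pair.** $\delta_{\mathfrak g}:U(\mathfrak g)\to\mathbb C$ is the character with $\delta_{\mathfrak g}(X)=\mathrm{Tr}(\mathrm{ad}_X)$; $\sigma_{\mathcal F}=\det[f^i_j]\in\mathcal F$. **Induced modules.** An induced $(\mathfrak g,\mathcal F)$-module is a left $\mathfrak g$-module $V$ with a right $\mathcal F$-coaction $\nabla_V(v)=v_{\langle0\rangle}\otimes v_{\langle1\rangle}$ such that $\nabla_V(X\cdot v)=X_{\langle0\rangle}\cdot v_{\langle0\rangle}\otimes X_{\langle1\rangle}v_{\langle1\rangle}+v_{\langle0\rangle}\otimes X\triangleright v_{\langle1\rangle}$ for all $X\in\mathfrak g$, $v\in V$. **SAYD modules.** A right-left anti-Yetter-Drinfeld (AYD) module over a Hopf algebra $H$ is a right $H$-module and left $H$-comodule $V$ with $\nabla(v\cdot h)=S(h_{(3)})v_{\langle-1\rangle}h_{(1)}\otimes v_{\langle0\rangle}\cdot h_{(2)}$; it is stable (SAYD) if moreover $v_{\langle0\rangle}\cdot v_{\langle-1\rangle}=v$.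 *)

theory Defs
  imports
    Complex_Main
    "HOL-Library.Function_Algebras"
    "Jordan_Normal_Form.Determinant"
begin

section \<open>Complex vector spaces\<close>

class complex_vector = ab_group_add +
  fixes scaleC :: "complex \<Rightarrow> 'a \<Rightarrow> 'a"  (infixr \<open>*\<^sub>C\<close> 75)
  assumes scaleC_add_right: "a *\<^sub>C (x + y) = a *\<^sub>C x + a *\<^sub>C y"
    and scaleC_add_left: "(a + b) *\<^sub>C x = a *\<^sub>C x + b *\<^sub>C x"
    and scaleC_scaleC: "a *\<^sub>C (b *\<^sub>C x) = (a * b) *\<^sub>C x"
    and scaleC_one: "1 *\<^sub>C x = x"

global_interpretation cvec: vector_space "scaleC :: complex \<Rightarrow> 'a \<Rightarrow> 'a::complex_vector"
  by unfold_locales (simp_all add: scaleC_add_right scaleC_add_left scaleC_scaleC scaleC_one)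

abbreviation clinear :: "('a::complex_vector \<Rightarrow> 'b::complex_vector) \<Rightarrow> bool"
  where "clinear \<equiv> Vector_Spaces.linear scaleC scaleC"

definition cbilinear :: "('a::complex_vector \<Rightarrow> 'b::complex_vector \<Rightarrow> 'c::complex_vector) \<Rightarrow> bool"
  where "cbilinear \<phi> \<longleftrightarrow> (\<forall>x. clinear (\<phi> x)) \<and> (\<forall>y. clinear (\<lambda>x. \<phi> x y))"

instantiation complex :: complex_vector
begin
definition scaleC_complex :: "complex \<Rightarrow> complex \<Rightarrow> complex"
  where "scaleC_complex a x = a * x"
instance
  by standard (simp_all add: scaleC_complex_def algebra_simps)
end

instantiation "fun" :: (type, complex_vector) complex_vector
begin
definition scaleC_fun :: "complex \<Rightarrow> ('a \<Rightarrow> 'b) \<Rightarrow> 'a \<Rightarrow> 'b"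
  where "scaleC_fun a f = (\<lambda>x. a *\<^sub>C f x)"
instance
  by standard (simp_all add: scaleC_fun_def fun_eq_iff
      scaleC_add_right scaleC_add_left scaleC_scaleC scaleC_one)
end


section \<open>Tensor products\<close>

text \<open>The tensor product over the complex numbers is the vector space presented by the
  generators \<open>a \<otimes> b\<close> and the relations of bilinearity: formal expressions modulo the congruence
  generated by the vector space axioms and these relations.\<close>

datatype (plugins only:) ('a, 'b) tensor_expr =
    TPure 'a 'b
  | TZero
  | TAdd "('a, 'b) tensor_expr" "('a, 'b) tensor_expr"
  | TScale complex "('a, 'b) tensor_expr"

inductive tensor_rel ::
  "('a::complex_vector, 'b::complex_vector) tensor_expr \<Rightarrow> ('a, 'b) tensor_expr \<Rightarrow> bool"
  where
    refl: "tensor_rel s s"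
  | sym: "tensor_rel s t \<Longrightarrow> tensor_rel t s"
  | trans: "tensor_rel s t \<Longrightarrow> tensor_rel t u \<Longrightarrow> tensor_rel s u"
  | add_cong: "tensor_rel s s' \<Longrightarrow> tensor_rel t t' \<Longrightarrow> tensor_rel (TAdd s t) (TAdd s' t')"
  | scale_cong: "tensor_rel s s' \<Longrightarrow> tensor_rel (TScale c s) (TScale c s')"
  | add_assoc: "tensor_rel (TAdd (TAdd s t) u) (TAdd s (TAdd t u))"
  | add_commute: "tensor_rel (TAdd s t) (TAdd t s)"
  | add_zero: "tensor_rel (TAdd TZero s) s"
  | add_inverse: "tensor_rel (TAdd (TScale (-1) s) s) TZero"
  | scale_add: "tensor_rel (TScale c (TAdd s t)) (TAdd (TScale c s) (TScale c t))"
  | add_scale: "tensor_rel (TScale (c + d) s) (TAdd (TScale c s) (TScale d s))"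
  | scale_scale: "tensor_rel (TScale c (TScale d s)) (TScale (c * d) s)"
  | scale_one: "tensor_rel (TScale 1 s) s"
  | pure_add_left: "tensor_rel (TPure (a + a') b) (TAdd (TPure a b) (TPure a' b))"
  | pure_add_right: "tensor_rel (TPure a (b + b')) (TAdd (TPure a b) (TPure a b'))"
  | pure_scale_left: "tensor_rel (TPure (c *\<^sub>C a) b) (TScale c (TPure a b))"
  | pure_scale_right: "tensor_rel (TPure a (c *\<^sub>C b)) (TScale c (TPure a b))"

quotient_type (overloaded) ('a, 'b) tensor =
  "('a::complex_vector, 'b::complex_vector) tensor_expr" / tensor_rel
  by (intro equivpI reflpI sympI transpI) (auto intro: tensor_rel.intros)

lift_definition tensor_pure ::
  "'a::complex_vector \<Rightarrow> 'b::complex_vector \<Rightarrow> ('a, 'b) tensor"  (infixr \<open>\<otimes>\<^sub>C\<close> 71)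
  is TPure .

instantiation tensor :: (complex_vector, complex_vector) complex_vector
begin
lift_definition zero_tensor :: "('a, 'b) tensor" is TZero .
lift_definition plus_tensor :: "('a, 'b) tensor \<Rightarrow> ('a, 'b) tensor \<Rightarrow> ('a, 'b) tensor"
  is TAdd by (rule tensor_rel.add_cong)
lift_definition scaleC_tensor :: "complex \<Rightarrow> ('a, 'b) tensor \<Rightarrow> ('a, 'b) tensor"
  is TScale by (rule tensor_rel.scale_cong)
lift_definition uminus_tensor :: "('a, 'b) tensor \<Rightarrow> ('a, 'b) tensor"
  is "TScale (-1)" by (rule tensor_rel.scale_cong)
lift_definition minus_tensor :: "('a, 'b) tensor \<Rightarrow> ('a, 'b) tensor \<Rightarrow> ('a, 'b) tensor"
  is "\<lambda>s t. TAdd s (TScale (-1) t)" by (intro tensor_rel.add_cong tensor_rel.scale_cong)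
instance
  by standard (transfer; blast intro: tensor_rel.intros)+
end

primrec tensor_eval ::
  "('a \<Rightarrow> 'b \<Rightarrow> 'c::complex_vector) \<Rightarrow> ('a, 'b) tensor_expr \<Rightarrow> 'c"
  where
    "tensor_eval \<phi> (TPure a b) = \<phi> a b"
  | "tensor_eval \<phi> TZero = 0"
  | "tensor_eval \<phi> (TAdd s t) = tensor_eval \<phi> s + tensor_eval \<phi> t"
  | "tensor_eval \<phi> (TScale c s) = c *\<^sub>C tensor_eval \<phi> s"

text \<open>\<open>sweedler t \<phi>\<close> is the sum of the \<open>\<phi> a\<^sub>i b\<^sub>i\<close> for \<open>t\<close> the sum of the \<open>a\<^sub>i \<otimes> b\<^sub>i\<close>, that is, the
  value at \<open>t\<close> of the linear map induced by \<open>\<phi>\<close>. It renders Sweedler notation: an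
  expression in \<open>h\<^sub>(\<^sub>1\<^sub>)\<close> and \<open>h\<^sub>(\<^sub>2\<^sub>)\<close> becomes \<open>sweedler (\<Delta> h) (\<lambda>h1 h2. \<dots>)\<close>. It does not depend on
  the chosen representative when \<open>\<phi>\<close> is bilinear, and is used only in that case.\<close>

definition sweedler ::
  "('a::complex_vector, 'b::complex_vector) tensor \<Rightarrow> ('a \<Rightarrow> 'b \<Rightarrow> 'c::complex_vector) \<Rightarrow> 'c"
  where "sweedler t \<phi> = tensor_eval \<phi> (rep_tensor t)"

lemma tensor_eval_cong:
  assumes "tensor_rel s t" and \<phi>: "cbilinear \<phi>"
  shows "tensor_eval \<phi> s = tensor_eval \<phi> t"
proof -
  have "\<phi> (a + a') b = \<phi> a b + \<phi> a' b" "\<phi> a (b + b') = \<phi> a b + \<phi> a b'"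
    "\<phi> (c *\<^sub>C a) b = c *\<^sub>C \<phi> a b" "\<phi> a (c *\<^sub>C b) = c *\<^sub>C \<phi> a b" for a a' b b' c
    using \<phi> by (simp_all add: cbilinear_def Vector_Spaces.linear_iff)
  with assms(1) show ?thesis
    by (induction rule: tensor_rel.induct)
      (auto simp: scaleC_add_right scaleC_add_left scaleC_scaleC scaleC_one)
qed

lemma
  assumes "cbilinear \<phi>"
  shows sweedler_pure: "sweedler (a \<otimes>\<^sub>C b) \<phi> = \<phi> a b"
    and sweedler_linear: "clinear (\<lambda>t. sweedler t \<phi>)"
proof -
  have rep: "tensor_eval \<phi> (rep_tensor (abs_tensor e)) = tensor_eval \<phi> e" for e
    using tensor_eval_cong[OF _ assms] Quotient3_rep_abs[OF Quotient3_tensor] tensor_rel.refl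
    by blast
  show "sweedler (a \<otimes>\<^sub>C b) \<phi> = \<phi> a b"
    by (simp add: sweedler_def tensor_pure.abs_eq rep)
  have "sweedler (s + t) \<phi> = sweedler s \<phi> + sweedler t \<phi>" for s t
    by (induct s rule: tensor.abs_induct, induct t rule: tensor.abs_induct)
      (simp add: sweedler_def plus_tensor.abs_eq rep)
  moreover have "sweedler (c *\<^sub>C t) \<phi> = c *\<^sub>C sweedler t \<phi>" for c t
    by (induct t rule: tensor.abs_induct) (simp add: sweedler_def scaleC_tensor.abs_eq rep)
  ultimately show "clinear (\<lambda>t. sweedler t \<phi>)"
    by (simp add: Vector_Spaces.linear_iff cvec.vector_space_axioms)
qed


section \<open>Hopf algebras, modules and comodules\<close>

locale algebra_over_complex =
  fixes mul :: "'h::complex_vector \<Rightarrow> 'h \<Rightarrow> 'h" and one :: 'h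
  assumes mul_bilinear: "cbilinear mul"
    and mul_assoc: "mul (mul a b) c = mul a (mul b c)"
    and mul_one_left: "mul one a = a"
    and mul_one_right: "mul a one = a"

locale coalgebra_over_complex =
  fixes \<Delta> :: "'h::complex_vector \<Rightarrow> ('h, 'h) tensor" and \<epsilon> :: "'h \<Rightarrow> complex"
  assumes comul_linear: "clinear \<Delta>"
    and counit_linear: "clinear \<epsilon>"
    and coassoc: "sweedler (\<Delta> h) (\<lambda>x y. sweedler (\<Delta> x) (\<lambda>a b. a \<otimes>\<^sub>C b \<otimes>\<^sub>C y))
      = sweedler (\<Delta> h) (\<lambda>x y. sweedler (\<Delta> y) (\<lambda>b c. x \<otimes>\<^sub>C b \<otimes>\<^sub>C c))"
    and counit_left: "sweedler (\<Delta> h) (\<lambda>x y. \<epsilon> x *\<^sub>C y) = h"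
    and counit_right: "sweedler (\<Delta> h) (\<lambda>x y. \<epsilon> y *\<^sub>C x) = h"

locale hopf_algebra =
  algebra_over_complex mul one + coalgebra_over_complex \<Delta> \<epsilon>
  for mul :: "'h::complex_vector \<Rightarrow> 'h \<Rightarrow> 'h" and one :: 'h
    and \<Delta> :: "'h \<Rightarrow> ('h, 'h) tensor" and \<epsilon> :: "'h \<Rightarrow> complex" +
  fixes S :: "'h \<Rightarrow> 'h"
  assumes comul_mul: "\<Delta> (mul g h) =
      sweedler (\<Delta> g) (\<lambda>g1 g2. sweedler (\<Delta> h) (\<lambda>h1 h2. mul g1 h1 \<otimes>\<^sub>C mul g2 h2))"
    and comul_one: "\<Delta> one = one \<otimes>\<^sub>C one"
    and counit_mul: "\<epsilon> (mul g h) = \<epsilon> g * \<epsilon> h"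
    and counit_one: "\<epsilon> one = 1"
    and antipode_linear: "clinear S"
    and antipode_left: "sweedler (\<Delta> h) (\<lambda>h1 h2. mul (S h1) h2) = \<epsilon> h *\<^sub>C one"
    and antipode_right: "sweedler (\<Delta> h) (\<lambda>h1 h2. mul h1 (S h2)) = \<epsilon> h *\<^sub>C one"

locale right_comodule = coalgebra_over_complex \<Delta> \<epsilon>
  for \<Delta> :: "'h::complex_vector \<Rightarrow> ('h, 'h) tensor" and \<epsilon> :: "'h \<Rightarrow> complex" +
  fixes \<rho> :: "'v::complex_vector \<Rightarrow> ('v, 'h) tensor"
  assumes coact_linear: "clinear \<rho>"
    and coact_coassoc: "sweedler (\<rho> v) (\<lambda>x y. sweedler (\<rho> x) (\<lambda>a b. a \<otimes>\<^sub>C b \<otimes>\<^sub>C y))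
      = sweedler (\<rho> v) (\<lambda>x y. sweedler (\<Delta> y) (\<lambda>b c. x \<otimes>\<^sub>C b \<otimes>\<^sub>C c))"
    and coact_counit: "sweedler (\<rho> v) (\<lambda>x y. \<epsilon> y *\<^sub>C x) = v"

locale left_comodule = coalgebra_over_complex \<Delta> \<epsilon>
  for \<Delta> :: "'h::complex_vector \<Rightarrow> ('h, 'h) tensor" and \<epsilon> :: "'h \<Rightarrow> complex" +
  fixes \<rho> :: "'v::complex_vector \<Rightarrow> ('h, 'v) tensor"
  assumes coact_linear: "clinear \<rho>"
    and coact_coassoc: "sweedler (\<rho> v) (\<lambda>x y. sweedler (\<Delta> x) (\<lambda>a b. a \<otimes>\<^sub>C b \<otimes>\<^sub>C y))
      = sweedler (\<rho> v) (\<lambda>x y. sweedler (\<rho> y) (\<lambda>b c. x \<otimes>\<^sub>C b \<otimes>\<^sub>C c))"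
    and coact_counit: "sweedler (\<rho> v) (\<lambda>x y. \<epsilon> x *\<^sub>C y) = v"

locale right_module = algebra_over_complex mul one
  for mul :: "'h::complex_vector \<Rightarrow> 'h \<Rightarrow> 'h" and one :: 'h +
  fixes act :: "'v::complex_vector \<Rightarrow> 'h \<Rightarrow> 'v"
  assumes act_bilinear: "cbilinear act"
    and act_mul: "act v (mul g h) = act (act v g) h"
    and act_one: "act v one = v"

locale right_left_ayd_module =
  hopf_algebra mul one \<Delta> \<epsilon> S + right_module mul one act + left_comodule \<Delta> \<epsilon> \<rho>
  for mul :: "'h::complex_vector \<Rightarrow> 'h \<Rightarrow> 'h" and one :: 'h
    and \<Delta> :: "'h \<Rightarrow> ('h, 'h) tensor" and \<epsilon> :: "'h \<Rightarrow> complex" and S :: "'h \<Rightarrow> 'h"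
    and act :: "'v::complex_vector \<Rightarrow> 'h \<Rightarrow> 'v" and \<rho> :: "'v \<Rightarrow> ('h, 'v) tensor" +
  assumes ayd: "\<rho> (act v h) =
      sweedler (\<Delta> h) (\<lambda>h1 h'. sweedler (\<Delta> h') (\<lambda>h2 h3. sweedler (\<rho> v) (\<lambda>w v0.
        mul (mul (S h3) w) h1 \<otimes>\<^sub>C act v0 h2)))"

locale right_left_sayd_module = right_left_ayd_module +
  assumes stable: "sweedler (\<rho> v) (\<lambda>w v0. act v0 w) = v"

text \<open>In \<open>twisted_antipode_square\<close>, the inverse of the group-like element \<open>\<sigma>\<close> is \<open>S \<sigma>\<close>, so that the
  right-hand side is \<open>\<sigma> h \<sigma>\<^sup>-\<^sup>1\<close>; the twisted antipode is the convolution product of \<open>\<delta>\<close> and \<open>S\<close>.\<close>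

definition twisted_antipode ::
  "('h \<Rightarrow> ('h, 'h) tensor) \<Rightarrow> ('h \<Rightarrow> 'h) \<Rightarrow> ('h \<Rightarrow> complex) \<Rightarrow> 'h \<Rightarrow> 'h::complex_vector"
  where "twisted_antipode \<Delta> S \<delta> h = sweedler (\<Delta> h) (\<lambda>h1 h2. \<delta> h1 *\<^sub>C S h2)"

locale modular_pair_in_involution =
  hopf_algebra mul one \<Delta> \<epsilon> S
  for mul :: "'h::complex_vector \<Rightarrow> 'h \<Rightarrow> 'h" and one :: 'h
    and \<Delta> :: "'h \<Rightarrow> ('h, 'h) tensor" and \<epsilon> :: "'h \<Rightarrow> complex" and S :: "'h \<Rightarrow> 'h" +
  fixes \<delta> :: "'h \<Rightarrow> complex" and \<sigma> :: 'h
  assumes character_linear: "clinear \<delta>"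
    and character_mul: "\<delta> (mul g h) = \<delta> g * \<delta> h"
    and character_one: "\<delta> one = 1"
    and group_like: "\<Delta> \<sigma> = \<sigma> \<otimes>\<^sub>C \<sigma>" "\<epsilon> \<sigma> = 1"
    and modular: "\<delta> \<sigma> = 1"
    and twisted_antipode_square:
      "twisted_antipode \<Delta> S \<delta> (twisted_antipode \<Delta> S \<delta> h) = mul (mul \<sigma> h) (S \<sigma>)"


section \<open>Lie algebras and their enveloping algebras\<close>

class lie_algebra = complex_vector +
  fixes lie_bracket :: "'a \<Rightarrow> 'a \<Rightarrow> 'a"
  assumes lie_bracket_add_left: "lie_bracket (x + y) z = lie_bracket x z + lie_bracket y z"
    and lie_bracket_scale_left: "lie_bracket (c *\<^sub>C x) z = c *\<^sub>C lie_bracket x z"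
    and lie_bracket_add_right: "lie_bracket z (x + y) = lie_bracket z x + lie_bracket z y"
    and lie_bracket_scale_right: "lie_bracket z (c *\<^sub>C x) = c *\<^sub>C lie_bracket z x"
    and lie_bracket_self: "lie_bracket x x = 0"
    and jacobi: "lie_bracket x (lie_bracket y z) + lie_bracket y (lie_bracket z x)
      + lie_bracket z (lie_bracket x y) = 0"

locale lie_module =
  fixes act :: "'g::lie_algebra \<Rightarrow> 'm::complex_vector \<Rightarrow> 'm"
  assumes act_bilinear: "cbilinear act"
    and act_bracket: "act (lie_bracket x y) m = act x (act y m) - act y (act x m)"

text \<open>The enveloping algebra is presented as a unital associative algebra by generators \<open>x\<close> in the
  Lie algebra, depending linearly on \<open>x\<close>, with the relations \<open>[x, y] = x y - y x\<close>.\<close>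

datatype (plugins only:) 'g uea_expr =
    UGen 'g
  | UZero
  | UOne
  | UAdd "'g uea_expr" "'g uea_expr"
  | UScale complex "'g uea_expr"
  | UMul "'g uea_expr" "'g uea_expr"

inductive uea_rel :: "'g::lie_algebra uea_expr \<Rightarrow> 'g uea_expr \<Rightarrow> bool"
  where
    refl: "uea_rel s s"
  | sym: "uea_rel s t \<Longrightarrow> uea_rel t s"
  | trans: "uea_rel s t \<Longrightarrow> uea_rel t u \<Longrightarrow> uea_rel s u"
  | add_cong: "uea_rel s s' \<Longrightarrow> uea_rel t t' \<Longrightarrow> uea_rel (UAdd s t) (UAdd s' t')"
  | scale_cong: "uea_rel s s' \<Longrightarrow> uea_rel (UScale c s) (UScale c s')"
  | mul_cong: "uea_rel s s' \<Longrightarrow> uea_rel t t' \<Longrightarrow> uea_rel (UMul s t) (UMul s' t')"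
  | add_assoc: "uea_rel (UAdd (UAdd s t) u) (UAdd s (UAdd t u))"
  | add_commute: "uea_rel (UAdd s t) (UAdd t s)"
  | add_zero: "uea_rel (UAdd UZero s) s"
  | add_inverse: "uea_rel (UAdd (UScale (-1) s) s) UZero"
  | scale_add: "uea_rel (UScale c (UAdd s t)) (UAdd (UScale c s) (UScale c t))"
  | add_scale: "uea_rel (UScale (c + d) s) (UAdd (UScale c s) (UScale d s))"
  | scale_scale: "uea_rel (UScale c (UScale d s)) (UScale (c * d) s)"
  | scale_one: "uea_rel (UScale 1 s) s"
  | mul_assoc: "uea_rel (UMul (UMul s t) u) (UMul s (UMul t u))"
  | mul_one_left: "uea_rel (UMul UOne s) s"
  | mul_one_right: "uea_rel (UMul s UOne) s"
  | mul_add_left: "uea_rel (UMul (UAdd s t) u) (UAdd (UMul s u) (UMul t u))"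
  | mul_add_right: "uea_rel (UMul s (UAdd t u)) (UAdd (UMul s t) (UMul s u))"
  | mul_scale_left: "uea_rel (UMul (UScale c s) t) (UScale c (UMul s t))"
  | mul_scale_right: "uea_rel (UMul s (UScale c t)) (UScale c (UMul s t))"
  | gen_add: "uea_rel (UGen (x + y)) (UAdd (UGen x) (UGen y))"
  | gen_scale: "uea_rel (UGen (c *\<^sub>C x)) (UScale c (UGen x))"
  | gen_bracket: "uea_rel (UGen (lie_bracket x y))
      (UAdd (UMul (UGen x) (UGen y)) (UScale (-1) (UMul (UGen y) (UGen x))))"

quotient_type (overloaded) 'g uea = "'g::lie_algebra uea_expr" / uea_rel
  by (intro equivpI reflpI sympI transpI) (auto intro: uea_rel.intros)

lift_definition uea_gen :: "'g::lie_algebra \<Rightarrow> 'g uea" is UGen .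

primrec uea_eval ::
  "('a \<Rightarrow> 'a \<Rightarrow> 'a) \<Rightarrow> 'a \<Rightarrow> ('g \<Rightarrow> 'a) \<Rightarrow> 'g uea_expr \<Rightarrow> 'a::complex_vector"
  where
    "uea_eval mul e \<phi> (UGen x) = \<phi> x"
  | "uea_eval mul e \<phi> UZero = 0"
  | "uea_eval mul e \<phi> UOne = e"
  | "uea_eval mul e \<phi> (UAdd s t) = uea_eval mul e \<phi> s + uea_eval mul e \<phi> t"
  | "uea_eval mul e \<phi> (UScale c s) = c *\<^sub>C uea_eval mul e \<phi> s"
  | "uea_eval mul e \<phi> (UMul s t) = mul (uea_eval mul e \<phi> s) (uea_eval mul e \<phi> t)"

lemma uea_eval_cong:
  assumes "uea_rel s t" and "algebra_over_complex mul e" and "clinear \<phi>"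
    and "\<And>x y. \<phi> (lie_bracket x y) = mul (\<phi> x) (\<phi> y) - mul (\<phi> y) (\<phi> x)"
  shows "uea_eval mul e \<phi> s = uea_eval mul e \<phi> t"
proof -
  interpret algebra_over_complex mul e by fact
  have mul: "mul (a + a') b = mul a b + mul a' b" "mul a (b + b') = mul a b + mul a b'"
    "mul (c *\<^sub>C a) b = c *\<^sub>C mul a b" "mul a (c *\<^sub>C b) = c *\<^sub>C mul a b" for a a' b b' c
    using mul_bilinear by (simp_all add: cbilinear_def Vector_Spaces.linear_iff)
  have \<phi>: "\<phi> (x + y) = \<phi> x + \<phi> y" "\<phi> (c *\<^sub>C x) = c *\<^sub>C \<phi> x" for x y c
    using assms(3) by (simp_all add: Vector_Spaces.linear_iff)
  from assms(1) show ?thesis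
    by (induction rule: uea_rel.induct)
      (auto simp: scaleC_add_right scaleC_add_left scaleC_scaleC scaleC_one mul \<phi> assms(4)
        mul_assoc mul_one_left mul_one_right)
qed

instantiation uea :: (lie_algebra) "{ring_1, complex_vector}"
begin
lift_definition zero_uea :: "'a uea" is UZero .
lift_definition one_uea :: "'a uea" is UOne .
lift_definition plus_uea :: "'a uea \<Rightarrow> 'a uea \<Rightarrow> 'a uea" is UAdd by (rule uea_rel.add_cong)
lift_definition times_uea :: "'a uea \<Rightarrow> 'a uea \<Rightarrow> 'a uea" is UMul by (rule uea_rel.mul_cong)
lift_definition scaleC_uea :: "complex \<Rightarrow> 'a uea \<Rightarrow> 'a uea"
  is UScale by (rule uea_rel.scale_cong)
lift_definition uminus_uea :: "'a uea \<Rightarrow> 'a uea" is "UScale (-1)" by (rule uea_rel.scale_cong)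
lift_definition minus_uea :: "'a uea \<Rightarrow> 'a uea \<Rightarrow> 'a uea"
  is "\<lambda>s t. UAdd s (UScale (-1) t)" by (intro uea_rel.add_cong uea_rel.scale_cong)
instance
proof
  show "(0 :: 'a uea) \<noteq> 1"
  proof (transfer, rule notI)
    assume "uea_rel UZero (UOne :: 'a uea_expr)"
    then have "uea_eval (*) (1 :: complex) (\<lambda>_. 0) (UZero :: 'a uea_expr)
        = uea_eval (*) 1 (\<lambda>_. 0) (UOne :: 'a uea_expr)"
      by (rule uea_eval_cong)
        (auto intro!: algebra_over_complex.intro simp: cbilinear_def Vector_Spaces.linear_iff
          cvec.vector_space_axioms scaleC_complex_def algebra_simps)
    then show False by simp
  qed
qed (transfer; blast intro: uea_rel.intros)+
end

text \<open>The algebra homomorphism extending \<open>\<phi>\<close>, a homomorphism of Lie algebras into an associative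
  algebra (with the given multiplication and unit); see \<open>uea_lift_hom\<close>.\<close>

definition uea_lift ::
  "('a \<Rightarrow> 'a \<Rightarrow> 'a) \<Rightarrow> 'a \<Rightarrow> ('g::lie_algebra \<Rightarrow> 'a) \<Rightarrow> 'g uea \<Rightarrow> 'a::complex_vector"
  where "uea_lift mul e \<phi> u = uea_eval mul e \<phi> (rep_uea u)"

lemma uea_lift_hom:
  assumes "algebra_over_complex mul e" and "clinear \<phi>"
    and "\<And>x y. \<phi> (lie_bracket x y) = mul (\<phi> x) (\<phi> y) - mul (\<phi> y) (\<phi> x)"
  shows "uea_lift mul e \<phi> (uea_gen x) = \<phi> x"
    and "uea_lift mul e \<phi> 1 = e"
    and "uea_lift mul e \<phi> (u * v) = mul (uea_lift mul e \<phi> u) (uea_lift mul e \<phi> v)"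
    and "clinear (uea_lift mul e \<phi>)"
proof -
  have rep: "uea_eval mul e \<phi> (rep_uea (abs_uea w)) = uea_eval mul e \<phi> w" for w
    using uea_eval_cong[OF _ assms] Quotient3_rep_abs[OF Quotient3_uea] uea_rel.refl
    by blast
  show "uea_lift mul e \<phi> (uea_gen x) = \<phi> x"
    by (simp add: uea_lift_def uea_gen.abs_eq rep)
  show "uea_lift mul e \<phi> 1 = e"
    by (simp add: uea_lift_def one_uea.abs_eq rep)
  show "uea_lift mul e \<phi> (u * v) = mul (uea_lift mul e \<phi> u) (uea_lift mul e \<phi> v)"
    by (induct u rule: uea.abs_induct, induct v rule: uea.abs_induct)
      (simp add: uea_lift_def times_uea.abs_eq rep)
  have "uea_lift mul e \<phi> (u + v) = uea_lift mul e \<phi> u + uea_lift mul e \<phi> v" for u v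
    by (induct u rule: uea.abs_induct, induct v rule: uea.abs_induct)
      (simp add: uea_lift_def plus_uea.abs_eq rep)
  moreover have "uea_lift mul e \<phi> (c *\<^sub>C u) = c *\<^sub>C uea_lift mul e \<phi> u" for c u
    by (induct u rule: uea.abs_induct) (simp add: uea_lift_def scaleC_uea.abs_eq rep)
  ultimately show "clinear (uea_lift mul e \<phi>)"
    by (simp add: Vector_Spaces.linear_iff cvec.vector_space_axioms)
qed

abbreviation uea_act ::
  "('g::lie_algebra \<Rightarrow> 'm \<Rightarrow> 'm) \<Rightarrow> 'g uea \<Rightarrow> 'm \<Rightarrow> 'm::complex_vector"
  where "uea_act \<equiv> uea_lift (\<circ>) id"

text \<open>Composition is additive in its right argument only on linear maps, so that \<open>uea_lift_hom\<close>
  does not apply to it; but all the endomorphisms arising from a Lie module are linear.\<close>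

lemma
  assumes "lie_module act"
  shows uea_act_gen: "uea_act act (uea_gen x) m = act x m"
    and uea_act_one: "uea_act act 1 m = m"
    and uea_act_mult: "uea_act act (u * v) m = uea_act act u (uea_act act v m)"
    and uea_act_bilinear: "cbilinear (uea_act act)"
proof -
  interpret lie_module act by fact
  let ?ev = "uea_eval (\<circ>) id act"
  have act: "act (x + y) m = act x m + act y m" "act x (m + n) = act x m + act x n"
    "act (c *\<^sub>C x) m = c *\<^sub>C act x m" "act x (c *\<^sub>C m) = c *\<^sub>C act x m" for x y m n c
    using act_bilinear by (simp_all add: cbilinear_def Vector_Spaces.linear_iff)
  have lin: "?ev w (m + n) = ?ev w m + ?ev w n" "?ev w (c *\<^sub>C m) = c *\<^sub>C ?ev w m" for w m n c
    by (induction w arbitrary: m n c)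
      (simp_all add: act scaleC_fun_def scaleC_add_right scaleC_scaleC mult.commute)
  have "?ev s = ?ev t" if "uea_rel s t" for s t
    using that by (induction rule: uea_rel.induct)
      (auto simp: fun_eq_iff act lin[unfolded comp_def id_def] act_bracket scaleC_fun_def scaleC_add_right scaleC_add_left
        scaleC_scaleC scaleC_one)
  then have rep: "?ev (rep_uea (abs_uea w)) = ?ev w" for w
    using Quotient3_rep_abs[OF Quotient3_uea] uea_rel.refl by blast
  show "uea_act act (uea_gen x) m = act x m"
    by (simp add: uea_lift_def uea_gen.abs_eq rep)
  show "uea_act act 1 m = m"
    by (simp add: uea_lift_def one_uea.abs_eq rep)
  show "uea_act act (u * v) m = uea_act act u (uea_act act v m)"
    by (induct u rule: uea.abs_induct, induct v rule: uea.abs_induct)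
      (simp add: uea_lift_def times_uea.abs_eq rep)
  have "uea_act act (u + v) m = uea_act act u m + uea_act act v m" for u v m
    by (induct u rule: uea.abs_induct, induct v rule: uea.abs_induct)
      (simp add: uea_lift_def plus_uea.abs_eq rep)
  moreover have "uea_act act (c *\<^sub>C u) m = c *\<^sub>C uea_act act u m" for c u m
    by (induct u rule: uea.abs_induct)
      (simp only: uea_lift_def scaleC_uea.abs_eq rep uea_eval.simps scaleC_fun_def)
  ultimately show "cbilinear (uea_act act)"
    by (simp add: cbilinear_def Vector_Spaces.linear_iff cvec.vector_space_axioms lin uea_lift_def)
qed

definition uea_comult :: "'g::lie_algebra uea \<Rightarrow> ('g uea, 'g uea) tensor"
  where "uea_comult = uea_lift
    (\<lambda>s t. sweedler s (\<lambda>a b. sweedler t (\<lambda>c d. (a * c) \<otimes>\<^sub>C (b * d)))) (1 \<otimes>\<^sub>C 1)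
    (\<lambda>x. uea_gen x \<otimes>\<^sub>C 1 + 1 \<otimes>\<^sub>C uea_gen x)"

definition uea_counit :: "'g::lie_algebra uea \<Rightarrow> complex"
  where "uea_counit = uea_lift (*) 1 (\<lambda>_. 0)"

definition uea_antipode :: "'g::lie_algebra uea \<Rightarrow> 'g uea"
  where "uea_antipode = uea_lift (\<lambda>a b. b * a) 1 (\<lambda>x. - uea_gen x)"

definition is_basis :: "nat \<Rightarrow> (nat \<Rightarrow> 'g::complex_vector) \<Rightarrow> bool"
  where "is_basis N X \<longleftrightarrow> inj_on X {..<N} \<and> cvec.independent (X ` {..<N})
    \<and> cvec.span (X ` {..<N}) = UNIV"

definition coord :: "nat \<Rightarrow> (nat \<Rightarrow> 'g::complex_vector) \<Rightarrow> 'g \<Rightarrow> nat \<Rightarrow> complex"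
  where "coord N X v k = cvec.representation (X ` {..<N}) v (X k)"

definition delta_g :: "nat \<Rightarrow> (nat \<Rightarrow> 'g::lie_algebra) \<Rightarrow> 'g uea \<Rightarrow> complex"
  where "delta_g N X = uea_lift (*) 1 (\<lambda>Y. \<Sum>i<N. coord N X (lie_bracket Y (X i)) i)"


section \<open>Hopf algebras over a Lie algebra and their induced modules\<close>

locale g_hopf_algebra =
  hopf_algebra "(*)" 1 \<Delta> \<epsilon> S + lie_module act + right_comodule \<Delta> \<epsilon> coact
  for N :: nat and X :: "nat \<Rightarrow> 'g::lie_algebra"
    and \<Delta> :: "'f::{comm_ring_1, complex_vector} \<Rightarrow> ('f, 'f) tensor"
    and \<epsilon> :: "'f \<Rightarrow> complex" and S :: "'f \<Rightarrow> 'f"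
    and act :: "'g \<Rightarrow> 'f \<Rightarrow> 'f" and coact :: "'g \<Rightarrow> ('g, 'f) tensor"
    and f :: "nat \<Rightarrow> nat \<Rightarrow> 'f" +
  assumes basis: "is_basis N X"
    and derivation: "act Y (a * b) = act Y a * b + a * act Y b"
    and coact_basis: "j < N \<Longrightarrow> coact (X j) = (\<Sum>i<N. X i \<otimes>\<^sub>C f i j)"
    and structure_identity: "i < N \<Longrightarrow> j < N \<Longrightarrow> k < N \<Longrightarrow>
      act (X i) (f k j) - act (X j) (f k i) =
        (\<Sum>s<N. \<Sum>r<N. coord N X (lie_bracket (X s) (X r)) k *\<^sub>C (f r i * f s j))
        + (\<Sum>l<N. coord N X (lie_bracket (X i) (X j)) l *\<^sub>C f k l)"
    and comul_act: "\<Delta> (act Y a) =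
        sweedler (coact Y) (\<lambda>Y0 Y1. sweedler (\<Delta> a) (\<lambda>a1 a2. act Y0 a1 \<otimes>\<^sub>C (Y1 * a2)))
        + sweedler (\<Delta> a) (\<lambda>a1 a2. a1 \<otimes>\<^sub>C act Y a2)"
    and counit_act: "\<epsilon> (act Y a) = 0"

locale induced_module =
  lie_module actV + right_comodule \<Delta> \<epsilon> coactV
  for \<Delta> :: "'f::{comm_ring_1, complex_vector} \<Rightarrow> ('f, 'f) tensor" and \<epsilon> :: "'f \<Rightarrow> complex"
    and act :: "'g::lie_algebra \<Rightarrow> 'f \<Rightarrow> 'f" and coact :: "'g \<Rightarrow> ('g, 'f) tensor"
    and actV :: "'g \<Rightarrow> 'v \<Rightarrow> 'v::complex_vector" and coactV :: "'v \<Rightarrow> ('v, 'f) tensor" +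
  assumes coactV_actV: "coactV (actV Y v) =
        sweedler (coact Y) (\<lambda>Y0 Y1. sweedler (coactV v) (\<lambda>v0 v1. actV Y0 v0 \<otimes>\<^sub>C (Y1 * v1)))
        + sweedler (coactV v) (\<lambda>v0 v1. v0 \<otimes>\<^sub>C act Y v1)"


section \<open>The bicrossed product\<close>

definition is_uea_coact ::
  "('g::lie_algebra \<Rightarrow> 'f \<Rightarrow> 'f) \<Rightarrow> ('g \<Rightarrow> ('g, 'f) tensor)
    \<Rightarrow> ('g uea \<Rightarrow> ('g uea, 'f::{comm_ring_1, complex_vector}) tensor) \<Rightarrow> bool"
  where "is_uea_coact act coact nab \<longleftrightarrow> clinear nab
    \<and> (\<forall>Y. nab (uea_gen Y) = sweedler (coact Y) (\<lambda>Y0 Y1. uea_gen Y0 \<otimes>\<^sub>C Y1))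
    \<and> nab 1 = 1 \<otimes>\<^sub>C 1
    \<and> (\<forall>u v. nab (u * v) =
          sweedler (uea_comult u) (\<lambda>u1 u2. sweedler (nab u1) (\<lambda>u10 u11. sweedler (nab v) (\<lambda>v0 v1.
            (u10 * v0) \<otimes>\<^sub>C (u11 * uea_act act u2 v1)))))"

definition uea_coact ::
  "('g::lie_algebra \<Rightarrow> 'f \<Rightarrow> 'f) \<Rightarrow> ('g \<Rightarrow> ('g, 'f) tensor)
    \<Rightarrow> 'g uea \<Rightarrow> ('g uea, 'f::{comm_ring_1, complex_vector}) tensor"
  where "uea_coact act coact = (THE nab. is_uea_coact act coact nab)"

type_synonym ('f, 'g) bicrossed = "('f, 'g uea) tensor"

definition bicrossed_mult ::
  "('g::lie_algebra \<Rightarrow> 'f \<Rightarrow> 'f) \<Rightarrow> ('f, 'g) bicrossed \<Rightarrow> ('f, 'g) bicrossed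
    \<Rightarrow> ('f::{comm_ring_1, complex_vector}, 'g) bicrossed"
  where "bicrossed_mult act x y =
    sweedler x (\<lambda>a u. sweedler y (\<lambda>b v. sweedler (uea_comult u) (\<lambda>u1 u2.
      (a * uea_act act u1 b) \<otimes>\<^sub>C (u2 * v))))"

definition bicrossed_one ::
  "('f::{comm_ring_1, complex_vector}, 'g::lie_algebra) bicrossed"
  where "bicrossed_one = 1 \<otimes>\<^sub>C 1"

definition bicrossed_comult ::
  "('f::{comm_ring_1, complex_vector} \<Rightarrow> ('f, 'f) tensor)
    \<Rightarrow> ('g::lie_algebra \<Rightarrow> 'f \<Rightarrow> 'f) \<Rightarrow> ('g \<Rightarrow> ('g, 'f) tensor)
    \<Rightarrow> ('f, 'g) bicrossed \<Rightarrow> (('f, 'g) bicrossed, ('f, 'g) bicrossed) tensor"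
  where "bicrossed_comult \<Delta> act coact x =
    sweedler x (\<lambda>a u. sweedler (\<Delta> a) (\<lambda>a1 a2. sweedler (uea_comult u) (\<lambda>u1 u2.
      sweedler (uea_coact act coact u1) (\<lambda>u10 u11.
        (a1 \<otimes>\<^sub>C u10) \<otimes>\<^sub>C ((a2 * u11) \<otimes>\<^sub>C u2)))))"

definition bicrossed_counit ::
  "('f \<Rightarrow> complex) \<Rightarrow> ('f::{comm_ring_1, complex_vector}, 'g::lie_algebra) bicrossed \<Rightarrow> complex"
  where "bicrossed_counit \<epsilon> x = sweedler x (\<lambda>a u. \<epsilon> a * uea_counit u)"

definition bicrossed_antipode ::
  "('f \<Rightarrow> 'f) \<Rightarrow> ('g::lie_algebra \<Rightarrow> 'f \<Rightarrow> 'f) \<Rightarrow> ('g \<Rightarrow> ('g, 'f) tensor)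
    \<Rightarrow> ('f, 'g) bicrossed \<Rightarrow> ('f::{comm_ring_1, complex_vector}, 'g) bicrossed"
  where "bicrossed_antipode S act coact x =
    sweedler x (\<lambda>a u. sweedler (uea_coact act coact u) (\<lambda>u0 u1.
      bicrossed_mult act (1 \<otimes>\<^sub>C uea_antipode u0) (S (a * u1) \<otimes>\<^sub>C 1)))"


section \<open>The canonical pair and the twisted induced module\<close>

definition sigma_F :: "nat \<Rightarrow> (nat \<Rightarrow> nat \<Rightarrow> 'f) \<Rightarrow> 'f::comm_ring_1"
  where "sigma_F N f = det (mat N N (\<lambda>(i, j). f i j))"

definition canonical_delta ::
  "nat \<Rightarrow> (nat \<Rightarrow> 'g::lie_algebra) \<Rightarrow> ('f \<Rightarrow> complex)
    \<Rightarrow> ('f::{comm_ring_1, complex_vector}, 'g) bicrossed \<Rightarrow> complex"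
  where "canonical_delta N X \<epsilon> x = sweedler x (\<lambda>a u. \<epsilon> a * delta_g N X u)"

definition canonical_sigma ::
  "nat \<Rightarrow> (nat \<Rightarrow> nat \<Rightarrow> 'f)
    \<Rightarrow> ('f::{comm_ring_1, complex_vector}, 'g::lie_algebra) bicrossed"
  where "canonical_sigma N f = sigma_F N f \<otimes>\<^sub>C 1"

definition twisted_act ::
  "nat \<Rightarrow> (nat \<Rightarrow> 'g::lie_algebra) \<Rightarrow> ('f \<Rightarrow> complex) \<Rightarrow> ('g \<Rightarrow> 'v \<Rightarrow> 'v)
    \<Rightarrow> 'v::complex_vector \<Rightarrow> ('f::{comm_ring_1, complex_vector}, 'g) bicrossed \<Rightarrow> 'v"
  where "twisted_act N X \<epsilon> actV v x =
    sweedler x (\<lambda>a u. sweedler (uea_comult u) (\<lambda>u1 u2.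
      (\<epsilon> a * delta_g N X u1) *\<^sub>C uea_act actV (uea_antipode u2) v))"

definition twisted_coact ::
  "nat \<Rightarrow> (nat \<Rightarrow> nat \<Rightarrow> 'f) \<Rightarrow> ('f \<Rightarrow> 'f) \<Rightarrow> ('v \<Rightarrow> ('v, 'f) tensor)
    \<Rightarrow> 'v::complex_vector
    \<Rightarrow> (('f::{comm_ring_1, complex_vector}, 'g::lie_algebra) bicrossed, 'v) tensor"
  where "twisted_coact N f S coactV v =
    sweedler (coactV v) (\<lambda>v0 v1. ((sigma_F N f * S v1) \<otimes>\<^sub>C 1) \<otimes>\<^sub>C v0)"

end

theory Submission
  imports Defs
begin

text \<open>As an algebra, the bicrossed product \<open>H\<close> is generated by the elements \<open>a \<otimes> 1\<close> with \<open>a\<close> in the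
  commutative Hopf algebra \<open>F\<close>, and \<open>1 \<otimes> Y\<close> with \<open>Y\<close> in the Lie algebra. Left multiplication by
  them is explicit: \<open>(a \<otimes> 1)(b \<otimes> v) = ab \<otimes> v\<close> and
  \<open>(1 \<otimes> Y)(b \<otimes> v) = (Y \<triangleright> b) \<otimes> v + b \<otimes> Y v\<close>. Every identity to be proved is closed under products,
  so that it is enough to verify it on generators; this is \<open>bicrossed_induct\<close>. Associativity comes
  first, then multiplicativity of the comultiplication and of the counit, whence coassociativity
  and the counit laws (\<open>coassoc_mul\<close>, \<open>counit_mul_laws\<close>). The antipode of \<open>H\<close> reverses
  products, and then the antipode laws are closed under products as well (\<open>antipode_mul_laws\<close>).

  Two facts make the generators work. The coaction extends to \<open>U\<close> because
  \<open>Y \<mapsto> (u \<otimes> c \<mapsto> Y\<^sub>0 u \<otimes> Y\<^sub>1 c + u \<otimes> Y \<triangleright> c)\<close> is a representation on \<open>U \<otimes> F\<close>, which is the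
  structure identity in disguise (\<open>coact_bracket\<close>, \<open>coact_step_lie_module\<close>). The antipode of \<open>H\<close> is
  antimultiplicative because \<open>S (Y \<triangleright> c) = S Y\<^sub>1 (Y\<^sub>0 \<triangleright> S c)\<close> in \<open>F\<close> (\<open>antipode_act\<close>).

  The element \<open>\<sigma>\<close> is group-like because the determinant is multiplicative. By Jacobi's
  formula for the derivative of a determinant, its logarithmic derivative \<open>\<sigma>\<^sup>-\<^sup>1 (Y \<triangleright> \<sigma>)\<close> is the trace of
  \<open>f\<^sup>-\<^sup>1 (Y \<triangleright> f)\<close>, and the structure identity turns this trace into
  \<open>S Y\<^sub>1 (Y\<^sub>0 \<triangleright> Y\<^sub>2) + \<delta> Y - \<delta> Y\<^sub>0 Y\<^sub>1\<close> (\<open>act_sigma_delta\<close>). This formula is exactly what is missing, on the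
  generators \<open>1 \<otimes> Y\<close>, both for the square of the twisted antipode to be conjugation by \<open>\<sigma>\<close> and for
  the anti-Yetter-Drinfeld condition on the twisted module. On the generators \<open>a \<otimes> 1\<close> both
  statements only use that \<open>F\<close> is commutative, and stability holds because \<open>\<epsilon> (\<sigma> S v\<^sub>1) = \<epsilon> v\<^sub>1\<close>.\<close>

section \<open>Sweedler calculus\<close>

lemma clinear_iff:
  "clinear L \<longleftrightarrow> (\<forall>x y. L (x + y) = L x + L y) \<and> (\<forall>c x. L (c *\<^sub>C x) = c *\<^sub>C L x)"
  by (simp add: Vector_Spaces.linear_iff cvec.vector_space_axioms)

lemma
  assumes "clinear L"
  shows clinear_add: "L (x + y) = L x + L y"
    and clinear_scale: "L (c *\<^sub>C x) = c *\<^sub>C L x"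
    and clinear_zero: "L 0 = 0"
    and clinear_minus: "L (- x) = - L x"
    and clinear_diff: "L (x - y) = L x - L y"
    and clinear_sum: "L (\<Sum>i\<in>I. g i) = (\<Sum>i\<in>I. L (g i))"
proof -
  interpret Vector_Spaces.linear scaleC scaleC L by fact
  show "L (x + y) = L x + L y" "L (c *\<^sub>C x) = c *\<^sub>C L x" "L 0 = 0" "L (- x) = - L x"
    "L (x - y) = L x - L y" "L (\<Sum>i\<in>I. g i) = (\<Sum>i\<in>I. L (g i))"
    by (rule add scale zero neg diff sum)+
qed

text \<open>Calculations in Sweedler notation rest on two collections of rules. The collection \<open>lin\<close>
  proves linearity of an expression in one of its variables, by recursion over the expression;
  \<open>push\<close> moves the symbol \<open>sweedler\<close> outwards through linear maps.\<close>

named_theorems lin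
named_theorems push

lemma cbilinearI:
  assumes "\<And>a. clinear (\<phi> a)" and "\<And>b. clinear (\<lambda>a. \<phi> a b)"
  shows "cbilinear \<phi>"
  using assms by (simp add: cbilinear_def)

lemma cbilinear_left: "cbilinear \<phi> \<Longrightarrow> clinear (\<lambda>a. \<phi> a b)"
  and cbilinear_right: "cbilinear \<phi> \<Longrightarrow> clinear (\<phi> a)"
  by (simp_all add: cbilinear_def)

lemma clinear_compose: "clinear L \<Longrightarrow> clinear g \<Longrightarrow> clinear (\<lambda>x. L (g x))"
  by (simp add: clinear_iff)

lemmas clinear_compose_left = clinear_compose[OF cbilinear_left]
lemmas clinear_compose_right = clinear_compose[OF cbilinear_right]

lemma cbilinear_simps:
  assumes "cbilinear \<phi>"
  shows "\<phi> (a + a') b = \<phi> a b + \<phi> a' b" "\<phi> a (b + b') = \<phi> a b + \<phi> a b'"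
    "\<phi> (c *\<^sub>C a) b = c *\<^sub>C \<phi> a b" "\<phi> a (c *\<^sub>C b) = c *\<^sub>C \<phi> a b"
    "\<phi> (- a) b = - \<phi> a b" "\<phi> a (- b) = - \<phi> a b"
    "\<phi> (a - a') b = \<phi> a b - \<phi> a' b" "\<phi> a (b - b') = \<phi> a b - \<phi> a b'"
    "\<phi> 0 b = 0" "\<phi> a 0 = 0"
proof -
  note left = cbilinear_left[OF assms] and right = cbilinear_right[OF assms]
  show "\<phi> (a + a') b = \<phi> a b + \<phi> a' b" "\<phi> a (b + b') = \<phi> a b + \<phi> a b'"
    by (rule left[THEN clinear_add] right[THEN clinear_add])+
  show "\<phi> (c *\<^sub>C a) b = c *\<^sub>C \<phi> a b" "\<phi> a (c *\<^sub>C b) = c *\<^sub>C \<phi> a b"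
    by (rule left[THEN clinear_scale] right[THEN clinear_scale])+
  show "\<phi> (- a) b = - \<phi> a b" "\<phi> a (- b) = - \<phi> a b"
    by (rule left[THEN clinear_minus] right[THEN clinear_minus])+
  show "\<phi> (a - a') b = \<phi> a b - \<phi> a' b" "\<phi> a (b - b') = \<phi> a b - \<phi> a b'"
    by (rule left[THEN clinear_diff] right[THEN clinear_diff])+
  show "\<phi> 0 b = 0" "\<phi> a 0 = 0"
    by (rule left[THEN clinear_zero] right[THEN clinear_zero])+
qed

lemma [lin]: "clinear (\<lambda>x. x)" "clinear (\<lambda>x. 0)"
  by (simp_all add: clinear_iff)

lemma [lin]:
  assumes "clinear g"
  shows "clinear (\<lambda>x. c *\<^sub>C g x)" "clinear (\<lambda>x. - g x)"
  using assms clinear_minus[OF cvec.linear_scale_self]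
  by (auto simp: clinear_iff scaleC_add_right scaleC_scaleC mult.commute)

lemma [lin]:
  assumes "clinear g" "clinear h"
  shows "clinear (\<lambda>x. g x + h x)" "clinear (\<lambda>x. g x - h x)"
  using assms clinear_diff[OF cvec.linear_scale_self]
  by (auto simp: clinear_iff scaleC_add_right algebra_simps)

lemma [lin]: "(\<And>i. clinear (g i)) \<Longrightarrow> clinear (\<lambda>x. \<Sum>i\<in>I. g i x)"
  by (induction I rule: infinite_finite_induct) (simp_all add: clinear_iff scaleC_add_right)

lemma cbilinear_scaleC: "cbilinear (\<lambda>c x. (c::complex) *\<^sub>C x)"
  by (simp add: cbilinear_def clinear_iff scaleC_add_right scaleC_add_left scaleC_scaleC
      scaleC_complex_def mult.commute)

lemma cbilinear_times_complex: "cbilinear (\<lambda>c d. c * d :: complex)"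
  by (simp add: cbilinear_def clinear_iff scaleC_complex_def algebra_simps)

lemma cbilinear_pure: "cbilinear (\<otimes>\<^sub>C)"
  unfolding cbilinear_def clinear_iff by (intro conjI allI; transfer) (auto intro: tensor_rel.intros)

lemmas [lin] = clinear_compose_left[OF cbilinear_scaleC]
  clinear_compose_left[OF cbilinear_times_complex] clinear_compose_right[OF cbilinear_times_complex]
  clinear_compose_left[OF cbilinear_pure] clinear_compose_right[OF cbilinear_pure]

lemmas pure_linear = cbilinear_simps[OF cbilinear_pure]

text \<open>Scalars are absorbed into a tensor factor, so that every tensor is a sum of pure tensors.\<close>

lemma tensor_induct [case_names pure add]:
  assumes pure: "\<And>a b. P (a \<otimes>\<^sub>C b)" and add: "\<And>s t. P s \<Longrightarrow> P t \<Longrightarrow> P (s + t)"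
  shows "P t"
proof -
  have "P (c *\<^sub>C abs_tensor e)" for c e
  proof (induction e arbitrary: c)
    case (TPure a b)
    have "c *\<^sub>C abs_tensor (TPure a b) = (c *\<^sub>C a) \<otimes>\<^sub>C b"
      by (simp add: pure_linear) (simp add: tensor_pure.abs_eq)
    then show ?case using pure by metis
  next
    case TZero
    have "c *\<^sub>C abs_tensor TZero = 0 \<otimes>\<^sub>C 0"
      by (simp add: pure_linear flip: zero_tensor.abs_eq)
    then show ?case using pure by metis
  next
    case (TAdd e1 e2)
    then have "P (c *\<^sub>C abs_tensor e1 + c *\<^sub>C abs_tensor e2)" using add by blast
    then show ?case by (simp add: scaleC_add_right flip: plus_tensor.abs_eq)
  next
    case (TScale d e)
    then show ?case by (simp add: scaleC_scaleC flip: scaleC_tensor.abs_eq)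
  qed
  from this[of 1] show ?thesis
    by (metis scaleC_one tensor.abs_induct)
qed

lemma sweedler_apply: "clinear L \<Longrightarrow> L (sweedler t \<phi>) = sweedler t (\<lambda>a b. L (\<phi> a b))"
proof -
  assume L: "clinear L"
  have "L (tensor_eval \<phi> e) = tensor_eval (\<lambda>a b. L (\<phi> a b)) e" for e
    by (induction e) (simp_all add: L clinear_add clinear_scale clinear_zero)
  then show ?thesis by (simp add: sweedler_def)
qed

lemma sweedler_cong: "(\<And>a b. \<phi> a b = \<psi> a b) \<Longrightarrow> sweedler t \<phi> = sweedler t \<psi>"
  by presburger

lemma sweedler_add: "sweedler t (\<lambda>a b. \<phi> a b + \<psi> a b) = sweedler t \<phi> + sweedler t \<psi>"
proof -
  have "tensor_eval (\<lambda>a b. \<phi> a b + \<psi> a b) e = tensor_eval \<phi> e + tensor_eval \<psi> e" for e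
    by (induction e) (simp_all add: scaleC_add_right)
  then show ?thesis by (simp add: sweedler_def)
qed

lemma sweedler_zero: "sweedler t (\<lambda>a b. 0) = 0"
  using sweedler_apply[of "\<lambda>x. 0" t "\<lambda>a b. 0"] by (simp add: lin)

lemma sweedler_minus: "sweedler t (\<lambda>a b. - \<phi> a b) = - sweedler t \<phi>"
  using sweedler_apply[of "\<lambda>x. - x" t \<phi>] by (simp add: lin)

lemma sweedler_diff: "sweedler t (\<lambda>a b. \<phi> a b - \<psi> a b) = sweedler t \<phi> - sweedler t \<psi>"
  using sweedler_add[of t \<phi> "\<lambda>a b. - \<psi> a b"] by (simp add: sweedler_minus)

lemma sweedler_scale: "sweedler t (\<lambda>a b. c *\<^sub>C \<phi> a b) = c *\<^sub>C sweedler t \<phi>"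
  using sweedler_apply[of "\<lambda>x. c *\<^sub>C x" t \<phi>] by (simp add: lin)

text \<open>Fubini's theorem for Sweedler sums. In simplification it is used with \<open>s\<close> or \<open>t\<close> fixed, which
  moves one particular sum inwards or outwards.\<close>

lemma sweedler_swap:
  "sweedler s (\<lambda>a b. sweedler t (\<lambda>c d. \<phi> a b c d)) = sweedler t (\<lambda>c d. sweedler s (\<lambda>a b. \<phi> a b c d))"
proof -
  have "tensor_eval (\<lambda>a b. sweedler t (\<lambda>c d. \<phi> a b c d)) e
      = sweedler t (\<lambda>c d. tensor_eval (\<lambda>a b. \<phi> a b c d) e)" for e
    by (induction e) (simp_all add: sweedler_zero sweedler_add sweedler_scale)
  then show ?thesis by (simp add: sweedler_def)
qed

lemma [lin]: "(\<And>a b. clinear (\<lambda>x. \<phi> x a b)) \<Longrightarrow> clinear (\<lambda>x. sweedler t (\<phi> x))"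
  unfolding clinear_iff
  by (auto simp: sweedler_add[symmetric] sweedler_scale[symmetric] intro!: arg_cong[of _ _ "sweedler t"] ext)

lemma [lin]: "cbilinear \<phi> \<Longrightarrow> clinear T \<Longrightarrow> clinear (\<lambda>x. sweedler (T x) \<phi>)"
  by (rule clinear_compose[OF sweedler_linear])

lemma [push]:
  "c *\<^sub>C sweedler t \<phi> = sweedler t (\<lambda>a b. c *\<^sub>C \<phi> a b)"
  "sweedler t \<chi> *\<^sub>C x = sweedler t (\<lambda>a b. \<chi> a b *\<^sub>C x)"
  "- sweedler t \<phi> = sweedler t (\<lambda>a b. - \<phi> a b)"
  "sweedler t \<psi> \<otimes>\<^sub>C y = sweedler t (\<lambda>a b. \<psi> a b \<otimes>\<^sub>C y)"
  "y \<otimes>\<^sub>C sweedler t \<psi> = sweedler t (\<lambda>a b. y \<otimes>\<^sub>C \<psi> a b)"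
  "cbilinear \<omega> \<Longrightarrow> sweedler (sweedler t \<theta>) \<omega> = sweedler t (\<lambda>a b. sweedler (\<theta> a b) \<omega>)"
  by (rule sweedler_apply; simp add: lin)+

lemma sweedler_tensor_linear:
  assumes "cbilinear \<phi>"
  shows "sweedler (s + t) \<phi> = sweedler s \<phi> + sweedler t \<phi>"
    "sweedler (s - t) \<phi> = sweedler s \<phi> - sweedler t \<phi>"
    "sweedler (- t) \<phi> = - sweedler t \<phi>"
    "sweedler 0 \<phi> = 0"
    "sweedler (c *\<^sub>C t) \<phi> = c *\<^sub>C sweedler t \<phi>"
    "sweedler (\<Sum>i\<in>I. g i) \<phi> = (\<Sum>i\<in>I. sweedler (g i) \<phi>)"
  using sweedler_linear[OF assms]
  by (rule clinear_add clinear_diff clinear_minus clinear_zero clinear_scale clinear_sum)+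

lemma sweedler_id: "sweedler t (\<otimes>\<^sub>C) = t"
  by (induction t rule: tensor_induct)
    (simp_all add: sweedler_pure sweedler_tensor_linear cbilinear_pure)

definition tensor_mul ::
  "('a::complex_vector \<Rightarrow> 'a \<Rightarrow> 'a) \<Rightarrow> ('b::complex_vector \<Rightarrow> 'b \<Rightarrow> 'b)
    \<Rightarrow> ('a, 'b) tensor \<Rightarrow> ('a, 'b) tensor \<Rightarrow> ('a, 'b) tensor"
  where "tensor_mul m n s t = sweedler s (\<lambda>a b. sweedler t (\<lambda>c d. m a c \<otimes>\<^sub>C n b d))"

context algebra_over_complex
begin

lemmas [lin] = clinear_compose_left[OF mul_bilinear] clinear_compose_right[OF mul_bilinear]

lemmas mul_push [push] =
  sweedler_apply[OF cbilinear_left, OF mul_bilinear]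
  sweedler_apply[OF cbilinear_right, OF mul_bilinear]

lemmas mul_linear = cbilinear_simps[OF mul_bilinear]

end

lemma tensor_mul_bilinear:
  assumes "cbilinear m" "cbilinear n"
  shows "cbilinear (tensor_mul m n)"
  unfolding tensor_mul_def
  by (intro cbilinearI lin clinear_compose_left[OF assms(1)] clinear_compose_left[OF assms(2)]
     clinear_compose_right[OF assms(1)] clinear_compose_right[OF assms(2)])

lemma tensor_mul_pure:
  assumes "cbilinear m" "cbilinear n"
  shows "tensor_mul m n (a \<otimes>\<^sub>C b) (c \<otimes>\<^sub>C d) = m a c \<otimes>\<^sub>C n b d"
  unfolding tensor_mul_def
  by (simp add: sweedler_pure cbilinear_def lin assms[THEN cbilinear_left, THEN clinear_compose]
     assms[THEN cbilinear_right, THEN clinear_compose] )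

lemma tensor_algebra:
  assumes "algebra_over_complex m e" "algebra_over_complex n e'"
  shows "algebra_over_complex (tensor_mul m n) (e \<otimes>\<^sub>C e')"
proof -
  interpret A: algebra_over_complex m e by fact
  interpret B: algebra_over_complex n e' by fact
  note bil = tensor_mul_bilinear[OF A.mul_bilinear B.mul_bilinear]
  note on_pure = tensor_mul_pure[OF A.mul_bilinear B.mul_bilinear]
  note add = clinear_add[OF cbilinear_left, OF bil] clinear_add[OF cbilinear_right, OF bil]
  show ?thesis
  proof
    show "cbilinear (tensor_mul m n)" by (rule bil)
    show "tensor_mul m n (tensor_mul m n s t) u = tensor_mul m n s (tensor_mul m n t u)" for s t u
    proof (induction s rule: tensor_induct)
      case (pure a b)
      show ?case
      proof (induction t rule: tensor_induct)
        case (pure c d)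
        show ?case
          by (induction u rule: tensor_induct) (simp_all add: on_pure add A.mul_assoc B.mul_assoc)
      qed (simp add: add)
    qed (simp add: add)
    show "tensor_mul m n (e \<otimes>\<^sub>C e') t = t" "tensor_mul m n t (e \<otimes>\<^sub>C e') = t" for t
      by (induction t rule: tensor_induct)
        (simp_all add: on_pure add A.mul_one_left B.mul_one_left A.mul_one_right B.mul_one_right)
  qed
qed

section \<open>Coalgebras and antipodes\<close>

context coalgebra_over_complex
begin

lemmas [lin] = clinear_compose[OF comul_linear]
lemmas [lin] = clinear_compose[OF counit_linear]
lemmas comul_push [push] = sweedler_apply[OF comul_linear]
lemmas counit_push [push] = sweedler_apply[OF counit_linear]

lemma coassoc_sweedler:
  assumes "\<And>b c. clinear (\<lambda>a. \<phi> a b c)" "\<And>a c. clinear (\<lambda>b. \<phi> a b c)"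
    "\<And>a b. clinear (\<lambda>c. \<phi> a b c)"
  shows "sweedler (\<Delta> h) (\<lambda>x c. sweedler (\<Delta> x) (\<lambda>a b. \<phi> a b c))
    = sweedler (\<Delta> h) (\<lambda>a y. sweedler (\<Delta> y) (\<lambda>b c. \<phi> a b c))"
proof -
  note [lin] = assms[THEN clinear_compose]
  let ?L = "\<lambda>t. sweedler t (\<lambda>a s. sweedler s (\<lambda>b c. \<phi> a b c))"
  have L: "clinear ?L" by (intro cbilinearI lin)
  show ?thesis
    using arg_cong[OF coassoc, of ?L h]
    by (simp add: push sweedler_pure cbilinear_def lin)
qed

end

text \<open>An algebra with a multiplicative comultiplication and counit, before coassociativity and the counit
  laws are known. The lemmas of this locale show that the remaining axioms of a Hopf algebra hold on
  a subalgebra, so that they can be checked on generators.\<close>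

locale multiplicative_comultiplication = algebra_over_complex mul one
  for mul :: "'h::complex_vector \<Rightarrow> 'h \<Rightarrow> 'h" and one :: 'h +
  fixes \<Delta> :: "'h \<Rightarrow> ('h, 'h) tensor" and \<epsilon> :: "'h \<Rightarrow> complex"
  assumes comultiplication_linear: "clinear \<Delta>"
    and comultiplication_mul: "\<Delta> (mul g h) =
      sweedler (\<Delta> g) (\<lambda>g1 g2. sweedler (\<Delta> h) (\<lambda>h1 h2. mul g1 h1 \<otimes>\<^sub>C mul g2 h2))"
    and character_linear: "clinear \<epsilon>"
    and character_mul: "\<epsilon> (mul g h) = \<epsilon> g * \<epsilon> h"
begin

lemma comul_mul_sweedler:
  assumes "cbilinear \<phi>"
  shows "sweedler (\<Delta> (mul g h)) \<phi> =
    sweedler (\<Delta> g) (\<lambda>g1 g2. sweedler (\<Delta> h) (\<lambda>h1 h2. \<phi> (mul g1 h1) (mul g2 h2)))"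
proof -
  note [lin] = clinear_compose_left[OF assms] clinear_compose_right[OF assms]
  show ?thesis
    unfolding comultiplication_mul by (simp add: push sweedler_pure assms lin)
qed

text \<open>Both sides of coassociativity define algebra homomorphisms into the threefold tensor power.\<close>

lemma coassoc_mul:
  assumes g: "sweedler (\<Delta> g) (\<lambda>x c. sweedler (\<Delta> x) (\<lambda>a b. a \<otimes>\<^sub>C b \<otimes>\<^sub>C c))
      = sweedler (\<Delta> g) (\<lambda>a y. sweedler (\<Delta> y) (\<lambda>b c. a \<otimes>\<^sub>C b \<otimes>\<^sub>C c))"
    and h: "sweedler (\<Delta> h) (\<lambda>x c. sweedler (\<Delta> x) (\<lambda>a b. a \<otimes>\<^sub>C b \<otimes>\<^sub>C c))
      = sweedler (\<Delta> h) (\<lambda>a y. sweedler (\<Delta> y) (\<lambda>b c. a \<otimes>\<^sub>C b \<otimes>\<^sub>C c))"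
  shows "sweedler (\<Delta> (mul g h)) (\<lambda>x c. sweedler (\<Delta> x) (\<lambda>a b. a \<otimes>\<^sub>C b \<otimes>\<^sub>C c))
      = sweedler (\<Delta> (mul g h)) (\<lambda>a y. sweedler (\<Delta> y) (\<lambda>b c. a \<otimes>\<^sub>C b \<otimes>\<^sub>C c))"
proof -
  let ?m2 = "tensor_mul mul mul" and ?m3 = "tensor_mul mul (tensor_mul mul mul)"
  interpret T2: algebra_over_complex ?m2 "one \<otimes>\<^sub>C one"
    by (rule tensor_algebra) unfold_locales
  interpret T3: algebra_over_complex ?m3 "one \<otimes>\<^sub>C one \<otimes>\<^sub>C one"
    by (rule tensor_algebra) unfold_locales
  note [lin] = clinear_compose[OF comultiplication_linear]
  note pure2 = tensor_mul_pure[OF mul_bilinear mul_bilinear]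
  note pure3 = tensor_mul_pure[OF mul_bilinear T2.mul_bilinear]
  let ?L = "\<lambda>h. sweedler (\<Delta> h) (\<lambda>x c. sweedler (\<Delta> x) (\<lambda>a b. a \<otimes>\<^sub>C b \<otimes>\<^sub>C c))"
  let ?R = "\<lambda>h. sweedler (\<Delta> h) (\<lambda>a y. sweedler (\<Delta> y) (\<lambda>b c. a \<otimes>\<^sub>C b \<otimes>\<^sub>C c))"
  have "?L (mul g h) = ?m3 (?L g) (?L h)"
    by (simp only: T3.mul_push(1), simp only: T3.mul_push(2))
      (simp add: comul_mul_sweedler cbilinear_def lin pure2 pure3 sweedler_swap[of "\<Delta> h"])
  moreover have "?R (mul g h) = ?m3 (?R g) (?R h)"
    by (simp only: T3.mul_push(1), simp only: T3.mul_push(2))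
      (simp add: comul_mul_sweedler cbilinear_def lin pure2 pure3 sweedler_swap[of "\<Delta> h"])
  ultimately show ?thesis by (simp only: g h)
qed

lemma counit_mul_laws:
  shows "sweedler (\<Delta> g) (\<lambda>x y. \<epsilon> x *\<^sub>C y) = g \<Longrightarrow> sweedler (\<Delta> h) (\<lambda>x y. \<epsilon> x *\<^sub>C y) = h
      \<Longrightarrow> sweedler (\<Delta> (mul g h)) (\<lambda>x y. \<epsilon> x *\<^sub>C y) = mul g h"
    and "sweedler (\<Delta> g) (\<lambda>x y. \<epsilon> y *\<^sub>C x) = g \<Longrightarrow> sweedler (\<Delta> h) (\<lambda>x y. \<epsilon> y *\<^sub>C x) = h
      \<Longrightarrow> sweedler (\<Delta> (mul g h)) (\<lambda>x y. \<epsilon> y *\<^sub>C x) = mul g h"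
proof -
  note [lin] = clinear_compose[OF character_linear]
  have "sweedler (\<Delta> (mul g h)) (\<lambda>x y. \<epsilon> x *\<^sub>C y)
      = mul (sweedler (\<Delta> g) (\<lambda>x y. \<epsilon> x *\<^sub>C y)) (sweedler (\<Delta> h) (\<lambda>x y. \<epsilon> x *\<^sub>C y))"
    by (simp only: mul_push(1), simp only: mul_push(2))
      (simp add: comul_mul_sweedler cbilinear_def lin character_mul mul_linear scaleC_scaleC mult.commute)
  then show "sweedler (\<Delta> g) (\<lambda>x y. \<epsilon> x *\<^sub>C y) = g \<Longrightarrow> sweedler (\<Delta> h) (\<lambda>x y. \<epsilon> x *\<^sub>C y) = h
      \<Longrightarrow> sweedler (\<Delta> (mul g h)) (\<lambda>x y. \<epsilon> x *\<^sub>C y) = mul g h" by simp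
  have "sweedler (\<Delta> (mul g h)) (\<lambda>x y. \<epsilon> y *\<^sub>C x)
      = mul (sweedler (\<Delta> g) (\<lambda>x y. \<epsilon> y *\<^sub>C x)) (sweedler (\<Delta> h) (\<lambda>x y. \<epsilon> y *\<^sub>C x))"
    by (simp only: mul_push(1), simp only: mul_push(2))
      (simp add: comul_mul_sweedler cbilinear_def lin character_mul mul_linear scaleC_scaleC mult.commute)
  then show "sweedler (\<Delta> g) (\<lambda>x y. \<epsilon> y *\<^sub>C x) = g \<Longrightarrow> sweedler (\<Delta> h) (\<lambda>x y. \<epsilon> y *\<^sub>C x) = h
      \<Longrightarrow> sweedler (\<Delta> (mul g h)) (\<lambda>x y. \<epsilon> y *\<^sub>C x) = mul g h" by simp
qed

text \<open>If \<open>S\<close> reverses products, then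
  \<open>S ((gh)\<^sub>1) (gh)\<^sub>2 = S h\<^sub>1 (S g\<^sub>1 g\<^sub>2) h\<^sub>2\<close>, and the two antipode laws can be applied one after the other.\<close>

lemma antipode_mul_laws:
  assumes S: "clinear S" "\<And>g h. S (mul g h) = mul (S h) (S g)"
  shows "sweedler (\<Delta> g) (\<lambda>x y. mul (S x) y) = \<epsilon> g *\<^sub>C one
      \<Longrightarrow> sweedler (\<Delta> h) (\<lambda>x y. mul (S x) y) = \<epsilon> h *\<^sub>C one
      \<Longrightarrow> sweedler (\<Delta> (mul g h)) (\<lambda>x y. mul (S x) y) = \<epsilon> (mul g h) *\<^sub>C one"
    and "sweedler (\<Delta> g) (\<lambda>x y. mul x (S y)) = \<epsilon> g *\<^sub>C one
      \<Longrightarrow> sweedler (\<Delta> h) (\<lambda>x y. mul x (S y)) = \<epsilon> h *\<^sub>C one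
      \<Longrightarrow> sweedler (\<Delta> (mul g h)) (\<lambda>x y. mul x (S y)) = \<epsilon> (mul g h) *\<^sub>C one"
proof -
  note [lin] = clinear_compose[OF S(1)]
  have "sweedler (\<Delta> (mul g h)) (\<lambda>x y. mul (S x) y)
      = sweedler (\<Delta> h) (\<lambda>h1 h2. mul (S h1) (mul (sweedler (\<Delta> g) (\<lambda>x y. mul (S x) y)) h2))"
    by (simp add: comul_mul_sweedler cbilinear_def lin S(2) mul_push mul_assoc sweedler_swap[of "\<Delta> h"])
  then show "sweedler (\<Delta> g) (\<lambda>x y. mul (S x) y) = \<epsilon> g *\<^sub>C one
      \<Longrightarrow> sweedler (\<Delta> h) (\<lambda>x y. mul (S x) y) = \<epsilon> h *\<^sub>C one
      \<Longrightarrow> sweedler (\<Delta> (mul g h)) (\<lambda>x y. mul (S x) y) = \<epsilon> (mul g h) *\<^sub>C one"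
    by (simp add: mul_linear mul_one_left sweedler_scale scaleC_scaleC character_mul)
  have "sweedler (\<Delta> (mul g h)) (\<lambda>x y. mul x (S y))
      = sweedler (\<Delta> g) (\<lambda>g1 g2. mul g1 (mul (sweedler (\<Delta> h) (\<lambda>x y. mul x (S y))) (S g2)))"
    by (simp add: comul_mul_sweedler cbilinear_def lin S(2) mul_push mul_assoc)
  then show "sweedler (\<Delta> g) (\<lambda>x y. mul x (S y)) = \<epsilon> g *\<^sub>C one
      \<Longrightarrow> sweedler (\<Delta> h) (\<lambda>x y. mul x (S y)) = \<epsilon> h *\<^sub>C one
      \<Longrightarrow> sweedler (\<Delta> (mul g h)) (\<lambda>x y. mul x (S y)) = \<epsilon> (mul g h) *\<^sub>C one"
    by (simp add: mul_linear mul_one_left sweedler_scale scaleC_scaleC character_mul mult.commute)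
qed

end

text \<open>The hypotheses say that \<open>F\<close> is a left and \<open>W\<close> a right inverse of \<open>G\<close> in the convolution algebra of
  linear maps, and \<open>F = F * (G * W) = (F * G) * W = W\<close>.\<close>

lemma (in coalgebra_over_complex) convolution_inverse_unique:
  assumes "algebra_over_complex m e" and [THEN clinear_compose, lin]: "clinear F" "clinear G" "clinear W"
    and FG: "\<And>h. sweedler (\<Delta> h) (\<lambda>x y. m (F x) (G y)) = \<epsilon> h *\<^sub>C e"
    and GW: "\<And>h. sweedler (\<Delta> h) (\<lambda>x y. m (G x) (W y)) = \<epsilon> h *\<^sub>C e"
  shows "F h = W h"
proof -
  interpret A: algebra_over_complex m e by fact
  have "F h = F (sweedler (\<Delta> h) (\<lambda>x y. \<epsilon> y *\<^sub>C x))" by (simp add: counit_right)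
  also have "\<dots> = sweedler (\<Delta> h) (\<lambda>x y. m (F x) (\<epsilon> y *\<^sub>C e))"
    by (simp add: sweedler_apply[OF assms(2)] clinear_scale[OF assms(2)] A.mul_linear A.mul_one_right)
  also have "\<dots> = sweedler (\<Delta> h) (\<lambda>x y. sweedler (\<Delta> y) (\<lambda>a b. m (F x) (m (G a) (W b))))"
    by (simp add: A.mul_push flip: GW)
  also have "\<dots> = sweedler (\<Delta> h) (\<lambda>x y. sweedler (\<Delta> x) (\<lambda>a b. m (F a) (m (G b) (W y))))"
    by (rule coassoc_sweedler[symmetric]) (intro lin)+
  also have "\<dots> = sweedler (\<Delta> h) (\<lambda>x y. m (\<epsilon> x *\<^sub>C e) (W y))"
    by (simp add: A.mul_push flip: FG A.mul_assoc)
  also have "\<dots> = W (sweedler (\<Delta> h) (\<lambda>x y. \<epsilon> x *\<^sub>C y))"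
    by (simp add: sweedler_apply[OF assms(4)] clinear_scale[OF assms(4)] A.mul_linear A.mul_one_left)
  finally show ?thesis by (simp add: counit_left)
qed

context hopf_algebra
begin

lemmas [lin] = clinear_compose[OF antipode_linear]
lemmas antipode_push [push] = sweedler_apply[OF antipode_linear]

sublocale multiplicative_comultiplication mul one \<Delta> \<epsilon>
  by (intro multiplicative_comultiplication.intro multiplicative_comultiplication_axioms.intro
      algebra_over_complex_axioms comul_linear comul_mul counit_linear counit_mul)

lemma comul_one_sweedler:
  "cbilinear \<phi> \<Longrightarrow> sweedler (\<Delta> one) \<phi> = \<phi> one one"
  by (simp add: comul_one sweedler_pure)

lemma antipode_cancel:
  assumes L: "clinear L"
  shows "sweedler (\<Delta> h) (\<lambda>x y. L (mul (S x) y)) = \<epsilon> h *\<^sub>C L one"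
    "sweedler (\<Delta> h) (\<lambda>x y. L (mul x (S y))) = \<epsilon> h *\<^sub>C L one"
  by (simp_all add: antipode_left antipode_right clinear_scale[OF L] flip: sweedler_apply[OF L])

lemma counit_cancel:
  assumes L: "clinear L"
  shows "sweedler (\<Delta> h) (\<lambda>x y. \<epsilon> x *\<^sub>C L y) = L h"
    "sweedler (\<Delta> h) (\<lambda>x y. \<epsilon> y *\<^sub>C L x) = L h"
  by (simp_all add: counit_left counit_right flip: clinear_scale[OF L] sweedler_apply[OF L])

lemma antipode_one: "S one = one"
  using antipode_left[of one]
  by (simp add: comul_one_sweedler cbilinear_def lin mul_one_right counit_one scaleC_one)

lemma counit_antipode: "\<epsilon> (S h) = \<epsilon> h"
proof -
  have "\<epsilon> (S h) = sweedler (\<Delta> h) (\<lambda>x y. \<epsilon> y *\<^sub>C \<epsilon> (S x))"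
    by (simp add: counit_cancel lin)
  also have "\<dots> = sweedler (\<Delta> h) (\<lambda>x y. \<epsilon> (mul (S x) y))"
    by (simp add: counit_mul scaleC_complex_def mult.commute)
  also have "\<dots> = \<epsilon> h"
    by (simp add: antipode_cancel lin counit_one scaleC_complex_def)
  finally show ?thesis .
qed

text \<open>The product \<open>g\<^sub>2 h\<^sub>2 S h\<^sub>3 S g\<^sub>3\<close> collapses from the inside to a scalar; inserting it behind
  \<open>S (g\<^sub>1 h\<^sub>1)\<close> and collapsing the other way round, with \<open>S ((gh)\<^sub>1) (gh)\<^sub>2\<close>, leaves \<open>S h S g\<close>.\<close>

lemma antipode_mul: "S (mul g h) = mul (S h) (S g)"
proof -
  let ?E = "\<lambda>g1 g2 g3 h1 h2 h3. mul (S (mul g1 h1)) (mul g2 (mul h2 (mul (S h3) (S g3))))"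
  have h: "sweedler (\<Delta> h') (\<lambda>h2 h3. ?E g1 g2 g3 h1 h2 h3)
      = \<epsilon> h' *\<^sub>C mul (S (mul g1 h1)) (mul g2 (S g3))" for g1 g2 g3 h1 h'
    using antipode_cancel(2)[of "\<lambda>z. mul (S (mul g1 h1)) (mul g2 (mul z (S g3)))"]
    by (simp add: lin mul_assoc mul_one_left)
  have g: "sweedler (\<Delta> g') (\<lambda>g2 g3. mul (S (mul g1 h)) (mul g2 (S g3))) = \<epsilon> g' *\<^sub>C S (mul g1 h)"
    for g1 g'
    using antipode_cancel(2)[of "\<lambda>z. mul (S (mul g1 h)) z"] by (simp add: lin mul_one_right)
  have "S (mul g h) = sweedler (\<Delta> g) (\<lambda>g1 g'. sweedler (\<Delta> g') (\<lambda>g2 g3.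
      sweedler (\<Delta> h) (\<lambda>h1 h'. sweedler (\<Delta> h') (\<lambda>h2 h3. ?E g1 g2 g3 h1 h2 h3))))"
    by (simp add: h g counit_cancel lin)
  also have "\<dots> = sweedler (\<Delta> g) (\<lambda>x g3. sweedler (\<Delta> x) (\<lambda>g1 g2.
      sweedler (\<Delta> h) (\<lambda>h1 h'. sweedler (\<Delta> h') (\<lambda>h2 h3. ?E g1 g2 g3 h1 h2 h3))))"
    by (rule coassoc_sweedler[symmetric]) (intro lin)+
  also have "\<dots> = sweedler (\<Delta> g) (\<lambda>x g3. sweedler (\<Delta> x) (\<lambda>g1 g2.
      sweedler (\<Delta> h) (\<lambda>y h3. sweedler (\<Delta> y) (\<lambda>h1 h2. ?E g1 g2 g3 h1 h2 h3))))"
    by (rule sweedler_cong, rule sweedler_cong, rule coassoc_sweedler[symmetric]) (intro lin)+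
  also have "\<dots> = sweedler (\<Delta> g) (\<lambda>x g3. sweedler (\<Delta> h) (\<lambda>y h3.
      sweedler (\<Delta> (mul x y)) (\<lambda>p q. mul (mul (S p) q) (mul (S h3) (S g3)))))"
    by (simp add: comul_mul_sweedler cbilinear_def lin mul_assoc sweedler_swap[of "\<Delta> h"])
  also have "\<dots> = sweedler (\<Delta> g) (\<lambda>x g3. sweedler (\<Delta> h) (\<lambda>y h3.
      \<epsilon> x *\<^sub>C \<epsilon> y *\<^sub>C mul (S h3) (S g3)))"
    by (simp add: antipode_cancel(1)[of "\<lambda>z. mul z (mul (S _) (S _))"] lin mul_one_left counit_mul
        scaleC_scaleC scaleC_complex_def)
  also have "\<dots> = mul (S h) (S g)"
    by (simp add: sweedler_scale counit_cancel lin del: scaleC_scaleC)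
  finally show ?thesis .
qed

text \<open>Both sides are convolution inverses of the comultiplication, as maps into the tensor square.\<close>

lemma comul_antipode: "\<Delta> (S h) = sweedler (\<Delta> h) (\<lambda>x y. S y \<otimes>\<^sub>C S x)"
proof (rule convolution_inverse_unique[where G = \<Delta>])
  let ?m = "tensor_mul mul mul"
  show T: "algebra_over_complex ?m (one \<otimes>\<^sub>C one)" by (rule tensor_algebra) unfold_locales
  interpret T: algebra_over_complex ?m "one \<otimes>\<^sub>C one" by fact
  note pure = tensor_mul_pure[OF mul_bilinear mul_bilinear]
  show "clinear (\<lambda>h. \<Delta> (S h))" "clinear \<Delta>" "clinear (\<lambda>h. sweedler (\<Delta> h) (\<lambda>x y. S y \<otimes>\<^sub>C S x))"
    by (intro lin cbilinearI)+
  show "sweedler (\<Delta> h) (\<lambda>x y. ?m (\<Delta> (S x)) (\<Delta> y)) = \<epsilon> h *\<^sub>C (one \<otimes>\<^sub>C one)" for h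
  proof -
    have "?m (\<Delta> x) (\<Delta> y) = \<Delta> (mul x y)" for x y
      by (simp add: comul_mul tensor_mul_def)
    then show ?thesis by (simp add: antipode_cancel lin comul_one)
  qed
  show "sweedler (\<Delta> h) (\<lambda>x y. ?m (\<Delta> x) (sweedler (\<Delta> y) (\<lambda>x y. S y \<otimes>\<^sub>C S x)))
      = \<epsilon> h *\<^sub>C (one \<otimes>\<^sub>C one)" for h
  proof -
    have "sweedler (\<Delta> h) (\<lambda>x y. ?m (\<Delta> x) (sweedler (\<Delta> y) (\<lambda>x y. S y \<otimes>\<^sub>C S x)))
      = sweedler (\<Delta> h) (\<lambda>x y. sweedler (\<Delta> x) (\<lambda>a b.
          sweedler (\<Delta> y) (\<lambda>c d. mul a (S d) \<otimes>\<^sub>C mul b (S c))))"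
      by (simp add: tensor_mul_def push sweedler_pure cbilinear_def lin)
    also have "\<dots> = sweedler (\<Delta> h) (\<lambda>a y. sweedler (\<Delta> y) (\<lambda>b z.
          sweedler (\<Delta> z) (\<lambda>c d. mul a (S d) \<otimes>\<^sub>C mul b (S c))))"
      by (rule coassoc_sweedler) (intro lin cbilinearI)+
    also have "\<dots> = sweedler (\<Delta> h) (\<lambda>a y. sweedler (\<Delta> y) (\<lambda>p d.
          sweedler (\<Delta> p) (\<lambda>b c. mul a (S d) \<otimes>\<^sub>C mul b (S c))))"
      by (rule sweedler_cong, rule coassoc_sweedler[symmetric]) (intro lin cbilinearI)+
    also have "\<dots> = \<epsilon> h *\<^sub>C (one \<otimes>\<^sub>C one)"
      by (simp add: antipode_cancel(2)[of "\<lambda>z. _ \<otimes>\<^sub>C z"] antipode_cancel(2)[of "\<lambda>z. z \<otimes>\<^sub>C _"] counit_cancel lin)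
    finally show ?thesis .
  qed
qed

end

locale commutative_hopf_algebra = hopf_algebra "(*)" 1 \<Delta> \<epsilon> S
  for \<Delta> :: "'f::{comm_ring_1, complex_vector} \<Rightarrow> ('f, 'f) tensor" and \<epsilon> :: "'f \<Rightarrow> complex"
    and S :: "'f \<Rightarrow> 'f"
begin

text \<open>Both \<open>S \<circ> S\<close> and the identity are convolution inverses of \<open>S\<close>; for the first, commutativity turns
  \<open>S (S h\<^sub>1) S h\<^sub>2\<close> into \<open>S (S h\<^sub>1 h\<^sub>2)\<close>.\<close>

lemma antipode_involutive: "S (S h) = h"
proof (rule convolution_inverse_unique[where G = S])
  show "algebra_over_complex (*) (1::'f)" by unfold_locales
  show "clinear (\<lambda>h. S (S h))" "clinear S" "clinear (\<lambda>h::'f. h)" by (intro lin)+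
  show "sweedler (\<Delta> h) (\<lambda>x y. S (S x) * S y) = \<epsilon> h *\<^sub>C 1" for h
  proof -
    have "S (S x) * S y = S (S x * y)" for x y by (simp add: antipode_mul mult.commute)
    then show ?thesis by (simp add: antipode_cancel(1)[OF antipode_linear] antipode_one)
  qed
  show "sweedler (\<Delta> h) (\<lambda>x y. S x * y) = \<epsilon> h *\<^sub>C 1" for h
    by (rule antipode_left)
qed

end

section \<open>Enveloping algebras\<close>

global_interpretation complex_algebra: algebra_over_complex "(*)" "1 :: complex"
  by (rule algebra_over_complex.intro) (simp_all add: cbilinear_times_complex)

lemma uea_mult_bilinear: "cbilinear ((*) :: 'g::lie_algebra uea \<Rightarrow> 'g uea \<Rightarrow> 'g uea)"
  unfolding cbilinear_def clinear_iff by (intro conjI allI; transfer) (auto intro: uea_rel.intros)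

global_interpretation uea: algebra_over_complex "(*)" "1 :: 'g::lie_algebra uea"
  by (rule algebra_over_complex.intro) (simp_all add: uea_mult_bilinear mult.assoc)

lemma uea_gen_linear: "clinear (uea_gen :: 'g::lie_algebra \<Rightarrow> 'g uea)"
  unfolding clinear_iff by (intro conjI allI; transfer) (auto intro: uea_rel.intros)

lemmas [lin] = clinear_compose[OF uea_gen_linear]

lemma uea_gen_bracket:
  "uea_gen (lie_bracket x y) = uea_gen x * uea_gen y - uea_gen y * uea_gen x"
  by transfer (rule uea_rel.gen_bracket)

text \<open>The enveloping algebra is spanned by products of generators, built up by multiplication from the
  left.\<close>

lemma uea_induct [case_names one gen add scale]:
  fixes u :: "'g::lie_algebra uea"
  assumes one: "P 1" and gen: "\<And>x u. P u \<Longrightarrow> P (uea_gen x * u)"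
    and add: "\<And>u v. P u \<Longrightarrow> P v \<Longrightarrow> P (u + v)" and scale: "\<And>c u. P u \<Longrightarrow> P (c *\<^sub>C u)"
  shows "P u"
proof -
  have "P (abs_uea e * v)" if "P v" for e v
    using that
  proof (induction e arbitrary: v)
    case (UGen x)
    then show ?case using gen by (simp flip: uea_gen.abs_eq)
  next
    case UZero
    then show ?case using scale[of v 0] by (simp flip: zero_uea.abs_eq)
  next
    case UOne
    then show ?case by (simp flip: one_uea.abs_eq)
  next
    case (UAdd e1 e2)
    then show ?case using add by (simp add: distrib_right flip: plus_uea.abs_eq)
  next
    case (UScale c e)
    then show ?case using scale by (simp add: uea.mul_linear flip: scaleC_uea.abs_eq)
  next
    case (UMul e1 e2)
    then show ?case by (simp add: mult.assoc flip: times_uea.abs_eq)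
  qed
  from this[OF one] show ?thesis by (metis mult_1_right uea.abs_induct)
qed

lemma uea_linear_eqI:
  fixes L L' :: "'g::lie_algebra uea \<Rightarrow> 'a::complex_vector"
  assumes "clinear L" "clinear L'" "L 1 = L' 1"
    and "\<And>x u. L u = L' u \<Longrightarrow> L (uea_gen x * u) = L' (uea_gen x * u)"
  shows "L u = L' u"
  by (induction u rule: uea_induct) (simp_all add: assms clinear_add clinear_scale)

lemma
  fixes x :: "'g::lie_algebra" and u v :: "'g uea"
  shows uea_comult_gen: "uea_comult (uea_gen x) = uea_gen x \<otimes>\<^sub>C 1 + 1 \<otimes>\<^sub>C uea_gen x"
    and uea_comult_one: "uea_comult (1 :: 'g uea) = 1 \<otimes>\<^sub>C 1"
    and uea_comult_mult: "uea_comult (u * v) = tensor_mul (*) (*) (uea_comult u) (uea_comult v)"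
    and uea_comult_linear: "clinear (uea_comult :: 'g::lie_algebra uea \<Rightarrow> _)"
proof -
  have m: "(\<lambda>s t. sweedler s (\<lambda>a b. sweedler t (\<lambda>c d. (a * c) \<otimes>\<^sub>C (b * d)))) =
      (tensor_mul (*) (*) :: ('g uea, 'g uea) tensor \<Rightarrow> _)"
    by (intro ext) (simp add: tensor_mul_def)
  note def = uea_comult_def[where 'g = 'g, unfolded m]
  have alg: "algebra_over_complex ((tensor_mul (*) (*) :: ('g uea, 'g uea) tensor \<Rightarrow> _)) (1 \<otimes>\<^sub>C 1)"
    by (rule tensor_algebra) (rule uea.algebra_over_complex_axioms)+
  interpret T: algebra_over_complex "(tensor_mul (*) (*) :: ('g uea, 'g uea) tensor \<Rightarrow> _)" "1 \<otimes>\<^sub>C 1" by fact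
  note pure = tensor_mul_pure[OF uea_mult_bilinear uea_mult_bilinear]
  have lin': "clinear (\<lambda>x::'g. uea_gen x \<otimes>\<^sub>C 1 + 1 \<otimes>\<^sub>C uea_gen x)" by (intro lin)
  have br: "uea_gen (lie_bracket x y) \<otimes>\<^sub>C 1 + 1 \<otimes>\<^sub>C uea_gen (lie_bracket x y) =
    tensor_mul (*) (*) (uea_gen x \<otimes>\<^sub>C 1 + 1 \<otimes>\<^sub>C uea_gen x) (uea_gen y \<otimes>\<^sub>C 1 + 1 \<otimes>\<^sub>C uea_gen y)
    - tensor_mul (*) (*) (uea_gen y \<otimes>\<^sub>C 1 + 1 \<otimes>\<^sub>C uea_gen y) (uea_gen x \<otimes>\<^sub>C 1 + 1 \<otimes>\<^sub>C uea_gen x)"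
    for x y :: 'g
    by (simp add: T.mul_linear pure uea_gen_bracket pure_linear)
  note hom = uea_lift_hom[OF alg lin' br]
  show "uea_comult (uea_gen x) = uea_gen x \<otimes>\<^sub>C 1 + 1 \<otimes>\<^sub>C uea_gen x"
    unfolding def by (rule hom)
  show "uea_comult (1 :: 'g uea) = 1 \<otimes>\<^sub>C 1" unfolding def by (rule hom)
  show "uea_comult (u * v) = tensor_mul (*) (*) (uea_comult u) (uea_comult v)"
    unfolding def by (rule hom)
  show "clinear (uea_comult :: 'g::lie_algebra uea \<Rightarrow> _)"
    unfolding def by (rule hom)
qed

lemmas [lin] = clinear_compose[OF uea_comult_linear]

lemma uea_comult_sweedler:
  fixes \<phi> :: "'g::lie_algebra uea \<Rightarrow> 'g uea \<Rightarrow> 'a::complex_vector"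
  assumes "cbilinear \<phi>"
  shows "sweedler (uea_comult 1) \<phi> = \<phi> 1 1"
    and "sweedler (uea_comult (uea_gen x)) \<phi> = \<phi> (uea_gen x) 1 + \<phi> 1 (uea_gen x)"
    and "sweedler (uea_comult (uea_gen x * u)) \<phi>
      = sweedler (uea_comult u) (\<lambda>u1 u2. \<phi> (uea_gen x * u1) u2)
      + sweedler (uea_comult u) (\<lambda>u1 u2. \<phi> u1 (uea_gen x * u2))"
proof -
  note [lin] = clinear_compose_left[OF assms] clinear_compose_right[OF assms]
  note simps = sweedler_pure sweedler_tensor_linear assms lin push
  show "sweedler (uea_comult 1) \<phi> = \<phi> 1 1"
    "sweedler (uea_comult (uea_gen x)) \<phi> = \<phi> (uea_gen x) 1 + \<phi> 1 (uea_gen x)"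
    by (simp_all add: uea_comult_one uea_comult_gen simps)
  show "sweedler (uea_comult (uea_gen x * u)) \<phi>
      = sweedler (uea_comult u) (\<lambda>u1 u2. \<phi> (uea_gen x * u1) u2)
      + sweedler (uea_comult u) (\<lambda>u1 u2. \<phi> u1 (uea_gen x * u2))"
    unfolding uea_comult_mult uea_comult_gen tensor_mul_def
    by (simp add: simps cbilinear_def[of "\<lambda>a b. sweedler _ (_ a b)"])
qed

lemma
  fixes x :: "'g::lie_algebra" and u v :: "'g uea"
  shows uea_counit_gen: "uea_counit (uea_gen x) = 0"
    and uea_counit_one: "uea_counit (1 :: 'g uea) = 1"
    and uea_counit_mult: "uea_counit (u * v) = uea_counit u * uea_counit v"
    and uea_counit_linear: "clinear (uea_counit :: 'g::lie_algebra uea \<Rightarrow> _)"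
proof -
  have "clinear (\<lambda>x::'g. 0 :: complex)" by (intro lin)
  from uea_lift_hom[OF complex_algebra.algebra_over_complex_axioms this]
  have hom: "uea_lift (*) 1 (\<lambda>_. 0 :: complex) (uea_gen x :: 'g uea) = 0"
    "uea_lift (*) 1 (\<lambda>_. 0 :: complex) (1 :: 'g uea) = 1"
    "uea_lift (*) 1 (\<lambda>_. 0 :: complex) (u * v :: 'g uea)
      = uea_lift (*) 1 (\<lambda>_. 0) u * uea_lift (*) 1 (\<lambda>_. 0) v"
    "clinear (uea_lift (*) 1 (\<lambda>_. 0 :: complex) :: 'g uea \<Rightarrow> _)" for x u v
    by simp_all
  show "uea_counit (uea_gen x) = 0" unfolding uea_counit_def by (rule hom)
  show "uea_counit (1 :: 'g uea) = 1" unfolding uea_counit_def by (rule hom)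
  show "uea_counit (u * v) = uea_counit u * uea_counit v"
    unfolding uea_counit_def by (rule hom)
  show "clinear (uea_counit :: 'g uea \<Rightarrow> _)" unfolding uea_counit_def by (rule hom)
qed

lemmas [lin] = clinear_compose[OF uea_counit_linear]

lemma
  fixes x :: "'g::lie_algebra" and u v :: "'g uea"
  shows uea_antipode_gen: "uea_antipode (uea_gen x) = - uea_gen x"
    and uea_antipode_one: "uea_antipode (1 :: 'g uea) = 1"
    and uea_antipode_mult: "uea_antipode (u * v) = uea_antipode v * uea_antipode u"
    and uea_antipode_linear: "clinear (uea_antipode :: 'g::lie_algebra uea \<Rightarrow> _)"
proof -
  have lin': "clinear (\<lambda>x::'g. - uea_gen x)" by (intro lin)
  have alg: "algebra_over_complex (\<lambda>a b. b * a) (1 :: 'g uea)"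
    by (rule algebra_over_complex.intro) (auto simp: mult.assoc intro!: cbilinearI lin)
  note hom = uea_lift_hom[OF alg lin']
  show "uea_antipode (uea_gen x) = - uea_gen x"
    unfolding uea_antipode_def by (rule hom) (simp add: uea_gen_bracket)
  show "uea_antipode (1 :: 'g uea) = 1"
    unfolding uea_antipode_def by (rule hom) (simp add: uea_gen_bracket)
  show "uea_antipode (u * v) = uea_antipode v * uea_antipode u"
    unfolding uea_antipode_def by (rule hom) (simp add: uea_gen_bracket)
  show "clinear (uea_antipode :: 'g uea \<Rightarrow> _)"
    unfolding uea_antipode_def by (rule hom) (simp add: uea_gen_bracket)
qed

lemmas [lin] = clinear_compose[OF uea_antipode_linear]

context lie_module
begin

lemmas [lin] = clinear_compose_left[OF act_bilinear] clinear_compose_right[OF act_bilinear]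
lemmas [push] =
  sweedler_apply[OF cbilinear_left, OF act_bilinear]
  sweedler_apply[OF cbilinear_right, OF act_bilinear]
lemmas act_linear = cbilinear_simps[OF act_bilinear]

lemmas uact_simps = uea_act_gen[OF lie_module_axioms] uea_act_one[OF lie_module_axioms]
  uea_act_mult[OF lie_module_axioms]
lemmas [lin] = clinear_compose_left[OF uea_act_bilinear[OF lie_module_axioms]]
  clinear_compose_right[OF uea_act_bilinear[OF lie_module_axioms]]
lemmas [push] =
  sweedler_apply[OF cbilinear_left, OF uea_act_bilinear[OF lie_module_axioms]]
  sweedler_apply[OF cbilinear_right, OF uea_act_bilinear[OF lie_module_axioms]]
lemmas uact_linear = cbilinear_simps[OF uea_act_bilinear[OF lie_module_axioms]]

end

section \<open>Coordinates and traces\<close>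

lemma lie_bracket_bilinear: "cbilinear lie_bracket"
  by (simp add: cbilinear_def clinear_iff lie_bracket_add_left lie_bracket_scale_left
      lie_bracket_add_right lie_bracket_scale_right)

lemmas [lin] =
  clinear_compose_left[OF lie_bracket_bilinear] clinear_compose_right[OF lie_bracket_bilinear]

lemma lie_bracket_skew: "lie_bracket x y = - lie_bracket y x"
proof -
  have "lie_bracket x y + lie_bracket y x = 0"
    using lie_bracket_self[of "x + y"]
    unfolding lie_bracket_add_left lie_bracket_add_right by (simp add: lie_bracket_self add.commute)
  then show ?thesis by (simp add: eq_neg_iff_add_eq_0)
qed

locale finite_basis =
  fixes N :: nat and X :: "nat \<Rightarrow> 'g::complex_vector"
  assumes basis: "is_basis N X"
begin

lemma coord_linear: "clinear (\<lambda>Y. coord N X Y k)"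
  using basis
  by (auto simp: clinear_iff is_basis_def coord_def cvec.representation_add
      cvec.representation_scale scaleC_complex_def)

lemmas [lin] = clinear_compose[OF coord_linear]

lemma coord_basis: "i < N \<Longrightarrow> j < N \<Longrightarrow> coord N X (X j) i = (if i = j then 1 else 0)"
  using basis cvec.representation_basis[of "X ` {..<N}" "X j"]
  by (auto simp: is_basis_def coord_def inj_on_def)

lemma basis_expansion: "Y = (\<Sum>k<N. coord N X Y k *\<^sub>C X k)"
proof -
  have "(\<Sum>b\<in>X ` {..<N}. cvec.representation (X ` {..<N}) Y b *\<^sub>C b) = Y"
    using basis by (intro cvec.sum_representation_eq) (auto simp: is_basis_def)
  then show ?thesis
    using basis by (simp add: sum.reindex is_basis_def coord_def)
qed

lemma basis_linear_eqI:
  assumes "clinear L" "clinear L'" "\<And>j. j < N \<Longrightarrow> L (X j) = L' (X j)"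
  shows "L Y = L' Y"
  by (subst (1 2) basis_expansion[of Y])
    (simp add: clinear_sum[OF assms(1)] clinear_sum[OF assms(2)] clinear_scale[OF assms(1)]
      clinear_scale[OF assms(2)] assms(3))

definition trace :: "('g \<Rightarrow> 'g) \<Rightarrow> complex"
  where "trace L = (\<Sum>i<N. coord N X (L (X i)) i)"

text \<open>This is what makes the trace of the adjoint representation vanish on brackets, so that it extends
  to a character of the enveloping algebra.\<close>

lemma trace_commute:
  assumes "clinear L" "clinear L'"
  shows "trace (\<lambda>x. L (L' x)) = trace (\<lambda>x. L' (L x))"
proof -
  have *: "trace (\<lambda>x. L (L' x)) = (\<Sum>i<N. \<Sum>k<N. coord N X (L' (X i)) k * coord N X (L (X k)) i)"
    if "clinear L" for L L'
  proof -
    have "coord N X (L (L' (X i))) i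
        = (\<Sum>k<N. coord N X (L' (X i)) k * coord N X (L (X k)) i)" for i
      by (subst basis_expansion[of "L' (X i)"])
        (simp add: clinear_sum[OF that] clinear_scale[OF that] clinear_sum[OF coord_linear]
          clinear_scale[OF coord_linear] scaleC_complex_def)
    then show ?thesis by (simp add: trace_def)
  qed
  show ?thesis
    unfolding *[OF assms(1)] *[OF assms(2)] by (subst sum.swap) (simp add: mult.commute)
qed

end

lemma
  fixes X :: "nat \<Rightarrow> 'g::lie_algebra"
  assumes "is_basis N X"
  shows delta_g_gen: "delta_g N X (uea_gen Y) = (\<Sum>i<N. coord N X (lie_bracket Y (X i)) i)"
    and delta_g_one: "delta_g N X 1 = 1"
    and delta_g_mult: "delta_g N X (u * v) = delta_g N X u * delta_g N X v"
    and delta_g_linear: "clinear (delta_g N X)"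
proof -
  interpret finite_basis N X by unfold_locales fact
  have lin': "clinear (\<lambda>Y. \<Sum>i<N. coord N X (lie_bracket Y (X i)) i)"
    by (intro lin)
  have br: "(\<Sum>i<N. coord N X (lie_bracket (lie_bracket Y Z) (X i)) i)
    = (\<Sum>i<N. coord N X (lie_bracket Y (X i)) i) * (\<Sum>i<N. coord N X (lie_bracket Z (X i)) i)
    - (\<Sum>i<N. coord N X (lie_bracket Z (X i)) i) * (\<Sum>i<N. coord N X (lie_bracket Y (X i)) i)"
    for Y Z
  proof -
    have ad: "lie_bracket (lie_bracket Y Z) W = lie_bracket Y (lie_bracket Z W) - lie_bracket Z (lie_bracket Y W)" for W
      using jacobi[of Y Z W] lie_bracket_skew[of W "lie_bracket Y Z"] lie_bracket_skew[of W Y]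
      by (simp add: clinear_minus[OF cbilinear_right[OF lie_bracket_bilinear]] algebra_simps
          eq_neg_iff_add_eq_0)
    have "trace (\<lambda>x. lie_bracket Y (lie_bracket Z x)) = trace (\<lambda>x. lie_bracket Z (lie_bracket Y x))"
      by (rule trace_commute) (intro lin)+
    then show ?thesis
      by (simp add: ad clinear_diff[OF coord_linear] sum_subtractf trace_def)
  qed
  note hom = uea_lift_hom[OF complex_algebra.algebra_over_complex_axioms lin' br]
  show "delta_g N X (uea_gen Y) = (\<Sum>i<N. coord N X (lie_bracket Y (X i)) i)"
    unfolding delta_g_def by (rule hom)
  show "delta_g N X 1 = 1" unfolding delta_g_def by (rule hom)
  show "delta_g N X (u * v) = delta_g N X u * delta_g N X v" unfolding delta_g_def by (rule hom)
  show "clinear (delta_g N X)" unfolding delta_g_def by (rule hom)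
qed

section \<open>The coaction on the Lie algebra\<close>

context right_comodule
begin

lemmas [lin] = clinear_compose[OF coact_linear]
lemmas [push] = sweedler_apply[OF coact_linear]

lemma coact_coassoc_sweedler:
  assumes "\<And>b c. clinear (\<lambda>a. \<phi> a b c)" "\<And>a c. clinear (\<lambda>b. \<phi> a b c)"
    "\<And>a b. clinear (\<lambda>c. \<phi> a b c)"
  shows "sweedler (\<rho> v) (\<lambda>x c. sweedler (\<rho> x) (\<lambda>a b. \<phi> a b c))
    = sweedler (\<rho> v) (\<lambda>a y. sweedler (\<Delta> y) (\<lambda>b c. \<phi> a b c))"
proof -
  note [lin] = assms[THEN clinear_compose]
  let ?L = "\<lambda>t. sweedler t (\<lambda>a s. sweedler s (\<lambda>b c. \<phi> a b c))"
  have L: "clinear ?L" by (intro cbilinearI lin)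
  show ?thesis
    using arg_cong[OF coact_coassoc, of ?L v]
    by (simp add: push sweedler_pure cbilinear_def lin)
qed

lemma coact_counit_cancel:
  assumes L: "clinear L"
  shows "sweedler (\<rho> v) (\<lambda>x y. \<epsilon> y *\<^sub>C L x) = L v"
  by (simp add: coact_counit flip: clinear_scale[OF L] sweedler_apply[OF L])

end

context g_hopf_algebra
begin

sublocale commutative_hopf_algebra \<Delta> \<epsilon> S
  by (rule commutative_hopf_algebra.intro) unfold_locales

sublocale finite_basis N X
  by unfold_locales (rule basis)

lemma act_one: "act Y 1 = 0"
  using derivation[of Y 1 1] by simp

text \<open>The structure identity without coordinates: comparing the coefficients of the basis vectors \<open>X\<^sub>k\<close>
  for \<open>Y = X\<^sub>i\<close> and \<open>Z = X\<^sub>j\<close> gives back the identity for the matrix \<open>f\<close>.\<close>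

lemma coact_bracket:
  "coact (lie_bracket Y Z) =
    sweedler (coact Y) (\<lambda>Y0 Y1. sweedler (coact Z) (\<lambda>Z0 Z1. lie_bracket Y0 Z0 \<otimes>\<^sub>C (Y1 * Z1)))
    + sweedler (coact Z) (\<lambda>Z0 Z1. Z0 \<otimes>\<^sub>C act Y Z1) - sweedler (coact Y) (\<lambda>Y0 Y1. Y0 \<otimes>\<^sub>C act Z Y1)"
    (is "_ = ?R Y Z")
proof -
  let ?c = "\<lambda>i j k. coord N X (lie_bracket (X i) (X j)) k"
  have *: "coact (lie_bracket (X i) (X j)) = ?R (X i) (X j)" if ij: "i < N" "j < N" for i j
  proof -
    have skew: "?c s r k = - ?c r s k" for r s k
      by (subst lie_bracket_skew) (simp add: clinear_minus[OF coord_linear])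
    have "coact (lie_bracket (X i) (X j)) = (\<Sum>l<N. ?c i j l *\<^sub>C (\<Sum>k<N. X k \<otimes>\<^sub>C f k l))"
      by (subst basis_expansion[of "lie_bracket _ _"])
        (simp add: clinear_sum[OF coact_linear] clinear_scale[OF coact_linear] coact_basis)
    also have "\<dots> = (\<Sum>k<N. X k \<otimes>\<^sub>C (\<Sum>l<N. ?c i j l *\<^sub>C f k l))"
      by (simp add: cvec.scale_sum_right pure_linear clinear_sum[OF cbilinear_right[OF cbilinear_pure]])
        (rule sum.swap)
    also have "\<dots> = (\<Sum>k<N. X k \<otimes>\<^sub>C ((\<Sum>r<N. \<Sum>s<N. ?c r s k *\<^sub>C (f r i * f s j))
        + act (X i) (f k j) - act (X j) (f k i)))"
    proof (intro sum.cong HOL.refl arg_cong[of _ _ "\<lambda>y. _ \<otimes>\<^sub>C y"])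
      fix k assume "k \<in> {..<N}"
      then have "act (X i) (f k j) - act (X j) (f k i)
          = (\<Sum>s<N. \<Sum>r<N. ?c s r k *\<^sub>C (f r i * f s j)) + (\<Sum>l<N. ?c i j l *\<^sub>C f k l)"
        using structure_identity ij by simp
      moreover have "(\<Sum>s<N. \<Sum>r<N. ?c s r k *\<^sub>C (f r i * f s j))
          = (\<Sum>s<N. \<Sum>r<N. - (?c r s k *\<^sub>C (f r i * f s j)))"
        by ((rule sum.cong[OF HOL.refl])+, subst skew) simp
      moreover have "\<dots> = - (\<Sum>r<N. \<Sum>s<N. ?c r s k *\<^sub>C (f r i * f s j))"
        by (subst sum.swap) (simp add: sum_negf)
      ultimately show "(\<Sum>l<N. ?c i j l *\<^sub>C f k l) = (\<Sum>r<N. \<Sum>s<N. ?c r s k *\<^sub>C (f r i * f s j))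
        + act (X i) (f k j) - act (X j) (f k i)"
        by (simp add: algebra_simps)
    qed
    also have "\<dots> = (\<Sum>r<N. \<Sum>s<N. \<Sum>k<N. (?c r s k *\<^sub>C X k) \<otimes>\<^sub>C (f r i * f s j))
        + (\<Sum>k<N. X k \<otimes>\<^sub>C act (X i) (f k j)) - (\<Sum>k<N. X k \<otimes>\<^sub>C act (X j) (f k i))"
    proof -
      have swap: "(\<Sum>k<N. \<Sum>r<N. \<Sum>s<N. G k r s) = (\<Sum>r<N. \<Sum>s<N. \<Sum>k<N. G k r s)"
        for G :: "nat \<Rightarrow> nat \<Rightarrow> nat \<Rightarrow> ('g, 'f) tensor"
        by (rule HOL.trans[OF sum.swap], rule sum.cong[OF HOL.refl], rule sum.swap)
      show ?thesis
        by (simp add: pure_linear clinear_sum[OF cbilinear_right[OF cbilinear_pure]]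
            sum.distrib sum_subtractf) (rule swap)
    qed
    also have "\<dots> = ?R (X i) (X j)"
      by (simp add: coact_basis ij sweedler_tensor_linear sweedler_pure cbilinear_def lin
          basis_expansion[symmetric] flip: clinear_sum[OF cbilinear_left[OF cbilinear_pure]])
    finally show ?thesis .
  qed
  have **: "coact (lie_bracket (X i) Z) = ?R (X i) Z" if "i < N" for i
    by (rule basis_linear_eqI[where L = "\<lambda>Z. coact (lie_bracket (X i) Z)"])
      (intro lin cbilinearI *[OF that])+
  show ?thesis
    by (rule basis_linear_eqI[where L = "\<lambda>Y. coact (lie_bracket Y Z)"])
      (intro lin cbilinearI | erule **)+
qed

lemma comul_act_sweedler:
  assumes "cbilinear \<phi>"
  shows "sweedler (\<Delta> (act Y a)) \<phi> =
    sweedler (coact Y) (\<lambda>Y0 Y1. sweedler (\<Delta> a) (\<lambda>a1 a2. \<phi> (act Y0 a1) (Y1 * a2)))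
    + sweedler (\<Delta> a) (\<lambda>a1 a2. \<phi> a1 (act Y a2))"
proof -
  note [lin] = clinear_compose_left[OF assms] clinear_compose_right[OF assms]
  show ?thesis
    unfolding comul_act by (simp add: push sweedler_tensor_linear sweedler_pure assms lin)
qed

text \<open>Applying the antipode law to \<open>Y \<triangleright> c\<close>, whose counit vanishes, determines the sum of the
  \<open>S (Y\<^sub>0 \<triangleright> c\<^sub>1) Y\<^sub>1 c\<^sub>2\<close>. The factors \<open>Y\<^sub>1\<close> and \<open>c\<^sub>2\<close> are then cancelled by multiplying with \<open>S Y\<^sub>2\<close> and
  \<open>S c\<^sub>3\<close>, and the action is moved from \<open>c\<^sub>2\<close> to \<open>S c\<^sub>3\<close> because \<open>Y \<triangleright> (c\<^sub>2 S c\<^sub>3) = 0\<close>.\<close>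

lemma antipode_act: "S (act Y c) = sweedler (coact Y) (\<lambda>Y0 Y1. S Y1 * act Y0 (S c))"
proof -
  have P: "sweedler (coact Y) (\<lambda>Y0 Y1. sweedler (\<Delta> c) (\<lambda>c1 c2. S (act Y0 c1) * (Y1 * c2)))
      = - sweedler (\<Delta> c) (\<lambda>c1 c2. S c1 * act Y c2)" for Y c
    using antipode_left[of "act Y c"]
    by (simp add: comul_act_sweedler cbilinear_def lin counit_act eq_neg_iff_add_eq_0)
  have Q: "sweedler (\<Delta> c) (\<lambda>c2 c3. act Z c2 * S c3) = - sweedler (\<Delta> c) (\<lambda>c2 c3. c2 * act Z (S c3))"
    for Z c
    using sweedler_apply[of "act Z" "\<Delta> c" "\<lambda>c2 c3. c2 * S c3"]
    by (simp add: lin antipode_right derivation sweedler_add act_linear act_one eq_neg_iff_add_eq_0)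
  have "S (act Y c) = sweedler (coact Y) (\<lambda>Y0 Y'. \<epsilon> Y' *\<^sub>C
      sweedler (\<Delta> c) (\<lambda>c1 c'. \<epsilon> c' *\<^sub>C S (act Y0 c1)))"
    by (simp add: coact_counit_cancel counit_cancel lin)
  also have "\<dots> = sweedler (coact Y) (\<lambda>Y0 Y'. sweedler (\<Delta> Y') (\<lambda>Y1 Y2.
      sweedler (\<Delta> c) (\<lambda>c1 c'. sweedler (\<Delta> c') (\<lambda>c2 c3. S (act Y0 c1) * (c2 * S c3) * (Y1 * S Y2)))))"
  proof (intro sweedler_cong)
    fix Y0 Y'
    have "sweedler (\<Delta> c') (\<lambda>c2 c3. S (act Y0 c1) * (c2 * S c3) * y) = \<epsilon> c' *\<^sub>C (S (act Y0 c1) * y)"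
      for c1 c' y
      using antipode_cancel(2)[of "\<lambda>z. S (act Y0 c1) * z * y" c'] by (simp add: lin)
    moreover have "sweedler (\<Delta> Y') (\<lambda>Y1 Y2. sweedler (\<Delta> c) (\<lambda>c1 c'. \<epsilon> c' *\<^sub>C (S (act Y0 c1) * (Y1 * S Y2))))
      = \<epsilon> Y' *\<^sub>C sweedler (\<Delta> c) (\<lambda>c1 c'. \<epsilon> c' *\<^sub>C (S (act Y0 c1)))"
      using antipode_cancel(2)[of "\<lambda>z. sweedler (\<Delta> c) (\<lambda>c1 c'. \<epsilon> c' *\<^sub>C (S (act Y0 c1) * z))" Y']
      by (simp add: lin)
    ultimately show "\<epsilon> Y' *\<^sub>C sweedler (\<Delta> c) (\<lambda>c1 c'. \<epsilon> c' *\<^sub>C S (act Y0 c1))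
      = sweedler (\<Delta> Y') (\<lambda>Y1 Y2. sweedler (\<Delta> c) (\<lambda>c1 c'.
          sweedler (\<Delta> c') (\<lambda>c2 c3. S (act Y0 c1) * (c2 * S c3) * (Y1 * S Y2))))"
      by simp
  qed
  also have "\<dots> = sweedler (coact Y) (\<lambda>Z Y2. sweedler (coact Z) (\<lambda>Y0 Y1.
      sweedler (\<Delta> c) (\<lambda>c1 c'. sweedler (\<Delta> c') (\<lambda>c2 c3. S (act Y0 c1) * (c2 * S c3) * (Y1 * S Y2)))))"
    by (rule coact_coassoc_sweedler[symmetric]) (intro lin)+
  also have "\<dots> = sweedler (coact Y) (\<lambda>Z Y2. sweedler (coact Z) (\<lambda>Y0 Y1.
      sweedler (\<Delta> c) (\<lambda>d c3. sweedler (\<Delta> d) (\<lambda>c1 c2. S (act Y0 c1) * (c2 * S c3) * (Y1 * S Y2)))))"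
    by (rule sweedler_cong, rule sweedler_cong, rule coassoc_sweedler[symmetric]) (intro lin)+
  also have "\<dots> = sweedler (coact Y) (\<lambda>Z Y2. sweedler (\<Delta> c) (\<lambda>d c3.
      sweedler (coact Z) (\<lambda>Y0 Y1. sweedler (\<Delta> d) (\<lambda>c1 c2. S (act Y0 c1) * (Y1 * c2))) * (S Y2 * S c3)))"
    by (subst sweedler_swap) (simp add: push mult_ac)
  also have "\<dots> = sweedler (coact Y) (\<lambda>Z Y2. sweedler (\<Delta> c) (\<lambda>d c3. sweedler (\<Delta> d) (\<lambda>c1 c2.
      - (S c1 * act Z c2 * S c3 * S Y2))))"
    unfolding P by (simp add: push mult_ac)
  also have "\<dots> = sweedler (coact Y) (\<lambda>Z Y2. sweedler (\<Delta> c) (\<lambda>c1 c'. sweedler (\<Delta> c') (\<lambda>c2 c3.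
      - (S c1 * act Z c2 * S c3 * S Y2))))"
    by (rule sweedler_cong, rule coassoc_sweedler) (intro lin)+
  also have "\<dots> = sweedler (coact Y) (\<lambda>Z Y2. sweedler (\<Delta> c) (\<lambda>c1 c'.
      - (S c1 * sweedler (\<Delta> c') (\<lambda>c2 c3. act Z c2 * S c3) * S Y2)))"
    by (simp add: push mult_ac)
  also have "\<dots> = sweedler (coact Y) (\<lambda>Z Y2. sweedler (\<Delta> c) (\<lambda>c1 c'. sweedler (\<Delta> c') (\<lambda>c2 c3.
      S c1 * c2 * act Z (S c3) * S Y2)))"
    unfolding Q by (simp add: push mult_ac)
  also have "\<dots> = sweedler (coact Y) (\<lambda>Z Y2. sweedler (\<Delta> c) (\<lambda>d c3. sweedler (\<Delta> d) (\<lambda>c1 c2.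
      S c1 * c2 * act Z (S c3) * S Y2)))"
    by (rule sweedler_cong, rule coassoc_sweedler[symmetric]) (intro lin)+
  also have "\<dots> = sweedler (coact Y) (\<lambda>Y0 Y1. S Y1 * act Y0 (S c))"
  proof (rule sweedler_cong)
    fix Z Y2
    show "sweedler (\<Delta> c) (\<lambda>d c3. sweedler (\<Delta> d) (\<lambda>c1 c2. S c1 * c2 * act Z (S c3) * S Y2))
      = S Y2 * act Z (S c)"
      using antipode_cancel(1)[of "\<lambda>z. z * act Z (S _) * S Y2"]
      by (simp add: lin counit_cancel mult_ac)
  qed
  finally show ?thesis .
qed

section \<open>The coaction on the enveloping algebra\<close>

text \<open>Multiplication by \<open>Y\<close> from the left, as the extended coaction has to see it: the coaction of
  \<open>Y u\<close> is \<open>coact_step Y\<close> applied to the coaction of \<open>u\<close>. The coaction on the enveloping algebra is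
  therefore the orbit map of \<open>1 \<otimes> 1\<close>, once \<open>coact_step\<close> is known to be a representation.\<close>

definition coact_step :: "'g \<Rightarrow> ('g uea, 'f) tensor \<Rightarrow> ('g uea, 'f) tensor"
  where "coact_step Y t =
    sweedler (coact Y) (\<lambda>Y0 Y1. sweedler t (\<lambda>u c. (uea_gen Y0 * u) \<otimes>\<^sub>C (Y1 * c)))
    + sweedler t (\<lambda>u c. u \<otimes>\<^sub>C act Y c)"

lemma [lin]:
  "clinear g \<Longrightarrow> clinear (\<lambda>x. coact_step (g x) t)"
  "clinear h \<Longrightarrow> clinear (\<lambda>x. coact_step Y (h x))"
  unfolding coact_step_def by (intro lin cbilinearI; assumption)+

lemma coact_step_pure:
  "coact_step Y (u \<otimes>\<^sub>C c) = sweedler (coact Y) (\<lambda>Y0 Y1. (uea_gen Y0 * u) \<otimes>\<^sub>C (Y1 * c)) + u \<otimes>\<^sub>C act Y c"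
  by (simp add: coact_step_def sweedler_pure cbilinear_def lin)

lemma coact_step_linear:
  "coact_step Y (s + t) = coact_step Y s + coact_step Y t"
  "coact_step Y (s - t) = coact_step Y s - coact_step Y t"
  "coact_step Y (c *\<^sub>C t) = c *\<^sub>C coact_step Y t"
  "coact_step Y (sweedler r \<theta>) = sweedler r (\<lambda>a b. coact_step Y (\<theta> a b))"
  by (rule clinear_add clinear_diff clinear_scale sweedler_apply, intro lin)+

text \<open>In the commutator, the terms in which one of \<open>Y\<close> and \<open>Z\<close> acts on \<open>c\<close> and the other one coacts
  cancel. What remains besides \<open>u \<otimes> [Y, Z] \<triangleright> c\<close> is the coaction of \<open>[Y, Z]\<close> in the form of
  \<open>coact_bracket\<close>.\<close>

lemma coact_step_lie_module: "lie_module coact_step"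
proof
  show "cbilinear coact_step" by (intro cbilinearI lin)
  show "coact_step (lie_bracket Y Z) t = coact_step Y (coact_step Z t) - coact_step Z (coact_step Y t)" for Y Z t
  proof (induction t rule: tensor_induct)
    case (pure u c)
    show ?case
      by (simp add: coact_step_pure coact_step_linear coact_bracket sweedler_tensor_linear sweedler_pure push
         uea_gen_bracket cbilinear_def lin derivation act_bracket pure_linear sweedler_add sweedler_diff algebra_simps
         sweedler_swap[of "coact Z"])
  qed (simp add: coact_step_linear)
qed

lemma
  assumes "is_uea_coact act coact nab"
  shows is_uea_coact_step: "nab (uea_gen Y * u) = coact_step Y (nab u)"
    and is_uea_coact_linear: "clinear nab" and is_uea_coact_one: "nab 1 = 1 \<otimes>\<^sub>C 1"
proof -
  show "clinear nab" "nab 1 = 1 \<otimes>\<^sub>C 1" using assms by (simp_all add: is_uea_coact_def)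
  note [lin] = clinear_compose[OF this(1)]
  show "nab (uea_gen Y * u) = coact_step Y (nab u)"
    using assms unfolding is_uea_coact_def coact_step_def
    by (simp add: uea_comult_sweedler cbilinear_def lin push sweedler_pure uact_simps)
qed

text \<open>Only the formula for products remains to be shown. It holds by induction on the first factor, since
  both sides turn multiplication by \<open>Y\<close> into \<open>coact_step Y\<close>: the three terms of
  \<open>coact_step Y ((u\<^sub>0 v\<^sub>0) \<otimes> u\<^sub>1 (u\<^sub>2 \<triangleright> v\<^sub>1))\<close> arise from \<open>Y\<close> coacting, from \<open>Y\<close>
  acting on \<open>u\<^sub>1\<close>, and from \<open>Y\<close> as a factor of \<open>u\<^sub>2\<close>.\<close>

lemma is_uea_coact_uea_act: "is_uea_coact act coact (\<lambda>u. uea_act coact_step u (1 \<otimes>\<^sub>C 1))"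
proof -
  interpret T: lie_module coact_step by (rule coact_step_lie_module)
  let ?n = "\<lambda>u. uea_act coact_step u (1 \<otimes>\<^sub>C 1)"
  let ?R = "\<lambda>u v. sweedler (uea_comult u) (\<lambda>u1 u2. sweedler (?n u1) (\<lambda>u10 u11.
    sweedler (?n v) (\<lambda>v0 v1. (u10 * v0) \<otimes>\<^sub>C (u11 * uea_act act u2 v1))))"
  have "?n (u * v) = ?R u v" for u v
  proof (rule uea_linear_eqI[where L = "\<lambda>u. ?n (u * v)" and L' = "\<lambda>u. ?R u v"])
    show "clinear (\<lambda>u. ?n (u * v))" "clinear (\<lambda>u. ?R u v)"
      by (intro lin cbilinearI)+
    show "?n (1 * v) = ?R 1 v"
      by (subst uea_comult_sweedler(1), (intro cbilinearI lin)[1],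
          subst T.uact_simps(2), subst sweedler_pure, (intro cbilinearI lin)[1])
        (simp add: uact_simps sweedler_id)
    show "?n (uea_gen Y * u * v) = ?R (uea_gen Y * u) v" if "?n (u * v) = ?R u v" for Y u
    proof -
      have "?n (uea_gen Y * u * v) = coact_step Y (?R u v)"
        using that by (simp add: mult.assoc T.uact_simps)
      also have "\<dots> = ?R (uea_gen Y * u) v"
        by (simp add: uea_comult_sweedler coact_step_linear T.uact_simps uact_simps cbilinear_def lin
           coact_step_pure)
           (simp add: coact_step_def sweedler_tensor_linear cbilinear_def lin derivation push sweedler_add
             sweedler_swap[of "coact Y"] sweedler_pure pure_linear mult_ac)
      finally show ?thesis .
    qed
  qed
  moreover have "clinear ?n" by (intro lin)
  moreover have "?n (uea_gen Y) = sweedler (coact Y) (\<lambda>Y0 Y1. uea_gen Y0 \<otimes>\<^sub>C Y1)" for Y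
    by (simp add: T.uact_simps coact_step_pure act_one pure_linear)
  ultimately show ?thesis
    by (simp add: is_uea_coact_def T.uact_simps)
qed

lemma is_uea_coact: "is_uea_coact act coact (uea_coact act coact)"
  unfolding uea_coact_def
proof (rule theI[where P = "is_uea_coact act coact", OF is_uea_coact_uea_act])
  fix nab assume nab: "is_uea_coact act coact nab"
  show "nab = (\<lambda>u. uea_act coact_step u (1 \<otimes>\<^sub>C 1))"
    by (rule ext, rule uea_linear_eqI[where L = nab and L' = "\<lambda>u. uea_act coact_step u (1 \<otimes>\<^sub>C 1)"])
      (simp_all add: nab is_uea_coact_linear[OF is_uea_coact_uea_act] is_uea_coact_step
        is_uea_coact_linear is_uea_coact_one uea_act_one uea_act_gen uea_act_mult coact_step_lie_module)
qed

lemma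
  shows uea_coact_step: "uea_coact act coact (uea_gen Y * u) = coact_step Y (uea_coact act coact u)"
    and uea_coact_linear: "clinear (uea_coact act coact)"
    and uea_coact_one: "uea_coact act coact 1 = 1 \<otimes>\<^sub>C 1"
  by (rule is_uea_coact_step is_uea_coact_linear is_uea_coact_one, rule is_uea_coact)+

lemmas [lin] = clinear_compose[OF uea_coact_linear]

lemma uea_coact_sweedler:
  assumes "cbilinear \<phi>"
  shows "sweedler (uea_coact act coact 1) \<phi> = \<phi> 1 1"
    and "sweedler (uea_coact act coact (uea_gen Y)) \<phi> = sweedler (coact Y) (\<lambda>Y0 Y1. \<phi> (uea_gen Y0) Y1)"
    and "sweedler (uea_coact act coact (uea_gen Y * u)) \<phi>
      = sweedler (uea_coact act coact u) (\<lambda>u0 u1.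
          sweedler (coact Y) (\<lambda>Y0 Y1. \<phi> (uea_gen Y0 * u0) (Y1 * u1)) + \<phi> u0 (act Y u1))"
proof -
  note [lin] = clinear_compose_left[OF assms] clinear_compose_right[OF assms]
  show "sweedler (uea_coact act coact 1) \<phi> = \<phi> 1 1"
    by (simp add: uea_coact_one sweedler_pure assms)
  show *: "sweedler (uea_coact act coact (uea_gen Y * u)) \<phi>
      = sweedler (uea_coact act coact u) (\<lambda>u0 u1.
          sweedler (coact Y) (\<lambda>Y0 Y1. \<phi> (uea_gen Y0 * u0) (Y1 * u1)) + \<phi> u0 (act Y u1))" for u
    unfolding uea_coact_step coact_step_def
    by (simp add: sweedler_tensor_linear push sweedler_pure assms lin sweedler_add
        sweedler_swap[of "coact Y"])
  show "sweedler (uea_coact act coact (uea_gen Y)) \<phi> = sweedler (coact Y) (\<lambda>Y0 Y1. \<phi> (uea_gen Y0) Y1)"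
    using *[of 1]
    by (simp add: uea_coact_one sweedler_pure cbilinear_def lin act_one
        clinear_zero[OF cbilinear_right, OF assms])
qed

end

section \<open>The bicrossed product Hopf algebra\<close>

context g_hopf_algebra
begin

abbreviation hmul :: "('f, 'g) bicrossed \<Rightarrow> ('f, 'g) bicrossed \<Rightarrow> ('f, 'g) bicrossed"
  where "hmul \<equiv> bicrossed_mult act"

abbreviation hcomul :: "('f, 'g) bicrossed \<Rightarrow> (('f, 'g) bicrossed, ('f, 'g) bicrossed) tensor"
  where "hcomul \<equiv> bicrossed_comult \<Delta> act coact"

abbreviation hcounit :: "('f, 'g) bicrossed \<Rightarrow> complex"
  where "hcounit \<equiv> bicrossed_counit \<epsilon>"

abbreviation hantipode :: "('f, 'g) bicrossed \<Rightarrow> ('f, 'g) bicrossed"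
  where "hantipode \<equiv> bicrossed_antipode S act coact"

lemma hmul_bilinear: "cbilinear hmul"
  unfolding bicrossed_mult_def by (intro cbilinearI lin)

lemmas [lin] = clinear_compose_left[OF hmul_bilinear] clinear_compose_right[OF hmul_bilinear]

lemma hmul_pure: "hmul (a \<otimes>\<^sub>C u) (b \<otimes>\<^sub>C v) =
    sweedler (uea_comult u) (\<lambda>u1 u2. (a * uea_act act u1 b) \<otimes>\<^sub>C (u2 * v))"
  by (simp add: bicrossed_mult_def sweedler_pure cbilinear_def lin)

lemma hmul_pure_one: "hmul (a \<otimes>\<^sub>C 1) (b \<otimes>\<^sub>C v) = (a * b) \<otimes>\<^sub>C v"
  by (simp add: hmul_pure uea_comult_sweedler cbilinear_def lin uact_simps)

lemma hmul_one_gen: "hmul (1 \<otimes>\<^sub>C uea_gen Y) (b \<otimes>\<^sub>C v) = act Y b \<otimes>\<^sub>C v + b \<otimes>\<^sub>C (uea_gen Y * v)"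
  by (simp add: hmul_pure uea_comult_sweedler cbilinear_def lin uact_simps)

text \<open>Induction over words in the generators. Scalar multiples are covered by the generators
  \<open>c \<otimes> 1\<close>.\<close>

lemma bicrossed_induct [case_names one pure gen add]:
  assumes one: "P (1 \<otimes>\<^sub>C 1)" and pure: "\<And>a y. P y \<Longrightarrow> P (hmul (a \<otimes>\<^sub>C 1) y)"
    and gen: "\<And>Y y. P y \<Longrightarrow> P (hmul (1 \<otimes>\<^sub>C uea_gen Y) y)"
    and add: "\<And>x y. P x \<Longrightarrow> P y \<Longrightarrow> P (x + y)"
  shows "P x"
proof -
  have u: "P (1 \<otimes>\<^sub>C u)" for u
  proof (induction u rule: uea_induct)
    case (gen Y u)
    then show ?case using assms(3)[of "1 \<otimes>\<^sub>C u" Y] by (simp add: hmul_one_gen act_one pure_linear)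
  next
    case (scale c u)
    then show ?case using pure[of "1 \<otimes>\<^sub>C u" "c *\<^sub>C 1"]
      unfolding hmul_pure_one mult_1_right by (simp add: pure_linear)
  qed (simp_all add: one add pure_linear)
  show ?thesis
  proof (induction x rule: tensor_induct)
    case (pure a u)
    show ?case using assms(2)[OF u[of u], of a] by (simp add: hmul_pure_one)
  qed (rule add)
qed

lemmas hmul_linear = cbilinear_simps[OF hmul_bilinear]

lemma hmul_assoc_generators:
  "hmul (hmul (a \<otimes>\<^sub>C 1) y) z = hmul (a \<otimes>\<^sub>C 1) (hmul y z)"
  "hmul (hmul (1 \<otimes>\<^sub>C uea_gen Y) y) z = hmul (1 \<otimes>\<^sub>C uea_gen Y) (hmul y z)"
proof -
  note [push] = sweedler_apply[OF cbilinear_right, OF hmul_bilinear]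
  show "hmul (hmul (a \<otimes>\<^sub>C 1) y) z = hmul (a \<otimes>\<^sub>C 1) (hmul y z)"
  proof (induction y rule: tensor_induct)
    case (pure b v)
    show ?case
      by (induction z rule: tensor_induct)
        (simp_all add: hmul_linear hmul_pure_one hmul_pure[of b] hmul_pure[of "a * b"] push mult.assoc)
  qed (simp add: hmul_linear)
  show "hmul (hmul (1 \<otimes>\<^sub>C uea_gen Y) y) z = hmul (1 \<otimes>\<^sub>C uea_gen Y) (hmul y z)"
  proof (induction y rule: tensor_induct)
    case (pure b v)
    show ?case
    proof (induction z rule: tensor_induct)
      case (pure c w)
      have "hmul (hmul (1 \<otimes>\<^sub>C uea_gen Y) (b \<otimes>\<^sub>C v)) (c \<otimes>\<^sub>C w) =
        hmul (act Y b \<otimes>\<^sub>C v) (c \<otimes>\<^sub>C w) + hmul (b \<otimes>\<^sub>C (uea_gen Y * v)) (c \<otimes>\<^sub>C w)"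
        by (simp add: hmul_one_gen hmul_linear)
      also have "\<dots> = hmul (1 \<otimes>\<^sub>C uea_gen Y) (hmul (b \<otimes>\<^sub>C v) (c \<otimes>\<^sub>C w))"
        unfolding hmul_pure[of "act Y b"] hmul_pure[of b]
        by (simp add: push hmul_one_gen uea_comult_sweedler cbilinear_def lin uact_simps
            derivation pure_linear sweedler_add mult.assoc)
      finally show ?case .
    qed (simp add: hmul_linear)
  qed (simp add: hmul_linear)
qed

lemma hmul_one_left: "hmul (1 \<otimes>\<^sub>C 1) x = x"
  by (induction x rule: tensor_induct) (simp_all add: hmul_linear hmul_pure_one)

lemma hmul_algebra: "algebra_over_complex hmul bicrossed_one"
proof
  show "cbilinear hmul" by (rule hmul_bilinear)
  show assoc: "hmul (hmul x y) z = hmul x (hmul y z)" for x y z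
  proof (induction x rule: bicrossed_induct)
  qed (simp_all add: hmul_linear hmul_assoc_generators hmul_one_left)
  show "hmul bicrossed_one x = x" for x
    unfolding bicrossed_one_def by (rule hmul_one_left)
  show "hmul x bicrossed_one = x" for x
    unfolding bicrossed_one_def
    by (induction x rule: bicrossed_induct) (simp_all add: assoc hmul_linear hmul_one_left)
qed

sublocale H: algebra_over_complex hmul bicrossed_one
  by (rule hmul_algebra)

lemma hcomul_linear: "clinear hcomul"
  unfolding bicrossed_comult_def by (intro cbilinearI lin)

lemmas [lin] = clinear_compose[OF hcomul_linear]

lemma hcomul_pure: "hcomul (a \<otimes>\<^sub>C u) =
    sweedler (\<Delta> a) (\<lambda>a1 a2. sweedler (uea_comult u) (\<lambda>u1 u2.
      sweedler (uea_coact act coact u1) (\<lambda>u10 u11. (a1 \<otimes>\<^sub>C u10) \<otimes>\<^sub>C ((a2 * u11) \<otimes>\<^sub>C u2))))"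
  by (simp add: bicrossed_comult_def sweedler_pure cbilinear_def lin)

lemma hcomul_pure_one: "hcomul (a \<otimes>\<^sub>C 1) = sweedler (\<Delta> a) (\<lambda>a1 a2. (a1 \<otimes>\<^sub>C 1) \<otimes>\<^sub>C (a2 \<otimes>\<^sub>C 1))"
  by (simp add: hcomul_pure uea_comult_sweedler uea_coact_sweedler cbilinear_def lin)

lemma hcomul_one_gen: "hcomul (1 \<otimes>\<^sub>C uea_gen Y) =
    sweedler (coact Y) (\<lambda>Y0 Y1. (1 \<otimes>\<^sub>C uea_gen Y0) \<otimes>\<^sub>C (Y1 \<otimes>\<^sub>C 1)) + (1 \<otimes>\<^sub>C 1) \<otimes>\<^sub>C (1 \<otimes>\<^sub>C uea_gen Y)"
  by (simp add: hcomul_pure uea_comult_sweedler uea_coact_sweedler comul_one_sweedler cbilinear_def lin)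

abbreviation "hmul2 \<equiv> tensor_mul hmul hmul"

sublocale H2: algebra_over_complex hmul2 "bicrossed_one \<otimes>\<^sub>C bicrossed_one"
  by (rule tensor_algebra) (rule hmul_algebra)+

lemmas hmul2_pure = tensor_mul_pure[OF hmul_bilinear hmul_bilinear]

text \<open>For \<open>1 \<otimes> Y\<close> this says that the comultiplication of \<open>F\<close>, the coaction and the comultiplication of the
  enveloping algebra all react to \<open>Y\<close> in the same way: \<open>Y\<close> reaches the second
  tensor factor unchanged, and the first one as \<open>Y\<^sub>0\<close>, leaving the factor \<open>Y\<^sub>1\<close> in the second.\<close>

lemma hcomul_generators:
  "hcomul (hmul (a \<otimes>\<^sub>C 1) y) = hmul2 (hcomul (a \<otimes>\<^sub>C 1)) (hcomul y)"
  "hcomul (hmul (1 \<otimes>\<^sub>C uea_gen Y) y) = hmul2 (hcomul (1 \<otimes>\<^sub>C uea_gen Y)) (hcomul y)"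
proof -
  show "hcomul (hmul (a \<otimes>\<^sub>C 1) y) = hmul2 (hcomul (a \<otimes>\<^sub>C 1)) (hcomul y)"
  proof (induction y rule: tensor_induct)
    case (pure b v)
    show ?case
      unfolding hmul_pure_one hcomul_pure_one unfolding hcomul_pure
      by (simp add: comul_mul_sweedler cbilinear_def lin H2.mul_push hmul2_pure hmul_pure_one
        sweedler_swap[of "\<Delta> a"] mult.assoc)
  qed (simp add: H2.mul_linear hmul_linear clinear_add[OF hcomul_linear])
  show "hcomul (hmul (1 \<otimes>\<^sub>C uea_gen Y) y) = hmul2 (hcomul (1 \<otimes>\<^sub>C uea_gen Y)) (hcomul y)"
  proof (induction y rule: tensor_induct)
    case (pure b v)
    show ?case
      unfolding hmul_one_gen hcomul_one_gen clinear_add[OF hcomul_linear] unfolding hcomul_pure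
      by (simp add: H2.mul_linear comul_act_sweedler uea_comult_sweedler uea_coact_sweedler
        cbilinear_def lin H2.mul_push hmul2_pure hmul_pure_one hmul_one_gen derivation act_one
        sweedler_swap[of "coact Y"] sweedler_add pure_linear push mult_ac distrib_left)
  qed (simp add: H2.mul_linear hmul_linear clinear_add[OF hcomul_linear])
qed

lemma hcounit_linear: "clinear hcounit"
  unfolding bicrossed_counit_def by (intro cbilinearI lin)

lemma hcounit_pure: "hcounit (a \<otimes>\<^sub>C u) = \<epsilon> a * uea_counit u"
  by (simp add: bicrossed_counit_def sweedler_pure cbilinear_def lin)

lemma hcounit_generators:
  "hcounit (hmul (a \<otimes>\<^sub>C 1) y) = \<epsilon> a * hcounit y"
  "hcounit (hmul (1 \<otimes>\<^sub>C uea_gen Y) y) = 0"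
  by (induction y rule: tensor_induct)
    (simp_all add: hmul_linear clinear_add[OF hcounit_linear] hmul_pure_one hmul_one_gen hcounit_pure
      counit_mul counit_act uea_counit_mult uea_counit_gen distrib_left)

lemma hcounit_mult: "hcounit (hmul x y) = hcounit x * hcounit y"
  by (induction x rule: bicrossed_induct)
    (simp_all add: hmul_linear hmul_one_left hcounit_pure counit_one uea_counit_one H.mul_assoc
      hcounit_generators clinear_add[OF hcounit_linear] distrib_right)

lemma hcomul_mult: "hcomul (hmul x y) = hmul2 (hcomul x) (hcomul y)"
proof (induction x rule: bicrossed_induct)
  case one
  then show ?case
    using H2.mul_one_left[of "hcomul y"]
    by (simp add: hmul_one_left bicrossed_one_def hcomul_pure_one comul_one_sweedler cbilinear_def lin)
qed (simp_all add: H.mul_assoc hcomul_generators H2.mul_assoc hmul_linear H2.mul_linear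
    clinear_add[OF hcomul_linear])

sublocale H: multiplicative_comultiplication hmul bicrossed_one hcomul hcounit
  by (intro multiplicative_comultiplication.intro multiplicative_comultiplication_axioms.intro
      hmul_algebra hcomul_linear hcounit_linear hcounit_mult) (simp add: hcomul_mult tensor_mul_def)

lemma hcomul_sweedler:
  assumes "cbilinear \<phi>"
  shows "sweedler (hcomul (a \<otimes>\<^sub>C 1)) \<phi> = sweedler (\<Delta> a) (\<lambda>a1 a2. \<phi> (a1 \<otimes>\<^sub>C 1) (a2 \<otimes>\<^sub>C 1))"
    and "sweedler (hcomul (1 \<otimes>\<^sub>C 1)) \<phi> = \<phi> (1 \<otimes>\<^sub>C 1) (1 \<otimes>\<^sub>C 1)"
    and "sweedler (hcomul (1 \<otimes>\<^sub>C uea_gen Y)) \<phi> =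
      sweedler (coact Y) (\<lambda>Y0 Y1. \<phi> (1 \<otimes>\<^sub>C uea_gen Y0) (Y1 \<otimes>\<^sub>C 1)) + \<phi> (1 \<otimes>\<^sub>C 1) (1 \<otimes>\<^sub>C uea_gen Y)"
proof -
  note [lin] = clinear_compose_left[OF assms] clinear_compose_right[OF assms]
  show "sweedler (hcomul (a \<otimes>\<^sub>C 1)) \<phi> = sweedler (\<Delta> a) (\<lambda>a1 a2. \<phi> (a1 \<otimes>\<^sub>C 1) (a2 \<otimes>\<^sub>C 1))" for a
    by (simp add: hcomul_pure_one push assms sweedler_pure)
  from this[of 1] show "sweedler (hcomul (1 \<otimes>\<^sub>C 1)) \<phi> = \<phi> (1 \<otimes>\<^sub>C 1) (1 \<otimes>\<^sub>C 1)"
    by (simp add: comul_one_sweedler cbilinear_def lin)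
  show "sweedler (hcomul (1 \<otimes>\<^sub>C uea_gen Y)) \<phi> =
      sweedler (coact Y) (\<lambda>Y0 Y1. \<phi> (1 \<otimes>\<^sub>C uea_gen Y0) (Y1 \<otimes>\<^sub>C 1)) + \<phi> (1 \<otimes>\<^sub>C 1) (1 \<otimes>\<^sub>C uea_gen Y)"
    by (simp add: hcomul_one_gen push assms sweedler_pure sweedler_tensor_linear)
qed

lemma hcomul_coassoc:
  "sweedler (hcomul x) (\<lambda>p c. sweedler (hcomul p) (\<lambda>a b. a \<otimes>\<^sub>C b \<otimes>\<^sub>C c))
    = sweedler (hcomul x) (\<lambda>a q. sweedler (hcomul q) (\<lambda>b c. a \<otimes>\<^sub>C b \<otimes>\<^sub>C c))"
proof (induction x rule: bicrossed_induct)
  case one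
  then show ?case by (simp add: hcomul_sweedler(2) cbilinear_def lin)
next
  case (pure a y)
  have "sweedler (hcomul (a \<otimes>\<^sub>C 1)) (\<lambda>p c. sweedler (hcomul p) (\<lambda>a b. a \<otimes>\<^sub>C b \<otimes>\<^sub>C c))
    = sweedler (hcomul (a \<otimes>\<^sub>C 1)) (\<lambda>a q. sweedler (hcomul q) (\<lambda>b c. a \<otimes>\<^sub>C b \<otimes>\<^sub>C c))"
    by (simp add: hcomul_sweedler cbilinear_def lin coassoc_sweedler)
  then show ?case using pure by (rule H.coassoc_mul)
next
  case (gen Y y)
  have "sweedler (hcomul (1 \<otimes>\<^sub>C uea_gen Y)) (\<lambda>p c. sweedler (hcomul p) (\<lambda>a b. a \<otimes>\<^sub>C b \<otimes>\<^sub>C c))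
    = sweedler (hcomul (1 \<otimes>\<^sub>C uea_gen Y)) (\<lambda>a q. sweedler (hcomul q) (\<lambda>b c. a \<otimes>\<^sub>C b \<otimes>\<^sub>C c))"
    by (simp add: hcomul_sweedler cbilinear_def lin sweedler_add pure_linear push coact_coassoc_sweedler
        comul_one_sweedler)
  then show ?case using gen by (rule H.coassoc_mul)
next
  case (add x y)
  then show ?case
    by (simp add: clinear_add[OF hcomul_linear] sweedler_tensor_linear cbilinear_def lin)
qed

lemmas [lin] = clinear_compose[OF hcounit_linear]

lemma hcounit_laws:
  "sweedler (hcomul x) (\<lambda>p q. hcounit p *\<^sub>C q) = x"
  "sweedler (hcomul x) (\<lambda>p q. hcounit q *\<^sub>C p) = x"
proof -
  show "sweedler (hcomul x) (\<lambda>p q. hcounit p *\<^sub>C q) = x"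
  proof (induction x rule: bicrossed_induct)
    case one
    then show ?case
      by (simp add: hcomul_sweedler(2) cbilinear_def lin hcounit_pure counit_one uea_counit_one scaleC_one)
  next
    case (pure a y)
    show ?case
      by (rule H.counit_mul_laws(1)[OF _ pure])
        (simp add: hcomul_sweedler cbilinear_def lin hcounit_pure uea_counit_one
          counit_cancel(1)[of "\<lambda>z. z \<otimes>\<^sub>C 1"])
  next
    case (gen Y y)
    show ?case
      by (rule H.counit_mul_laws(1)[OF _ gen])
        (simp add: hcomul_sweedler cbilinear_def lin hcounit_pure counit_one uea_counit_one uea_counit_gen
          sweedler_zero scaleC_one)
  next
    case (add x y)
    then show ?case
      by (simp add: clinear_add[OF hcomul_linear] sweedler_tensor_linear cbilinear_def lin)
  qed
  show "sweedler (hcomul x) (\<lambda>p q. hcounit q *\<^sub>C p) = x"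
  proof (induction x rule: bicrossed_induct)
    case one
    then show ?case
      by (simp add: hcomul_sweedler(2) cbilinear_def lin hcounit_pure counit_one uea_counit_one scaleC_one)
  next
    case (pure a y)
    show ?case
      by (rule H.counit_mul_laws(2)[OF _ pure])
        (simp add: hcomul_sweedler cbilinear_def lin hcounit_pure uea_counit_one
          counit_cancel(2)[of "\<lambda>z. z \<otimes>\<^sub>C 1"])
  next
    case (gen Y y)
    show ?case
      by (rule H.counit_mul_laws(2)[OF _ gen])
        (simp add: hcomul_sweedler cbilinear_def lin hcounit_pure uea_counit_one uea_counit_gen
          coact_counit_cancel[of "\<lambda>z. 1 \<otimes>\<^sub>C uea_gen z"])
  next
    case (add x y)
    then show ?case
      by (simp add: clinear_add[OF hcomul_linear] sweedler_tensor_linear cbilinear_def lin)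
  qed
qed

lemma hmul_one_one: "hmul (1 \<otimes>\<^sub>C u) (1 \<otimes>\<^sub>C w) = 1 \<otimes>\<^sub>C (u * w)"
proof (rule uea_linear_eqI[where L = "\<lambda>u. hmul (1 \<otimes>\<^sub>C u) (1 \<otimes>\<^sub>C w)" and L' = "\<lambda>u. 1 \<otimes>\<^sub>C (u * w)"])
  fix Y u assume *: "hmul (1 \<otimes>\<^sub>C u) (1 \<otimes>\<^sub>C w) = 1 \<otimes>\<^sub>C (u * w)"
  have "1 \<otimes>\<^sub>C (uea_gen Y * u) = hmul (1 \<otimes>\<^sub>C uea_gen Y) (1 \<otimes>\<^sub>C u)"
    by (simp add: hmul_one_gen act_one pure_linear)
  then have "hmul (1 \<otimes>\<^sub>C (uea_gen Y * u)) (1 \<otimes>\<^sub>C w) = hmul (1 \<otimes>\<^sub>C uea_gen Y) (1 \<otimes>\<^sub>C (u * w))"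
    by (simp add: H.mul_assoc *)
  also have "\<dots> = 1 \<otimes>\<^sub>C (uea_gen Y * u * w)"
    by (simp add: hmul_one_gen act_one pure_linear mult.assoc)
  finally show "hmul (1 \<otimes>\<^sub>C (uea_gen Y * u)) (1 \<otimes>\<^sub>C w) = 1 \<otimes>\<^sub>C (uea_gen Y * u * w)" .
qed (simp_all add: lin hmul_one_left)

lemma hantipode_linear: "clinear hantipode"
  unfolding bicrossed_antipode_def by (intro cbilinearI lin)

lemmas [lin] = clinear_compose[OF hantipode_linear]

lemma hantipode_pure: "hantipode (a \<otimes>\<^sub>C u) =
    sweedler (uea_coact act coact u) (\<lambda>u0 u1. hmul (1 \<otimes>\<^sub>C uea_antipode u0) (S (a * u1) \<otimes>\<^sub>C 1))"
  by (simp add: bicrossed_antipode_def sweedler_pure cbilinear_def lin)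

lemma hantipode_pure_one: "hantipode (a \<otimes>\<^sub>C 1) = S a \<otimes>\<^sub>C 1"
  by (simp add: hantipode_pure uea_coact_sweedler cbilinear_def lin uea_antipode_one hmul_one_left)

lemma hantipode_one_gen:
  "hantipode (1 \<otimes>\<^sub>C uea_gen Y) = - sweedler (coact Y) (\<lambda>Y0 Y1. hmul (1 \<otimes>\<^sub>C uea_gen Y0) (S Y1 \<otimes>\<^sub>C 1))"
  by (simp add: hantipode_pure uea_coact_sweedler cbilinear_def lin uea_antipode_gen pure_linear
      H.mul_linear sweedler_minus)

text \<open>The antimultiplicativity of the antipode for \<open>(1 \<otimes> Y)(c \<otimes> 1) = (Y \<triangleright> c) \<otimes> 1 + c \<otimes> Y\<close>. Commuting \<open>Y\<^sub>0\<close>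
  past the elements of \<open>F\<close> reduces it to \<open>antipode_act\<close>.\<close>

lemma antipode_act_bicrossed:
  "S (act Y c) \<otimes>\<^sub>C 1 - sweedler (coact Y) (\<lambda>Y0 Y1. hmul (1 \<otimes>\<^sub>C uea_gen Y0) (S (c * Y1) \<otimes>\<^sub>C 1))
    = hmul (S c \<otimes>\<^sub>C 1) (hantipode (1 \<otimes>\<^sub>C uea_gen Y))"
  by (simp add: hantipode_one_gen antipode_act hmul_one_gen H.mul_linear H.mul_push hmul_pure_one
      antipode_mul derivation push sweedler_add sweedler_diff pure_linear mult_ac)

text \<open>Since \<open>S (Y v) = - S v Y\<close> in the enveloping algebra, all terms for the generator \<open>1 \<otimes> Y\<close> share the
  left factor \<open>S v\<^sub>0\<close>; the right factors are those of \<open>antipode_act_bicrossed\<close> for \<open>c = b v\<^sub>1\<close>.\<close>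

lemma hantipode_generators:
  "hantipode (hmul (a \<otimes>\<^sub>C 1) y) = hmul (hantipode y) (hantipode (a \<otimes>\<^sub>C 1))"
  "hantipode (hmul (1 \<otimes>\<^sub>C uea_gen Y) y) = hmul (hantipode y) (hantipode (1 \<otimes>\<^sub>C uea_gen Y))"
proof -
  show "hantipode (hmul (a \<otimes>\<^sub>C 1) y) = hmul (hantipode y) (hantipode (a \<otimes>\<^sub>C 1))"
  proof (induction y rule: tensor_induct)
    case (pure b v)
    show ?case
      unfolding hmul_pure_one hantipode_pure_one unfolding hantipode_pure
      by (simp add: H.mul_push H.mul_assoc hmul_pure_one antipode_mul mult_ac)
  qed (simp add: H.mul_linear clinear_add[OF hantipode_linear])
  show "hantipode (hmul (1 \<otimes>\<^sub>C uea_gen Y) y) = hmul (hantipode y) (hantipode (1 \<otimes>\<^sub>C uea_gen Y))"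
  proof (induction y rule: tensor_induct)
    case (pure b v)
    have "hantipode (hmul (1 \<otimes>\<^sub>C uea_gen Y) (b \<otimes>\<^sub>C v))
      = hantipode (act Y b \<otimes>\<^sub>C v) + hantipode (b \<otimes>\<^sub>C (uea_gen Y * v))"
      by (simp add: hmul_one_gen clinear_add[OF hantipode_linear])
    also have "\<dots> = sweedler (uea_coact act coact v) (\<lambda>v0 v1. hmul (1 \<otimes>\<^sub>C uea_antipode v0)
          (S (act Y (b * v1)) \<otimes>\<^sub>C 1
            - sweedler (coact Y) (\<lambda>Y0 Y1. hmul (1 \<otimes>\<^sub>C uea_gen Y0) (S ((b * v1) * Y1) \<otimes>\<^sub>C 1))))"
      unfolding hantipode_pure
      by (simp add: uea_coact_sweedler cbilinear_def lin derivation H.mul_linear H.mul_push pure_linear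
          clinear_add[OF antipode_linear] sweedler_add sweedler_diff uea_antipode_mult uea_antipode_gen
          sweedler_minus H.mul_assoc mult_ac flip: hmul_one_one)
    also have "\<dots> = hmul (hantipode (b \<otimes>\<^sub>C v)) (hantipode (1 \<otimes>\<^sub>C uea_gen Y))"
      unfolding antipode_act_bicrossed hantipode_pure[of b] by (simp add: H.mul_push H.mul_assoc)
    finally show ?case .
  qed (simp add: H.mul_linear clinear_add[OF hantipode_linear])
qed

lemma hantipode_mult: "hantipode (hmul x y) = hmul (hantipode y) (hantipode x)"
proof (induction x rule: bicrossed_induct)
  case one
  then show ?case
    using H.mul_one_right[of "hantipode y"]
    by (simp add: hmul_one_left hantipode_pure_one antipode_one bicrossed_one_def)
qed (simp_all add: H.mul_assoc H.mul_linear hantipode_generators clinear_add[OF hantipode_linear])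

lemma hantipode_laws:
  "sweedler (hcomul x) (\<lambda>p q. hmul (hantipode p) q) = hcounit x *\<^sub>C bicrossed_one"
  "sweedler (hcomul x) (\<lambda>p q. hmul p (hantipode q)) = hcounit x *\<^sub>C bicrossed_one"
proof -
  note closed = H.antipode_mul_laws[OF hantipode_linear hantipode_mult]
  show "sweedler (hcomul x) (\<lambda>p q. hmul (hantipode p) q) = hcounit x *\<^sub>C bicrossed_one"
  proof (induction x rule: bicrossed_induct)
    case one
    then show ?case
      by (simp add: hcomul_sweedler(2) cbilinear_def lin hcounit_pure counit_one uea_counit_one scaleC_one
          hmul_pure_one hantipode_pure_one antipode_one bicrossed_one_def)
  next
    case (pure a y)
    show ?case
      by (rule closed(1)[OF _ pure])
        (simp add: hcomul_sweedler cbilinear_def lin hcounit_pure uea_counit_one hantipode_pure_one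
          hmul_pure_one antipode_cancel(1)[of "\<lambda>z. z \<otimes>\<^sub>C 1"] bicrossed_one_def)
  next
    case (gen Y y)
    have "sweedler (coact Y) (\<lambda>Y0 Y1. hmul (hantipode (1 \<otimes>\<^sub>C uea_gen Y0)) (Y1 \<otimes>\<^sub>C 1))
        = - sweedler (coact Y) (\<lambda>Y' Y2. sweedler (coact Y') (\<lambda>Y0 Y1.
            hmul (1 \<otimes>\<^sub>C uea_gen Y0) ((S Y1 * Y2) \<otimes>\<^sub>C 1)))"
      by (simp add: hantipode_one_gen H.mul_linear H.mul_push H.mul_assoc hmul_pure_one sweedler_minus)
    also have "\<dots> = - sweedler (coact Y) (\<lambda>Y0 Y'. sweedler (\<Delta> Y') (\<lambda>Y1 Y2.
            hmul (1 \<otimes>\<^sub>C uea_gen Y0) ((S Y1 * Y2) \<otimes>\<^sub>C 1)))"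
      by (subst coact_coassoc_sweedler) (intro lin HOL.refl)+
    also have "\<dots> = - sweedler (coact Y) (\<lambda>Y0 Y'. \<epsilon> Y' *\<^sub>C (1 \<otimes>\<^sub>C uea_gen Y0))"
      by (simp add: antipode_cancel(1)[of "\<lambda>z. hmul (1 \<otimes>\<^sub>C uea_gen _) (z \<otimes>\<^sub>C 1)"] lin hmul_one_one)
    also have "\<dots> = - (1 \<otimes>\<^sub>C uea_gen Y)"
      by (simp add: coact_counit_cancel lin)
    finally show ?case
      by (intro closed(1)[OF _ gen])
        (simp add: hcomul_sweedler cbilinear_def lin hcounit_pure uea_counit_gen hantipode_pure_one
          antipode_one hmul_one_left)
  next
    case (add x y)
    then show ?case
      by (simp add: clinear_add[OF hcomul_linear] sweedler_tensor_linear cbilinear_def lin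
          clinear_add[OF hcounit_linear] scaleC_add_left)
  qed
  show "sweedler (hcomul x) (\<lambda>p q. hmul p (hantipode q)) = hcounit x *\<^sub>C bicrossed_one"
  proof (induction x rule: bicrossed_induct)
    case one
    then show ?case
      by (simp add: hcomul_sweedler(2) cbilinear_def lin hcounit_pure counit_one uea_counit_one scaleC_one
          hmul_pure_one hantipode_pure_one antipode_one bicrossed_one_def)
  next
    case (pure a y)
    show ?case
      by (rule closed(2)[OF _ pure])
        (simp add: hcomul_sweedler cbilinear_def lin hcounit_pure uea_counit_one hantipode_pure_one
          hmul_pure_one antipode_cancel(2)[of "\<lambda>z. z \<otimes>\<^sub>C 1"] bicrossed_one_def)
  next
    case (gen Y y)
    show ?case
      by (rule closed(2)[OF _ gen])
        (simp add: hcomul_sweedler cbilinear_def lin hcounit_pure uea_counit_gen hantipode_pure_one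
          hantipode_one_gen hmul_one_left)
  next
    case (add x y)
    then show ?case
      by (simp add: clinear_add[OF hcomul_linear] sweedler_tensor_linear cbilinear_def lin
          clinear_add[OF hcounit_linear] scaleC_add_left)
  qed
qed

theorem bicrossed_hopf_algebra: "hopf_algebra hmul bicrossed_one hcomul hcounit hantipode"
proof (intro hopf_algebra.intro coalgebra_over_complex.intro hopf_algebra_axioms.intro)
  show "hcomul bicrossed_one = bicrossed_one \<otimes>\<^sub>C bicrossed_one"
    by (simp add: bicrossed_one_def hcomul_pure_one comul_one_sweedler cbilinear_def lin)
  show "hcounit bicrossed_one = 1"
    by (simp add: bicrossed_one_def hcounit_pure counit_one uea_counit_one)
qed (rule hmul_algebra hcomul_linear hcounit_linear hcomul_coassoc hcounit_laws hcounit_mult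
    hantipode_linear hantipode_laws H.comultiplication_mul)+

sublocale H: hopf_algebra hmul bicrossed_one hcomul hcounit hantipode
  by (rule bicrossed_hopf_algebra)

end

section \<open>Determinants\<close>

text \<open>Maps from \<open>{0..<n}\<close> into \<open>{0..<N}\<close>, extended by the identity. With this convention the permutations of
  \<open>{0..<N}\<close> are literally the injective ones among them.\<close>

definition selfmaps :: "nat \<Rightarrow> nat \<Rightarrow> (nat \<Rightarrow> nat) set"
  where "selfmaps N n = {\<kappa>. (\<forall>i\<in>{0..<n}. \<kappa> i \<in> {0..<N}) \<and> (\<forall>i. i \<notin> {0..<n} \<longrightarrow> \<kappa> i = i)}"

lemma finite_selfmaps: "finite (selfmaps N n)"
  unfolding selfmaps_def by (rule finite_bounded_functions) simp_all

lemma selfmaps_0: "selfmaps N 0 = {id}"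
  by (auto simp: selfmaps_def)

lemma sum_selfmaps_Suc:
  "(\<Sum>\<kappa>\<in>selfmaps N (Suc n). G \<kappa>) = (\<Sum>\<kappa>\<in>selfmaps N n. \<Sum>k = 0..<N. G (\<kappa>(n := k)))"
  unfolding sum.cartesian_product
  by (rule sum.reindex_bij_witness[where i = "\<lambda>(\<kappa>, k). \<kappa>(n := k)" and j = "\<lambda>\<kappa>. (\<kappa>(n := n), \<kappa> n)"])
    (auto simp: selfmaps_def fun_eq_iff less_Suc_eq)

lemma permutes_iff_selfmaps: "\<kappa> permutes {0..<N} \<longleftrightarrow> \<kappa> \<in> selfmaps N N \<and> inj_on \<kappa> {0..<N}"
proof
  assume "\<kappa> permutes {0..<N}"
  then show "\<kappa> \<in> selfmaps N N \<and> inj_on \<kappa> {0..<N}"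
    using permutes_in_image[of \<kappa> "{0..<N}"] permutes_not_in[of \<kappa> "{0..<N}"]
    by (auto simp: selfmaps_def permutes_inj_on)
next
  assume \<kappa>: "\<kappa> \<in> selfmaps N N \<and> inj_on \<kappa> {0..<N}"
  then have "\<kappa> ` {0..<N} = {0..<N}"
    by (intro endo_inj_surj) (auto simp: selfmaps_def)
  then show "\<kappa> permutes {0..<N}"
    using \<kappa> by (intro bij_imp_permutes) (auto simp: selfmaps_def bij_betw_def)
qed

text \<open>The two cases of the Cauchy-Binet argument: repeated rows kill the determinant, permuted rows only
  change its sign.\<close>

lemma det_select_rows:
  fixes A :: "'a::comm_ring_1 mat"
  assumes A: "A \<in> carrier_mat N N" and \<kappa>: "\<kappa> \<in> selfmaps N N"
  shows "det (mat N N (\<lambda>(i, j). A $$ (\<kappa> i, j)))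
    = (if \<kappa> permutes {0..<N} then signof \<kappa> * det A else 0)"
proof (cases "\<kappa> permutes {0..<N}")
  case True
  then show ?thesis using det_permute_rows[OF A True] by simp
next
  case False
  then obtain i j where ij: "i < N" "j < N" "i \<noteq> j" "\<kappa> i = \<kappa> j"
    using \<kappa> by (auto simp: permutes_iff_selfmaps inj_on_def)
  have "det (mat N N (\<lambda>(i, j). A $$ (\<kappa> i, j))) = 0"
    by (rule det_identical_rows[OF _ ij(3,1,2)]) (use ij in \<open>auto intro!: eq_vecI\<close>)
  then show ?thesis using False by simp
qed

lemma derivation_prod:
  fixes D :: "'a::comm_ring_1 \<Rightarrow> 'a"
  assumes "\<And>a b. D (a * b) = D a * b + a * D b" and "finite I"
  shows "D (\<Prod>i\<in>I. g i) = (\<Sum>k\<in>I. D (g k) * (\<Prod>i\<in>I - {k}. g i))"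
  using assms(2)
proof (induction I rule: finite_induct)
  case empty
  then show ?case using assms(1)[of 1 1] by simp
next
  case (insert x I)
  have "(\<Prod>i\<in>insert x I - {k}. g i) = g x * (\<Prod>i\<in>I - {k}. g i)" if "k \<in> I" for k
  proof -
    have "insert x I - {k} = insert x (I - {k})" "x \<notin> I - {k}" using insert(2) that by auto
    then show ?thesis using insert(1) by simp
  qed
  then show ?case
    using insert by (simp add: assms(1) sum_distrib_left mult_ac)
qed

text \<open>Jacobi's formula. Differentiating each product in the Leibniz expansion yields the determinants in which
  one row is replaced by its derivative; these are expanded along that row.\<close>

lemma derivation_det:
  fixes D :: "'a::comm_ring_1 \<Rightarrow> 'a"
  assumes D_mult: "\<And>a b. D (a * b) = D a * b + a * D b" and D_add: "\<And>a b. D (a + b) = D a + D b"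
    and A: "A \<in> carrier_mat N N"
  shows "D (det A) = (\<Sum>k<N. \<Sum>j<N. D (A $$ (k, j)) * cofactor A k j)"
proof -
  have D0: "D 0 = 0" using D_add[of 0 0] by simp
  have D_sum: "D (\<Sum>i\<in>I. g i) = (\<Sum>i\<in>I. D (g i))" for g :: "(nat \<Rightarrow> nat) \<Rightarrow> 'a" and I
    by (induction I rule: infinite_finite_induct) (simp_all add: D0 D_add)
  have D_minus: "D (- a) = - D a" for a
    using D_add[of a "- a"] by (simp add: D0 eq_neg_iff_add_eq_0 add.commute)
  have D_sign: "D (signof p * a) = signof p * D a" for p :: "nat \<Rightarrow> nat" and a
    by (simp add: sign_def D_minus)
  define B where "B k = mat N N (\<lambda>(i, j). if i = k then D (A $$ (k, j)) else A $$ (i, j))" for k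
  have B: "B k \<in> carrier_mat N N" for k by (simp add: B_def)
  have "D (det A) = (\<Sum>p | p permutes {0..<N}. \<Sum>k = 0..<N.
      signof p * (D (A $$ (k, p k)) * (\<Prod>i\<in>{0..<N} - {k}. A $$ (i, p i))))"
    by (simp add: det_def'[OF A] D_sum D_sign derivation_prod[OF D_mult] sum_distrib_left)
  also have "\<dots> = (\<Sum>k = 0..<N. det (B k))"
  proof (subst sum.swap, rule sum.cong[OF HOL.refl])
    fix k assume k: "k \<in> {0..<N}"
    have "D (A $$ (k, p k)) * (\<Prod>i\<in>{0..<N} - {k}. A $$ (i, p i)) = (\<Prod>i = 0..<N. B k $$ (i, p i))"
      if p: "p permutes {0..<N}" for p
    proof -
      have pN: "p i < N" if "i < N" for i using permutes_in_image[OF p, of i] that by simp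
      have "(\<Prod>i\<in>{0..<N} - {k}. A $$ (i, p i)) = (\<Prod>i\<in>{0..<N} - {k}. B k $$ (i, p i))"
        by (rule prod.cong) (auto simp: B_def pN)
      then show ?thesis
        using k by (subst prod.remove[of _ k]) (auto simp: B_def pN)
    qed
    then show "(\<Sum>p | p permutes {0..<N}. signof p *
        (D (A $$ (k, p k)) * (\<Prod>i\<in>{0..<N} - {k}. A $$ (i, p i)))) = det (B k)"
      by (simp add: det_def'[OF B])
  qed
  also have "\<dots> = (\<Sum>k<N. \<Sum>j<N. D (A $$ (k, j)) * cofactor A k j)"
  proof (unfold atLeast0LessThan, intro sum.cong[OF HOL.refl])
    fix k assume k: "k \<in> {..<N}"
    have "mat_delete (B k) k j = mat_delete A k j" for j
      using A k by (intro eq_matI) (auto simp: mat_delete_def B_def)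
    then have "cofactor (B k) k j = cofactor A k j" for j by (simp add: cofactor_def)
    then show "det (B k) = (\<Sum>j<N. D (A $$ (k, j)) * cofactor A k j)"
      using k by (subst laplace_expansion_row[OF B, of k]) (auto simp: B_def)
  qed
  finally show ?thesis .
qed

lemma cofactor_eq_inverse:
  fixes A B :: "'a::comm_ring_1 mat"
  assumes A: "A \<in> carrier_mat N N" and B: "B \<in> carrier_mat N N" and BA: "B * A = 1\<^sub>m N"
    and ij: "i < N" "j < N"
  shows "cofactor A i j = det A * B $$ (j, i)"
proof -
  note adj = adj_mat[OF A]
  have "adj_mat A = (B * A) * adj_mat A" using adj(1) by (simp add: BA)
  also have "\<dots> = B * (det A \<cdot>\<^sub>m 1\<^sub>m N)" using A B adj by (simp add: assoc_mult_mat)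
  also have "\<dots> = det A \<cdot>\<^sub>m B" using mult_smult_distrib[OF B one_carrier_mat] B by simp
  finally have "adj_mat A $$ (j, i) = (det A \<cdot>\<^sub>m B) $$ (j, i)" by simp
  then show ?thesis using A B ij by (simp add: adj_mat_def)
qed

section \<open>The group-like element\<close>

context g_hopf_algebra
begin

abbreviation \<sigma> :: 'f where "\<sigma> \<equiv> sigma_F N f"

abbreviation fmat :: "'f mat" where "fmat \<equiv> mat N N (\<lambda>(i, j). f i j)"

lemma coord_coact:
  "i < N \<Longrightarrow> j < N \<Longrightarrow> sweedler (coact (X j)) (\<lambda>Y c. coord N X Y i *\<^sub>C c) = f i j"
  by (simp add: coact_basis sweedler_tensor_linear sweedler_pure cbilinear_def lin coord_basis
      if_distrib[where f = "\<lambda>c. c *\<^sub>C _"] scaleC_one cvec.scale_zero_left cong: if_cong)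

text \<open>The \<open>f\<^sub>i\<^sub>j\<close> are the matrix coefficients of the Lie algebra as a comodule, obtained by applying a coordinate to
  the coaction; coassociativity of the coaction makes them multiply like matrices.\<close>

lemma comul_f: "i < N \<Longrightarrow> j < N \<Longrightarrow> \<Delta> (f i j) = (\<Sum>k = 0..<N. f i k \<otimes>\<^sub>C f k j)"
proof -
  assume ij: "i < N" "j < N"
  have "\<Delta> (f i j) = sweedler (coact (X j)) (\<lambda>Y c. sweedler (\<Delta> c) (\<lambda>c1 c2. coord N X Y i *\<^sub>C (c1 \<otimes>\<^sub>C c2)))"
    by (simp add: coord_coact[OF ij, symmetric] comul_push clinear_scale[OF comul_linear] sweedler_scale
        sweedler_id)
  also have "\<dots> = sweedler (coact (X j)) (\<lambda>Y c. sweedler (coact Y) (\<lambda>Z b. coord N X Z i *\<^sub>C (b \<otimes>\<^sub>C c)))"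
    by (rule coact_coassoc_sweedler[symmetric]) (intro lin)+
  also have "\<dots> = sweedler (coact (X j)) (\<lambda>Y c. sweedler (coact Y) (\<lambda>Z b. coord N X Z i *\<^sub>C b) \<otimes>\<^sub>C c)"
    by (simp add: push pure_linear)
  also have "\<dots> = (\<Sum>k<N. f i k \<otimes>\<^sub>C f k j)"
    using ij by (simp add: coact_basis[of j] sweedler_tensor_linear sweedler_pure cbilinear_def lin coord_coact)
  finally show ?thesis by (simp add: atLeast0LessThan)
qed

lemma counit_f: "i < N \<Longrightarrow> j < N \<Longrightarrow> \<epsilon> (f i j) = (if i = j then 1 else 0)"
proof -
  assume ij: "i < N" "j < N"
  have "\<epsilon> (f i j) = sweedler (coact (X j)) (\<lambda>Y c. \<epsilon> c *\<^sub>C coord N X Y i)"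
    by (simp add: coord_coact[OF ij, symmetric] counit_push clinear_scale[OF counit_linear]
        scaleC_complex_def mult.commute)
  also have "\<dots> = coord N X (X j) i" by (simp add: coact_counit_cancel coord_linear)
  finally show ?thesis using ij by (simp add: coord_basis)
qed

lemma antipode_f: "i < N \<Longrightarrow> j < N \<Longrightarrow> (\<Sum>k = 0..<N. S (f i k) * f k j) = (if i = j then 1 else 0)"
  using antipode_left[of "f i j"]
  by (simp add: comul_f counit_f sweedler_tensor_linear sweedler_pure cbilinear_def lin scaleC_one)

lemma antipode_f_matrix: "mat N N (\<lambda>(i, j). S (f i j)) * fmat = 1\<^sub>m N"
  by (intro eq_matI) (auto simp: scalar_prod_def antipode_f)

text \<open>Jacobi's formula with the cofactors written as \<open>\<sigma>\<close> times entries of the inverse matrix, which is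
  the matrix of the antipodes.\<close>

lemma act_sigma: "act Y \<sigma> = \<sigma> * (\<Sum>k<N. \<Sum>j<N. act Y (f k j) * S (f j k))"
proof -
  have "act Y \<sigma> = (\<Sum>k<N. \<Sum>j<N. act Y (fmat $$ (k, j)) * cofactor fmat k j)"
    unfolding sigma_F_def
    by (rule derivation_det) (simp_all add: derivation act_linear)
  also have "\<dots> = (\<Sum>k<N. \<Sum>j<N. act Y (f k j) * (\<sigma> * S (f j k)))"
    by (intro sum.cong HOL.refl)
      (simp add: cofactor_eq_inverse[OF _ _ antipode_f_matrix] sigma_F_def)
  also have "\<dots> = \<sigma> * (\<Sum>k<N. \<Sum>j<N. act Y (f k j) * S (f j k))"
    by (simp add: sum_distrib_left mult_ac)
  finally show ?thesis .
qed

lemma counit_sigma: "\<epsilon> \<sigma> = 1"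
proof -
  interpret e: comm_ring_hom \<epsilon>
    by unfold_locales
      (simp_all add: clinear_zero[OF counit_linear] clinear_add[OF counit_linear] counit_mul counit_one)
  have "map_mat \<epsilon> fmat = 1\<^sub>m N" by (intro eq_matI) (simp_all add: counit_f)
  then show ?thesis unfolding sigma_F_def by (simp flip: e.hom_det)
qed

text \<open>The product of the sums in \<open>comul_f\<close>, multiplied out: \<open>\<kappa>\<close> collects the summation index chosen in each
  factor.\<close>

lemma comul_prod_f:
  assumes p: "\<And>i. i < N \<Longrightarrow> p i < N"
  shows "n \<le> N \<Longrightarrow> \<Delta> (\<Prod>i = 0..<n. f i (p i))
    = (\<Sum>\<kappa>\<in>selfmaps N n. (\<Prod>i = 0..<n. f i (\<kappa> i)) \<otimes>\<^sub>C (\<Prod>i = 0..<n. f (\<kappa> i) (p i)))"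
proof (induction n)
  case 0
  then show ?case by (simp add: comul_one selfmaps_0)
next
  case (Suc n)
  have "\<Delta> (\<Prod>i = 0..<Suc n. f i (p i))
    = (\<Sum>\<kappa>\<in>selfmaps N n. \<Sum>k = 0..<N. ((\<Prod>i = 0..<n. f i (\<kappa> i)) * f n k)
        \<otimes>\<^sub>C ((\<Prod>i = 0..<n. f (\<kappa> i) (p i)) * f k (p n)))"
    using Suc p[of n]
    by (simp add: comul_mul comul_f sweedler_tensor_linear sweedler_pure cbilinear_def lin)
  also have "\<dots> = (\<Sum>\<kappa>\<in>selfmaps N (Suc n). (\<Prod>i = 0..<Suc n. f i (\<kappa> i)) \<otimes>\<^sub>C (\<Prod>i = 0..<Suc n. f (\<kappa> i) (p i)))"
    by (simp add: sum_selfmaps_Suc)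
  finally show ?case .
qed

lemma signof_mult: "signof p * (a::'f) = signof p *\<^sub>C a"
  by (simp add: sign_def scaleC_one cvec.scale_minus_left)

text \<open>The multiplicativity of the determinant, with the two factors kept in different tensor factors:
  after expanding, the second factor is the determinant of the rows selected by \<open>\<kappa>\<close>, which vanishes unless
  \<open>\<kappa>\<close> is a permutation.\<close>

lemma comul_sigma: "\<Delta> \<sigma> = \<sigma> \<otimes>\<^sub>C \<sigma>"
proof -
  let ?P = "{p. p permutes {0..<N}}"
  have fin: "finite ?P" by (simp add: finite_permutations)
  have \<sigma>: "\<sigma> = (\<Sum>p\<in>?P. signof p *\<^sub>C (\<Prod>i = 0..<N. f i (p i)))"
    unfolding sigma_F_def by (subst det_def') (auto simp: signof_mult permutes_in_image intro!: sum.cong prod.cong)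
  have pN: "p i < N" if "p \<in> ?P" "i < N" for p i
    using permutes_in_image[of p "{0..<N}" i] that by simp
  have minor: "(\<Sum>p\<in>?P. signof p *\<^sub>C (\<Prod>i = 0..<N. f (\<kappa> i) (p i)))
      = (if \<kappa> permutes {0..<N} then signof \<kappa> *\<^sub>C \<sigma> else 0)" if "\<kappa> \<in> selfmaps N N" for \<kappa>
  proof -
    have "(\<Sum>p\<in>?P. signof p *\<^sub>C (\<Prod>i = 0..<N. f (\<kappa> i) (p i)))
        = det (mat N N (\<lambda>(i, j). fmat $$ (\<kappa> i, j)))"
      using that by (subst det_def'[of _ N])
        (auto simp: signof_mult permutes_in_image selfmaps_def intro!: sum.cong prod.cong arg_cong[of _ _ "\<lambda>x. _ *\<^sub>C x"])
    then show ?thesis using det_select_rows[of fmat N \<kappa>] that by (simp add: sigma_F_def signof_mult)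
  qed
  have "\<Delta> \<sigma> = (\<Sum>p\<in>?P. \<Sum>\<kappa>\<in>selfmaps N N. signof p *\<^sub>C
      ((\<Prod>i = 0..<N. f i (\<kappa> i)) \<otimes>\<^sub>C (\<Prod>i = 0..<N. f (\<kappa> i) (p i))))"
    unfolding \<sigma> clinear_sum[OF comul_linear] clinear_scale[OF comul_linear]
    by (intro sum.cong HOL.refl) (subst comul_prod_f, auto simp: pN cvec.scale_sum_right)
  also have "\<dots> = (\<Sum>\<kappa>\<in>selfmaps N N. (\<Prod>i = 0..<N. f i (\<kappa> i)) \<otimes>\<^sub>C
      (\<Sum>p\<in>?P. signof p *\<^sub>C (\<Prod>i = 0..<N. f (\<kappa> i) (p i))))"
    by (subst sum.swap) (simp add: clinear_sum[OF cbilinear_right[OF cbilinear_pure]] pure_linear)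
  also have "\<dots> = (\<Sum>\<kappa>\<in>selfmaps N N. if \<kappa> permutes {0..<N}
      then (signof \<kappa> *\<^sub>C (\<Prod>i = 0..<N. f i (\<kappa> i))) \<otimes>\<^sub>C \<sigma> else 0)"
    by (intro sum.cong HOL.refl) (auto simp: minor pure_linear)
  also have "\<dots> = (\<Sum>\<kappa>\<in>?P. (signof \<kappa> *\<^sub>C (\<Prod>i = 0..<N. f i (\<kappa> i))) \<otimes>\<^sub>C \<sigma>)"
    by (rule sum.mono_neutral_cong_right) (auto simp: finite_selfmaps permutes_iff_selfmaps)
  also have "\<dots> = \<sigma> \<otimes>\<^sub>C \<sigma>"
    by (subst (2) \<sigma>) (simp add: clinear_sum[OF cbilinear_left[OF cbilinear_pure]])
  finally show ?thesis .
qed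

end

section \<open>The modular pair in involution\<close>

lemma twisted_antipode_linear:
  assumes "clinear \<Delta>" "clinear S" "clinear \<delta>"
  shows "clinear (twisted_antipode \<Delta> S \<delta>)"
  unfolding twisted_antipode_def
  by (intro lin cbilinearI assms[THEN clinear_compose])

text \<open>The twisted antipode is the convolution of a character with an antimultiplicative map. Its square is
  thus multiplicative, and can be compared with conjugation by \<open>\<sigma>\<close> on generators.\<close>

lemma (in hopf_algebra) twisted_antipode_mul:
  assumes "clinear \<delta>" and \<delta>_mul: "\<And>g h. \<delta> (mul g h) = \<delta> g * \<delta> h"
  shows "twisted_antipode \<Delta> S \<delta> (mul g h)
    = mul (twisted_antipode \<Delta> S \<delta> h) (twisted_antipode \<Delta> S \<delta> g)"
proof -
  note [lin] = clinear_compose[OF assms(1)]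
  show ?thesis
    unfolding twisted_antipode_def
    by (simp add: comul_mul_sweedler cbilinear_def lin antipode_mul \<delta>_mul)
      (simp only: mul_push(2), simp only: mul_push(1),
        simp add: mul_linear scaleC_scaleC)
qed

context g_hopf_algebra
begin

abbreviation "\<delta> \<equiv> delta_g N X"

lemmas [lin] = clinear_compose[OF delta_g_linear[OF basis]]

text \<open>For a basis vector \<open>X\<^sub>j\<close> this is the divergence \<open>\<Sum>\<^sub>i X\<^sub>i \<triangleright> S f\<^sub>i\<^sub>j\<close> of a column of the inverse matrix; it is
  the common correction term of all the formulas below.\<close>

definition div_coact :: "'g \<Rightarrow> 'f"
  where "div_coact Y = sweedler (coact Y) (\<lambda>Y0 Y1. act Y0 (S Y1))"

lemma [lin]: "clinear g \<Longrightarrow> clinear (\<lambda>x. div_coact (g x))"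
  unfolding div_coact_def by (intro lin cbilinearI; assumption)

lemma antipode_div_coact:
  "S (div_coact Y) = sweedler (coact Y) (\<lambda>Y0 Y'. sweedler (\<Delta> Y') (\<lambda>Y1 Y2. S Y1 * act Y0 Y2))"
proof -
  have "S (div_coact Y)
      = sweedler (coact Y) (\<lambda>Y' Y2. sweedler (coact Y') (\<lambda>Y0 Y1. S Y1 * act Y0 Y2))"
    by (simp add: div_coact_def push antipode_act antipode_involutive)
  also have "\<dots> = sweedler (coact Y) (\<lambda>Y0 Y'. sweedler (\<Delta> Y') (\<lambda>Y1 Y2. S Y1 * act Y0 Y2))"
    by (rule coact_coassoc_sweedler) (intro lin)+
  finally show ?thesis .
qed

text \<open>Up to sign this is the element of \<open>antipode_div_coact\<close>, because \<open>Y \<triangleright> (S Z\<^sub>1 Z\<^sub>2) = 0\<close> moves the action from \<open>S Z\<^sub>1\<close> to \<open>Z\<^sub>2\<close>.\<close>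

lemma antipode_div_coact':
  "sweedler (coact Y) (\<lambda>Y0 Y1. sweedler (coact Y0) (\<lambda>Z0 Z1. act Z0 (S Z1) * Y1)) = - S (div_coact Y)"
proof -
  have "sweedler (coact Y) (\<lambda>Y0 Y1. sweedler (coact Y0) (\<lambda>Z0 Z1. act Z0 (S Z1) * Y1))
      = sweedler (coact Y) (\<lambda>Z0 Y'. sweedler (\<Delta> Y') (\<lambda>Z1 Y1. act Z0 (S Z1) * Y1))"
    by (rule coact_coassoc_sweedler) (intro lin)+
  also have "\<dots> = sweedler (coact Y) (\<lambda>Z0 Y'. - sweedler (\<Delta> Y') (\<lambda>Z1 Y1. S Z1 * act Z0 Y1))"
  proof (rule sweedler_cong)
    fix Z Y'
    show "sweedler (\<Delta> Y') (\<lambda>Z1 Y1. act Z (S Z1) * Y1) = - sweedler (\<Delta> Y') (\<lambda>Z1 Y1. S Z1 * act Z Y1)"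
      using sweedler_apply[of "act Z" "\<Delta> Y'" "\<lambda>a b. S a * b"]
      by (simp add: lin antipode_left derivation sweedler_add act_linear act_one eq_neg_iff_add_eq_0)
  qed
  finally show ?thesis by (simp add: antipode_div_coact sweedler_minus)
qed

lemma antipode_f_right: "i < N \<Longrightarrow> j < N \<Longrightarrow> (\<Sum>k = 0..<N. f i k * S (f k j)) = (if i = j then 1 else 0)"
  using antipode_right[of "f i j"]
  by (simp add: comul_f counit_f sweedler_tensor_linear sweedler_pure cbilinear_def lin scaleC_one)

text \<open>The logarithmic derivative of \<open>\<sigma>\<close>. For \<open>Y = X\<^sub>j\<close> the structure identity replaces \<open>X\<^sub>j \<triangleright> f\<^sub>k\<^sub>i\<close> in
  \<open>act_sigma\<close> by three terms: \<open>X\<^sub>i \<triangleright> f\<^sub>k\<^sub>j\<close> gives the divergence, and in the two terms with structure constants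
  the product of \<open>f\<close> and its inverse leaves a trace of the adjoint representation, in the first one
  with the opposite sign because the trace runs over the other argument of the bracket.\<close>

lemma act_sigma_delta:
  "act Y \<sigma> = \<sigma> * (S (div_coact Y) + \<delta> (uea_gen Y) *\<^sub>C 1 - sweedler (coact Y) (\<lambda>Y0 Y1. \<delta> (uea_gen Y0) *\<^sub>C Y1))"
    (is "_ = \<sigma> * ?r Y")
proof (rule basis_linear_eqI[where L = "\<lambda>Y. act Y \<sigma>" and L' = "\<lambda>Y. \<sigma> * ?r Y"])
  show "clinear (\<lambda>Y. act Y \<sigma>)" "clinear (\<lambda>Y. \<sigma> * ?r Y)" by (intro lin cbilinearI)+
  fix j assume j: "j < N"
  let ?c = "\<lambda>i j k. coord N X (lie_bracket (X i) (X j)) k"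
  have struct: "act (X j) (f k i) = act (X i) (f k j)
      + (\<Sum>s<N. \<Sum>r<N. ?c s r k *\<^sub>C (f r j * f s i)) + (\<Sum>l<N. ?c j i l *\<^sub>C f k l)"
    if "i < N" "k < N" for i k
    using structure_identity[OF j that] by (simp add: algebra_simps)
  have T1: "(\<Sum>k<N. \<Sum>i<N. act (X i) (f k j) * S (f i k)) = S (div_coact (X j))"
    unfolding antipode_div_coact
    by (simp add: coact_basis j sweedler_tensor_linear sweedler_pure cbilinear_def lin comul_f
        atLeast0LessThan mult.commute) (rule sum.swap)
  have T2: "(\<Sum>k<N. \<Sum>i<N. (\<Sum>s<N. \<Sum>r<N. ?c s r k *\<^sub>C (f r j * f s i)) * S (f i k))
      = - sweedler (coact (X j)) (\<lambda>Y0 Y1. \<delta> (uea_gen Y0) *\<^sub>C Y1)"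
  proof -
    have "(\<Sum>i<N. (\<Sum>s<N. \<Sum>r<N. ?c s r k *\<^sub>C (f r j * f s i)) * S (f i k))
        = (\<Sum>r<N. - (?c r k k *\<^sub>C f r j))" if k: "k < N" for k
    proof -
      have "(\<Sum>i<N. (\<Sum>s<N. \<Sum>r<N. ?c s r k *\<^sub>C (f r j * f s i)) * S (f i k))
          = (\<Sum>s<N. \<Sum>r<N. \<Sum>i<N. ?c s r k *\<^sub>C (f r j * (f s i * S (f i k))))"
        by (simp add: mul_linear sum_distrib_right mult.assoc)
          (rule HOL.trans[OF sum.swap], rule sum.cong[OF HOL.refl], rule sum.swap)
      also have "\<dots> = (\<Sum>s<N. \<Sum>r<N. ?c s r k *\<^sub>C (f r j * (\<Sum>i = 0..<N. f s i * S (f i k))))"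
        by (simp add: mul_linear cvec.scale_sum_right sum_distrib_left atLeast0LessThan)
      also have "\<dots> = (\<Sum>s<N. if s = k then (\<Sum>r<N. ?c s r k *\<^sub>C f r j) else 0)"
        using k by (intro sum.cong HOL.refl) (simp add: antipode_f_right)
      also have "\<dots> = (\<Sum>r<N. ?c k r k *\<^sub>C f r j)" using k by simp
      also have "\<dots> = (\<Sum>r<N. - (?c r k k *\<^sub>C f r j))"
      proof (rule sum.cong[OF HOL.refl])
        fix r
        have "?c k r k = - ?c r k k"
          by (subst lie_bracket_skew) (simp add: clinear_minus[OF coord_linear])
        then show "?c k r k *\<^sub>C f r j = - (?c r k k *\<^sub>C f r j)" by simp
      qed
      finally show ?thesis .
    qed
    then have "(\<Sum>k<N. \<Sum>i<N. (\<Sum>s<N. \<Sum>r<N. ?c s r k *\<^sub>C (f r j * f s i)) * S (f i k))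
        = (\<Sum>k<N. \<Sum>r<N. - (?c r k k *\<^sub>C f r j))" by simp
    also have "\<dots> = - (\<Sum>r<N. \<delta> (uea_gen (X r)) *\<^sub>C f r j)"
      by (subst sum.swap) (simp add: delta_g_gen[OF basis] cvec.scale_sum_left sum_negf)
    also have "\<dots> = - sweedler (coact (X j)) (\<lambda>Y0 Y1. \<delta> (uea_gen Y0) *\<^sub>C Y1)"
      by (simp add: coact_basis j sweedler_tensor_linear sweedler_pure cbilinear_def lin)
    finally show ?thesis .
  qed
  have T3: "(\<Sum>k<N. \<Sum>i<N. (\<Sum>l<N. ?c j i l *\<^sub>C f k l) * S (f i k)) = \<delta> (uea_gen (X j)) *\<^sub>C 1"
  proof -
    have "(\<Sum>k<N. \<Sum>i<N. (\<Sum>l<N. ?c j i l *\<^sub>C f k l) * S (f i k))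
        = (\<Sum>i<N. \<Sum>l<N. \<Sum>k<N. ?c j i l *\<^sub>C (S (f i k) * f k l))"
      by (simp add: mul_linear sum_distrib_right sum_distrib_left mult.commute)
        (rule HOL.trans[OF sum.swap], rule sum.cong[OF HOL.refl], rule sum.swap)
    also have "\<dots> = (\<Sum>i<N. \<Sum>l<N. ?c j i l *\<^sub>C (\<Sum>k = 0..<N. S (f i k) * f k l))"
      by (simp add: cvec.scale_sum_right atLeast0LessThan)
    also have "\<dots> = (\<Sum>i<N. \<Sum>l<N. if i = l then ?c j i l *\<^sub>C 1 else 0)"
      by (intro sum.cong HOL.refl) (simp add: antipode_f)
    also have "\<dots> = \<delta> (uea_gen (X j)) *\<^sub>C 1"
      by (simp add: delta_g_gen[OF basis] cvec.scale_sum_left)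
    finally show ?thesis .
  qed
  have "act (X j) \<sigma> = \<sigma> * (\<Sum>k<N. \<Sum>i<N. act (X j) (f k i) * S (f i k))"
    by (rule act_sigma)
  also have "(\<Sum>k<N. \<Sum>i<N. act (X j) (f k i) * S (f i k)) = ?r (X j)"
    by (simp add: struct distrib_right sum.distrib T1 T2 T3)
  finally show "act (X j) \<sigma> = \<sigma> * ?r (X j)" .
qed

text \<open>The form of \<open>act_sigma_delta\<close> that the anti-Yetter-Drinfeld condition requires. By the Leibniz
  rule the left-hand side is \<open>div_coact Y * \<sigma>\<close> plus the sum of the \<open>S Y\<^sub>1 (Y\<^sub>0 \<triangleright> \<sigma>)\<close>; the divergences cancel.\<close>

lemma div_coact_sigma:
  "sweedler (coact Y) (\<lambda>Y0 Y1. act Y0 (S Y1 * \<sigma>))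
    = \<sigma> * (sweedler (coact Y) (\<lambda>Y0 Y1. \<delta> (uea_gen Y0) *\<^sub>C S Y1) - \<delta> (uea_gen Y) *\<^sub>C 1)"
proof -
  have a: "sweedler (coact Y) (\<lambda>Y0 Y1. S Y1 * S (div_coact Y0)) = - div_coact Y"
  proof -
    have "sweedler (coact Y) (\<lambda>Y0 Y1. S Y1 * S (div_coact Y0))
        = S (sweedler (coact Y) (\<lambda>Y0 Y1. sweedler (coact Y0) (\<lambda>Z0 Z1. act Z0 (S Z1) * Y1)))"
      by (simp add: div_coact_def push antipode_mul)
    also have "\<dots> = - div_coact Y"
      by (simp add: antipode_div_coact' clinear_minus[OF antipode_linear] antipode_involutive)
    finally show ?thesis .
  qed
  have b: "sweedler (coact Y) (\<lambda>Y0 Y1. S Y1 * sweedler (coact Y0) (\<lambda>Z0 Z1. \<delta> (uea_gen Z0) *\<^sub>C Z1))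
      = \<delta> (uea_gen Y) *\<^sub>C 1"
  proof -
    have "sweedler (coact Y) (\<lambda>Y0 Y1. S Y1 * sweedler (coact Y0) (\<lambda>Z0 Z1. \<delta> (uea_gen Z0) *\<^sub>C Z1))
        = sweedler (coact Y) (\<lambda>Y0 Y1. sweedler (coact Y0) (\<lambda>Z0 Z1. \<delta> (uea_gen Z0) *\<^sub>C (Z1 * S Y1)))"
      by (simp add: push mul_linear mult.commute)
    also have "\<dots> = sweedler (coact Y) (\<lambda>Z0 Y'. sweedler (\<Delta> Y') (\<lambda>Z1 Y1. \<delta> (uea_gen Z0) *\<^sub>C (Z1 * S Y1)))"
      by (rule coact_coassoc_sweedler) (intro lin)+
    also have "\<dots> = sweedler (coact Y) (\<lambda>Z0 Y'. \<epsilon> Y' *\<^sub>C (\<delta> (uea_gen Z0) *\<^sub>C 1))"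
      by (simp add: sweedler_scale antipode_right scaleC_scaleC mult.commute)
    also have "\<dots> = \<delta> (uea_gen Y) *\<^sub>C 1"
      by (rule coact_counit_cancel) (intro lin)
    finally show ?thesis .
  qed
  have "sweedler (coact Y) (\<lambda>Y0 Y1. act Y0 (S Y1 * \<sigma>))
    = \<sigma> * (div_coact Y + sweedler (coact Y) (\<lambda>Y0 Y1. S Y1 * S (div_coact Y0))
        + sweedler (coact Y) (\<lambda>Y0 Y1. \<delta> (uea_gen Y0) *\<^sub>C S Y1)
        - sweedler (coact Y) (\<lambda>Y0 Y1. S Y1 * sweedler (coact Y0) (\<lambda>Z0 Z1. \<delta> (uea_gen Z0) *\<^sub>C Z1)))"
    unfolding div_coact_def[of Y]
    by (simp add: derivation act_sigma_delta mul_push mul_linear algebra_simps flip: sweedler_add sweedler_diff)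
  also have "\<dots> = \<sigma> * (sweedler (coact Y) (\<lambda>Y0 Y1. \<delta> (uea_gen Y0) *\<^sub>C S Y1) - \<delta> (uea_gen Y) *\<^sub>C 1)"
    by (simp add: a b)
  finally show ?thesis .
qed

lemma sigma_antipode: "\<sigma> * S \<sigma> = 1"
  using antipode_right[of \<sigma>]
  by (simp add: comul_sigma sweedler_pure cbilinear_def lin counit_sigma scaleC_one)

lemma sigma_act_antipode: "\<sigma> * act Y (S \<sigma>) =
    - (S (div_coact Y) + \<delta> (uea_gen Y) *\<^sub>C 1 - sweedler (coact Y) (\<lambda>Y0 Y1. \<delta> (uea_gen Y0) *\<^sub>C Y1))"
  (is "_ = - ?r")
proof -
  have "\<sigma> * act Y (S \<sigma>) + act Y \<sigma> * S \<sigma> = 0"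
    using arg_cong[OF sigma_antipode, of "act Y"] by (simp add: derivation act_one add.commute)
  moreover have "act Y \<sigma> * S \<sigma> = (\<sigma> * S \<sigma>) * ?r"
    by (simp only: act_sigma_delta mult_ac)
  ultimately show ?thesis by (simp only: sigma_antipode mult_1_left eq_neg_iff_add_eq_0)
qed

abbreviation "cdelta \<equiv> canonical_delta N X \<epsilon>"
abbreviation "csigma \<equiv> canonical_sigma N f :: ('f, 'g) bicrossed"

lemma cdelta_linear: "clinear cdelta"
  unfolding canonical_delta_def by (intro lin cbilinearI)

lemmas [lin] = clinear_compose[OF cdelta_linear]

lemma cdelta_pure: "cdelta (a \<otimes>\<^sub>C u) = \<epsilon> a * \<delta> u"
  by (simp add: canonical_delta_def sweedler_pure cbilinear_def lin)

lemma cdelta_generators: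
  "cdelta (hmul (a \<otimes>\<^sub>C 1) y) = \<epsilon> a * cdelta y"
  "cdelta (hmul (1 \<otimes>\<^sub>C uea_gen Y) y) = \<delta> (uea_gen Y) * cdelta y"
  by (induction y rule: tensor_induct)
    (simp_all add: hmul_linear clinear_add[OF cdelta_linear] hmul_pure_one hmul_one_gen cdelta_pure
      counit_mul counit_act delta_g_mult[OF basis] distrib_left)

lemma cdelta_mult: "cdelta (hmul x y) = cdelta x * cdelta y"
  by (induction x rule: bicrossed_induct)
    (simp_all add: hmul_linear hmul_one_left cdelta_pure counit_one delta_g_one[OF basis] H.mul_assoc
      cdelta_generators clinear_add[OF cdelta_linear] distrib_right)

abbreviation "htwist \<equiv> twisted_antipode hcomul hantipode cdelta"

lemma htwist_linear: "clinear htwist"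
  by (rule twisted_antipode_linear) (rule hcomul_linear hantipode_linear cdelta_linear)+

lemma htwist_mult: "htwist (hmul x y) = hmul (htwist y) (htwist x)"
  by (rule H.twisted_antipode_mul) (rule cdelta_linear cdelta_mult)+

lemma htwist_pure_one: "htwist (a \<otimes>\<^sub>C 1) = S a \<otimes>\<^sub>C 1"
  by (simp add: twisted_antipode_def hcomul_sweedler cbilinear_def lin cdelta_pure delta_g_one[OF basis]
      hantipode_pure_one counit_cancel(1)[of "\<lambda>z. S z \<otimes>\<^sub>C 1"])

lemma htwist_one_gen: "htwist (1 \<otimes>\<^sub>C uea_gen Y) =
    sweedler (coact Y) (\<lambda>Y0 Y1. \<delta> (uea_gen Y0) *\<^sub>C S Y1) \<otimes>\<^sub>C 1
    - sweedler (coact Y) (\<lambda>Y0 Y1. hmul (1 \<otimes>\<^sub>C uea_gen Y0) (S Y1 \<otimes>\<^sub>C 1))"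
  by (simp add: twisted_antipode_def hcomul_sweedler cbilinear_def lin cdelta_pure counit_one
      delta_g_one[OF basis] scaleC_one hantipode_pure_one hantipode_one_gen push pure_linear)

text \<open>One application of the twisted antipode turns \<open>1 \<otimes> Y\<close> into \<open>\<delta> Y\<^sub>0 S Y\<^sub>1 - Y\<^sub>0 S Y\<^sub>1\<close>, where the product in the
  second term is taken in the bicrossed product. In the second application the elements \<open>Y\<^sub>1 S Y\<^sub>2\<close> cancel once they
  stand next to each other, which leaves \<open>1 \<otimes> Y\<close> minus the logarithmic derivative of \<open>\<sigma>\<close>.\<close>

lemma htwist_twist_gen: "htwist (htwist (1 \<otimes>\<^sub>C uea_gen Y)) = 1 \<otimes>\<^sub>C uea_gen Y
    - (S (div_coact Y) + \<delta> (uea_gen Y) *\<^sub>C 1 - sweedler (coact Y) (\<lambda>Y0 Y1. \<delta> (uea_gen Y0) *\<^sub>C Y1)) \<otimes>\<^sub>C 1"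
proof -
  have "htwist (htwist (1 \<otimes>\<^sub>C uea_gen Y)) = sweedler (coact Y) (\<lambda>Y0 Y1. \<delta> (uea_gen Y0) *\<^sub>C Y1) \<otimes>\<^sub>C 1
      - sweedler (coact Y) (\<lambda>Y0 Y1. hmul (Y1 \<otimes>\<^sub>C 1) (htwist (1 \<otimes>\<^sub>C uea_gen Y0)))"
    by (subst htwist_one_gen) (simp add: clinear_diff[OF htwist_linear] sweedler_apply[OF htwist_linear]
      htwist_mult htwist_pure_one antipode_involutive antipode_push clinear_scale[OF antipode_linear])
  also have "sweedler (coact Y) (\<lambda>Y0 Y1. hmul (Y1 \<otimes>\<^sub>C 1) (htwist (1 \<otimes>\<^sub>C uea_gen Y0)))
      = sweedler (coact Y) (\<lambda>Y0 Y1. sweedler (coact Y0) (\<lambda>Z0 Z1.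
          \<delta> (uea_gen Z0) *\<^sub>C ((Y1 * S Z1) \<otimes>\<^sub>C 1) - (Y1 * S Z1) \<otimes>\<^sub>C uea_gen Z0))
        - sweedler (coact Y) (\<lambda>Y0 Y1. sweedler (coact Y0) (\<lambda>Z0 Z1. act Z0 (S Z1) * Y1)) \<otimes>\<^sub>C 1"
    by (simp add: htwist_one_gen hmul_one_gen H.mul_linear H.mul_push hmul_pure_one push pure_linear
      sweedler_add sweedler_diff mul_linear mult.commute)
  also have "sweedler (coact Y) (\<lambda>Y0 Y1. sweedler (coact Y0) (\<lambda>Z0 Z1.
          \<delta> (uea_gen Z0) *\<^sub>C ((Y1 * S Z1) \<otimes>\<^sub>C 1) - (Y1 * S Z1) \<otimes>\<^sub>C uea_gen Z0))
      = sweedler (coact Y) (\<lambda>Z0 Y'. sweedler (\<Delta> Y') (\<lambda>Z1 Y1.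
          \<delta> (uea_gen Z0) *\<^sub>C ((Y1 * S Z1) \<otimes>\<^sub>C 1) - (Y1 * S Z1) \<otimes>\<^sub>C uea_gen Z0))"
    by (rule coact_coassoc_sweedler) (intro lin)+
  also have "\<dots> = sweedler (coact Y) (\<lambda>Z0 Y'. \<epsilon> Y' *\<^sub>C (\<delta> (uea_gen Z0) *\<^sub>C (1 \<otimes>\<^sub>C 1) - 1 \<otimes>\<^sub>C uea_gen Z0))"
  proof (rule sweedler_cong)
    fix Z0 Y'
    show "sweedler (\<Delta> Y') (\<lambda>Z1 Y1. \<delta> (uea_gen Z0) *\<^sub>C ((Y1 * S Z1) \<otimes>\<^sub>C 1) - (Y1 * S Z1) \<otimes>\<^sub>C uea_gen Z0)
        = \<epsilon> Y' *\<^sub>C (\<delta> (uea_gen Z0) *\<^sub>C (1 \<otimes>\<^sub>C 1) - 1 \<otimes>\<^sub>C uea_gen Z0)"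
      using antipode_cancel(1)[of "\<lambda>z. \<delta> (uea_gen Z0) *\<^sub>C (z \<otimes>\<^sub>C 1) - z \<otimes>\<^sub>C uea_gen Z0" Y']
      by (simp add: lin mult.commute)
  qed
  also have "\<dots> = \<delta> (uea_gen Y) *\<^sub>C (1 \<otimes>\<^sub>C 1) - 1 \<otimes>\<^sub>C uea_gen Y"
    by (rule coact_counit_cancel) (intro lin)
  finally show ?thesis
    by (simp add: antipode_div_coact' pure_linear)
qed

lemma canonical_modular_pair: "modular_pair_in_involution hmul bicrossed_one hcomul hcounit hantipode cdelta csigma"
proof (intro modular_pair_in_involution.intro modular_pair_in_involution_axioms.intro)
  show "hopf_algebra hmul bicrossed_one hcomul hcounit hantipode" by (rule bicrossed_hopf_algebra)
  show "clinear cdelta" by (rule cdelta_linear)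
  show "cdelta (hmul x y) = cdelta x * cdelta y" for x y by (rule cdelta_mult)
  show "cdelta bicrossed_one = 1"
    by (simp add: bicrossed_one_def cdelta_pure counit_one delta_g_one[OF basis])
  show "hcomul csigma = csigma \<otimes>\<^sub>C csigma"
    by (simp add: canonical_sigma_def hcomul_pure_one comul_sigma sweedler_pure cbilinear_def lin)
  show "hcounit csigma = 1"
    by (simp add: canonical_sigma_def hcounit_pure counit_sigma uea_counit_one)
  show "cdelta csigma = 1"
    by (simp add: canonical_sigma_def cdelta_pure counit_sigma delta_g_one[OF basis])
  have conj_mult: "hmul (hmul csigma (hmul x y)) (hantipode csigma)
    = hmul (hmul (hmul csigma x) (hantipode csigma)) (hmul (hmul csigma y) (hantipode csigma))" for x y
  proof -
    have "hmul (hantipode csigma) csigma = bicrossed_one"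
      by (simp add: canonical_sigma_def hantipode_pure_one hmul_pure_one mult.commute[of "S _"] sigma_antipode
          bicrossed_one_def)
    then have "hmul (hantipode csigma) (hmul csigma z) = z" for z
      by (simp add: H.mul_one_left flip: H.mul_assoc)
    then show ?thesis by (simp add: H.mul_assoc)
  qed
  show "htwist (htwist x) = hmul (hmul csigma x) (hantipode csigma)" for x
  proof (induction x rule: bicrossed_induct)
    case one
    show ?case
      by (simp add: htwist_pure_one antipode_one canonical_sigma_def hantipode_pure_one hmul_pure_one
          sigma_antipode)
  next
    case (pure a y)
    have "htwist (htwist (a \<otimes>\<^sub>C 1)) = hmul (hmul csigma (a \<otimes>\<^sub>C 1)) (hantipode csigma)"
      using sigma_antipode
      by (simp add: htwist_pure_one antipode_involutive canonical_sigma_def hantipode_pure_one hmul_pure_one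
          mult_ac)
    with pure show ?case by (simp only: htwist_mult conj_mult)
  next
    case (gen Y y)
    have "htwist (htwist (1 \<otimes>\<^sub>C uea_gen Y)) = hmul (hmul csigma (1 \<otimes>\<^sub>C uea_gen Y)) (hantipode csigma)"
      unfolding H.mul_assoc
      by (simp add: htwist_twist_gen canonical_sigma_def hantipode_pure_one hmul_one_gen
          H.mul_linear hmul_pure_one sigma_antipode sigma_act_antipode pure_linear)
    with gen show ?case by (simp only: htwist_mult conj_mult)
  next
    case (add x y)
    then show ?case by (simp add: clinear_add[OF htwist_linear] H.mul_linear)
  qed
qed

end

section \<open>The twisted induced module\<close>

text \<open>The anti-Yetter-Drinfeld condition is closed under products: apply it for \<open>h\<close>, then for \<open>g\<close>, and use
  \<open>S h\<^sub>3 S g\<^sub>3 = S (g\<^sub>3 h\<^sub>3)\<close>.\<close>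

lemma (in hopf_algebra) ayd_mul:
  assumes act: "cbilinear act" "\<And>v g h. act v (mul g h) = act (act v g) h" and \<rho>: "clinear \<rho>"
    and g: "\<And>v. \<rho> (act v g) = sweedler (\<Delta> g) (\<lambda>g1 g'. sweedler (\<Delta> g') (\<lambda>g2 g3.
      sweedler (\<rho> v) (\<lambda>w v0. mul (mul (S g3) w) g1 \<otimes>\<^sub>C act v0 g2)))"
    and h: "\<And>v. \<rho> (act v h) = sweedler (\<Delta> h) (\<lambda>h1 h'. sweedler (\<Delta> h') (\<lambda>h2 h3.
      sweedler (\<rho> v) (\<lambda>w v0. mul (mul (S h3) w) h1 \<otimes>\<^sub>C act v0 h2)))"
  shows "\<rho> (act v (mul g h)) = sweedler (\<Delta> (mul g h)) (\<lambda>x1 x'. sweedler (\<Delta> x') (\<lambda>x2 x3.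
      sweedler (\<rho> v) (\<lambda>w v0. mul (mul (S x3) w) x1 \<otimes>\<^sub>C act v0 x2)))"
proof -
  note [lin] = clinear_compose_left[OF act(1)] clinear_compose_right[OF act(1)]
  let ?E = "\<lambda>g1 g2 g3 h1 h2 h3. sweedler (\<rho> v) (\<lambda>w v0.
    mul (mul (mul (S h3) (S g3)) w) (mul g1 h1) \<otimes>\<^sub>C act v0 (mul g2 h2))"
  have "\<rho> (act v (mul g h)) = sweedler (\<Delta> h) (\<lambda>h1 h'. sweedler (\<Delta> h') (\<lambda>h2 h3.
      sweedler (\<Delta> g) (\<lambda>g1 g'. sweedler (\<Delta> g') (\<lambda>g2 g3. ?E g1 g2 g3 h1 h2 h3))))"
    unfolding act(2) h unfolding g by (simp add: push sweedler_pure cbilinear_def lin mul_assoc)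
  also have "\<dots> = sweedler (\<Delta> g) (\<lambda>g1 g'. sweedler (\<Delta> h) (\<lambda>h1 h'. sweedler (\<Delta> h') (\<lambda>h2 h3.
      sweedler (\<Delta> g') (\<lambda>g2 g3. ?E g1 g2 g3 h1 h2 h3))))"
    by (simp only: sweedler_swap[of _ "\<Delta> g"])
  also have "\<dots> = sweedler (\<Delta> g) (\<lambda>g1 g'. sweedler (\<Delta> h) (\<lambda>h1 h'. sweedler (\<Delta> g') (\<lambda>g2 g3.
      sweedler (\<Delta> h') (\<lambda>h2 h3. ?E g1 g2 g3 h1 h2 h3))))"
    by (rule sweedler_cong, rule sweedler_cong, rule sweedler_swap)
  also have "\<dots> = sweedler (\<Delta> (mul g h)) (\<lambda>x1 x'. sweedler (\<Delta> x') (\<lambda>x2 x3.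
      sweedler (\<rho> v) (\<lambda>w v0. mul (mul (S x3) w) x1 \<otimes>\<^sub>C act v0 x2)))"
    by (simp add: comul_mul_sweedler cbilinear_def lin antipode_mul)
  finally show ?thesis .
qed

locale module_over_g_hopf_algebra =
  g_hopf_algebra N X \<Delta> \<epsilon> S act coact f + V: induced_module \<Delta> \<epsilon> act coact actV coactV
  for N :: nat and X :: "nat \<Rightarrow> 'g::lie_algebra"
    and \<Delta> :: "'f::{comm_ring_1, complex_vector} \<Rightarrow> ('f, 'f) tensor"
    and \<epsilon> :: "'f \<Rightarrow> complex" and S :: "'f \<Rightarrow> 'f"
    and act :: "'g \<Rightarrow> 'f \<Rightarrow> 'f" and coact :: "'g \<Rightarrow> ('g, 'f) tensor"
    and f :: "nat \<Rightarrow> nat \<Rightarrow> 'f"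
    and actV :: "'g \<Rightarrow> 'v::complex_vector \<Rightarrow> 'v" and coactV :: "'v \<Rightarrow> ('v, 'f) tensor"
begin

abbreviation tact :: "'v \<Rightarrow> ('f, 'g) bicrossed \<Rightarrow> 'v"
  where "tact \<equiv> twisted_act N X \<epsilon> actV"

abbreviation tcoact :: "'v \<Rightarrow> (('f, 'g) bicrossed, 'v) tensor"
  where "tcoact \<equiv> twisted_coact N f S coactV"

lemma tact_bilinear: "cbilinear tact"
  unfolding twisted_act_def by (intro cbilinearI lin)

lemmas [lin] = clinear_compose_left[OF tact_bilinear] clinear_compose_right[OF tact_bilinear]
lemmas tact_linear = cbilinear_simps[OF tact_bilinear]

lemma tact_pure: "tact v (a \<otimes>\<^sub>C u) = sweedler (uea_comult u) (\<lambda>u1 u2.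
    (\<epsilon> a * \<delta> u1) *\<^sub>C uea_act actV (uea_antipode u2) v)"
  by (simp add: twisted_act_def sweedler_pure cbilinear_def lin)

lemma tact_pure_one: "tact v (a \<otimes>\<^sub>C 1) = \<epsilon> a *\<^sub>C v"
  by (simp add: tact_pure uea_comult_sweedler cbilinear_def lin delta_g_one[OF basis] uea_antipode_one
      V.uact_simps)

lemma tact_one_gen: "tact v (1 \<otimes>\<^sub>C uea_gen Y) = \<delta> (uea_gen Y) *\<^sub>C v - actV Y v"
  by (simp add: tact_pure uea_comult_sweedler cbilinear_def lin delta_g_one[OF basis] uea_antipode_one
      uea_antipode_gen counit_one V.uact_simps V.uact_linear scaleC_one)

lemma tact_generators:
  "tact v (hmul (a \<otimes>\<^sub>C 1) y) = tact (tact v (a \<otimes>\<^sub>C 1)) y"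
  "tact v (hmul (1 \<otimes>\<^sub>C uea_gen Y) y) = tact (tact v (1 \<otimes>\<^sub>C uea_gen Y)) y"
proof -
  show "tact v (hmul (a \<otimes>\<^sub>C 1) y) = tact (tact v (a \<otimes>\<^sub>C 1)) y"
  proof (induction y rule: tensor_induct)
    case (pure b w)
    show ?case
      unfolding tact_pure_one hmul_pure_one
      by (simp add: tact_pure counit_mul V.uact_linear scaleC_scaleC mult_ac)
  qed (simp add: hmul_linear tact_linear)
  show "tact v (hmul (1 \<otimes>\<^sub>C uea_gen Y) y) = tact (tact v (1 \<otimes>\<^sub>C uea_gen Y)) y"
  proof (induction y rule: tensor_induct)
    case (pure b w)
    show ?case
      unfolding tact_one_gen hmul_one_gen tact_linear(2)
      by (simp add: tact_pure uea_comult_sweedler cbilinear_def lin counit_act sweedler_zero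
          delta_g_mult[OF basis] uea_antipode_mult uea_antipode_gen V.uact_simps V.uact_linear
          scaleC_scaleC cvec.scale_right_diff_distrib sweedler_diff sweedler_minus mult_ac)
  qed (simp add: hmul_linear tact_linear)
qed

lemma tact_mult: "tact v (hmul x y) = tact (tact v x) y"
  by (induction x arbitrary: v rule: bicrossed_induct)
    (simp_all add: hmul_one_left tact_pure_one counit_one scaleC_one H.mul_assoc tact_generators
      hmul_linear tact_linear)

lemma tcoact_linear: "clinear tcoact"
  unfolding twisted_coact_def by (intro lin cbilinearI)

lemmas [lin] = clinear_compose[OF tcoact_linear]

lemma tcoact_sweedler:
  assumes "cbilinear \<phi>"
  shows "sweedler (tcoact v) \<phi> = sweedler (coactV v) (\<lambda>v0 v1. \<phi> ((\<sigma> * S v1) \<otimes>\<^sub>C 1) v0)"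
  by (simp add: twisted_coact_def push assms sweedler_pure)

text \<open>As the antipode reverses the comultiplication, \<open>v \<mapsto> \<sigma> S v\<^sub>1 \<otimes> v\<^sub>0\<close> turns a right coaction into
  a left one.\<close>

lemma comul_sigma_antipode:
  assumes "cbilinear \<phi>"
  shows "sweedler (\<Delta> (\<sigma> * S c)) \<phi> = sweedler (\<Delta> c) (\<lambda>c1 c2. \<phi> (\<sigma> * S c2) (\<sigma> * S c1))"
proof -
  note [lin] = clinear_compose_left[OF assms] clinear_compose_right[OF assms]
  show ?thesis
    by (simp add: comul_mul_sweedler assms comul_sigma comul_antipode push sweedler_pure cbilinear_def lin)
qed

lemma coactV_actV_sweedler:
  assumes "cbilinear \<phi>"
  shows "sweedler (coactV (actV Y v)) \<phi> =
    sweedler (coact Y) (\<lambda>Y0 Y1. sweedler (coactV v) (\<lambda>v0 v1. \<phi> (actV Y0 v0) (Y1 * v1)))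
    + sweedler (coactV v) (\<lambda>v0 v1. \<phi> v0 (act Y v1))"
proof -
  note [lin] = clinear_compose_left[OF assms] clinear_compose_right[OF assms]
  show ?thesis
    unfolding V.coactV_actV by (simp add: push sweedler_tensor_linear sweedler_pure assms lin)
qed

lemma div_coact_sigma_mult:
  "sweedler (coact Y) (\<lambda>Y0 Y1. act Y0 (S Y1 * (\<sigma> * t))) =
    sweedler (coact Y) (\<lambda>Y0 Y1. \<sigma> * (S Y1 * act Y0 t))
    + sweedler (coact Y) (\<lambda>Y0 Y1. \<delta> (uea_gen Y0) *\<^sub>C (\<sigma> * (S Y1 * t))) - \<delta> (uea_gen Y) *\<^sub>C (\<sigma> * t)"
proof -
  have "sweedler (coact Y) (\<lambda>Y0 Y1. act Y0 (S Y1 * (\<sigma> * t)))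
      = sweedler (coact Y) (\<lambda>Y0 Y1. act Y0 (S Y1 * \<sigma>)) * t
        + sweedler (coact Y) (\<lambda>Y0 Y1. \<sigma> * (S Y1 * act Y0 t))"
  proof -
    have "act Y0 (S Y1 * (\<sigma> * t)) = act Y0 (S Y1 * \<sigma>) * t + \<sigma> * (S Y1 * act Y0 t)" for Y0 Y1
      using derivation[of Y0 "S Y1 * \<sigma>" t] by (simp only: mult.assoc mult.left_commute[of \<sigma> "S Y1"])
    then show ?thesis by (simp add: sweedler_add mul_push)
  qed
  then show ?thesis
    unfolding div_coact_sigma by (simp add: mul_push mul_linear algebra_simps)
qed

text \<open>Since \<open>F\<close> is commutative and acts through its counit, the right-hand side is \<open>S a\<^sub>2 a\<^sub>1\<close> times the
  coaction of \<open>v\<close>.\<close>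

lemma ayd_pure_one: "tcoact (tact v (a \<otimes>\<^sub>C 1)) =
  sweedler (hcomul (a \<otimes>\<^sub>C 1)) (\<lambda>h1 h'. sweedler (hcomul h') (\<lambda>h2 h3. sweedler (tcoact v) (\<lambda>w v0.
    hmul (hmul (hantipode h3) w) h1 \<otimes>\<^sub>C tact v0 h2)))"
proof -
  have 1: "sweedler (\<Delta> a') (\<lambda>a2 a3. ((S a3 * (b * a1)) \<otimes>\<^sub>C 1) \<otimes>\<^sub>C (\<epsilon> a2 *\<^sub>C v0))
      = ((S a' * (b * a1)) \<otimes>\<^sub>C 1) \<otimes>\<^sub>C v0" for a1 a' b and v0 :: 'v
    using counit_cancel(1)[of "\<lambda>z. ((S z * (b * a1)) \<otimes>\<^sub>C 1) \<otimes>\<^sub>C v0" a'] by (simp add: lin pure_linear)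
  have 2: "sweedler (\<Delta> a) (\<lambda>a1 a'. ((S a' * (b * a1)) \<otimes>\<^sub>C 1) \<otimes>\<^sub>C v0) = \<epsilon> a *\<^sub>C ((b \<otimes>\<^sub>C 1) \<otimes>\<^sub>C v0)"
    for b and v0 :: 'v
    using antipode_cancel(2)[of "\<lambda>z. ((b * z) \<otimes>\<^sub>C 1) \<otimes>\<^sub>C v0" a] by (simp add: lin mult_ac)
  have "sweedler (hcomul (a \<otimes>\<^sub>C 1)) (\<lambda>h1 h'. sweedler (hcomul h') (\<lambda>h2 h3. sweedler (tcoact v) (\<lambda>w v0.
      hmul (hmul (hantipode h3) w) h1 \<otimes>\<^sub>C tact v0 h2)))
    = sweedler (coactV v) (\<lambda>v0 v1. sweedler (\<Delta> a) (\<lambda>a1 a'. sweedler (\<Delta> a') (\<lambda>a2 a3.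
        ((S a3 * ((\<sigma> * S v1) * a1)) \<otimes>\<^sub>C 1) \<otimes>\<^sub>C (\<epsilon> a2 *\<^sub>C v0))))"
    by (simp add: hcomul_sweedler tcoact_sweedler cbilinear_def lin hantipode_pure_one hmul_pure_one
        tact_pure_one mult.assoc sweedler_swap[of "coactV v"])
  also have "\<dots> = tcoact (tact v (a \<otimes>\<^sub>C 1))"
    unfolding tact_pure_one clinear_scale[OF tcoact_linear]
    by (simp add: 1 2 sweedler_scale twisted_coact_def)
  finally show ?thesis ..
qed

text \<open>The iterated comultiplication of \<open>1 \<otimes> Y\<close> has three terms, \<open>R1\<close>, \<open>R2\<close> and \<open>R3\<close> below, according to the
  position of the Lie algebra element. The parts of \<open>R1\<close> and \<open>R3\<close> outside \<open>F\<close> cancel. The rest is the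
  coaction of \<open>\<delta> Y v - Y v\<close> by \<open>div_coact_sigma_mult\<close> and the compatibility of action and coaction
  of an induced module.\<close>

lemma ayd_one_gen: "tcoact (tact v (1 \<otimes>\<^sub>C uea_gen Y)) =
  sweedler (hcomul (1 \<otimes>\<^sub>C uea_gen Y)) (\<lambda>h1 h'. sweedler (hcomul h') (\<lambda>h2 h3. sweedler (tcoact v) (\<lambda>w v0.
    hmul (hmul (hantipode h3) w) h1 \<otimes>\<^sub>C tact v0 h2)))"
proof -
  let ?R = "\<lambda>h1 h2 h3. sweedler (tcoact v) (\<lambda>w v0. hmul (hmul (hantipode h3) w) h1 \<otimes>\<^sub>C tact v0 h2)"
  have R1: "sweedler (coact Y) (\<lambda>Y0 Y'. sweedler (\<Delta> Y') (\<lambda>a b. ?R (1 \<otimes>\<^sub>C uea_gen Y0) (a \<otimes>\<^sub>C 1) (b \<otimes>\<^sub>C 1)))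
      = sweedler (coactV v) (\<lambda>v0 v1. sweedler (coact Y) (\<lambda>Y0 Y1.
          ((S Y1 * (\<sigma> * S v1)) \<otimes>\<^sub>C uea_gen Y0) \<otimes>\<^sub>C v0))"
  proof -
    have "sweedler (\<Delta> Y') (\<lambda>a b. ((S b * s) \<otimes>\<^sub>C u) \<otimes>\<^sub>C (\<epsilon> a *\<^sub>C v0)) = ((S Y' * s) \<otimes>\<^sub>C u) \<otimes>\<^sub>C v0"
      for Y' s and u :: "'g uea" and v0 :: 'v
      using counit_cancel(1)[of "\<lambda>z. ((S z * s) \<otimes>\<^sub>C u) \<otimes>\<^sub>C v0" Y'] by (simp add: lin pure_linear)
    then show ?thesis
      by (simp add: tcoact_sweedler cbilinear_def lin hantipode_pure_one hmul_pure_one tact_pure_one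
          sweedler_swap[of _ "coactV v"])
  qed
  have R2: "sweedler (coact Y) (\<lambda>Y0 Y1. ?R (1 \<otimes>\<^sub>C 1) (1 \<otimes>\<^sub>C uea_gen Y0) (Y1 \<otimes>\<^sub>C 1))
      = sweedler (coactV v) (\<lambda>v0 v1. sweedler (coact Y) (\<lambda>Y0 Y1.
          ((S Y1 * (\<sigma> * S v1)) \<otimes>\<^sub>C 1) \<otimes>\<^sub>C (\<delta> (uea_gen Y0) *\<^sub>C v0 - actV Y0 v0)))"
    by (simp add: tcoact_sweedler cbilinear_def lin hantipode_pure_one hmul_pure_one tact_one_gen
          sweedler_swap[of _ "coactV v"])
  have R3: "?R (1 \<otimes>\<^sub>C 1) (1 \<otimes>\<^sub>C 1) (1 \<otimes>\<^sub>C uea_gen Y)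
      = - sweedler (coactV v) (\<lambda>v0 v1. sweedler (coact Y) (\<lambda>Y0 Y1.
          (act Y0 (S Y1 * (\<sigma> * S v1)) \<otimes>\<^sub>C 1) \<otimes>\<^sub>C v0 + ((S Y1 * (\<sigma> * S v1)) \<otimes>\<^sub>C uea_gen Y0) \<otimes>\<^sub>C v0))"
  proof -
    have "hmul (hmul (hantipode (1 \<otimes>\<^sub>C uea_gen Y)) (s \<otimes>\<^sub>C 1)) (1 \<otimes>\<^sub>C 1) =
      - sweedler (coact Y) (\<lambda>Y0 Y1. act Y0 (S Y1 * s) \<otimes>\<^sub>C 1 + (S Y1 * s) \<otimes>\<^sub>C uea_gen Y0)" for s
    proof -
      have "hmul (hmul (hantipode (1 \<otimes>\<^sub>C uea_gen Y)) (s \<otimes>\<^sub>C 1)) (1 \<otimes>\<^sub>C 1)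
          = - sweedler (coact Y) (\<lambda>Y0 Y1. hmul (1 \<otimes>\<^sub>C uea_gen Y0) (hmul (hmul (S Y1 \<otimes>\<^sub>C 1) (s \<otimes>\<^sub>C 1)) (1 \<otimes>\<^sub>C 1)))"
        unfolding hantipode_one_gen by (simp only: H.mul_linear H.mul_push H.mul_assoc)
      then show ?thesis by (simp add: hmul_pure_one hmul_one_gen)
    qed
    then show ?thesis
      by (simp add: tcoact_sweedler cbilinear_def lin tact_pure_one counit_one scaleC_one pure_linear push
        sweedler_add)
  qed
  have "sweedler (hcomul (1 \<otimes>\<^sub>C uea_gen Y)) (\<lambda>h1 h'. sweedler (hcomul h') (\<lambda>h2 h3. ?R h1 h2 h3))
    = sweedler (coact Y) (\<lambda>Y0 Y'. sweedler (\<Delta> Y') (\<lambda>a b. ?R (1 \<otimes>\<^sub>C uea_gen Y0) (a \<otimes>\<^sub>C 1) (b \<otimes>\<^sub>C 1)))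
      + (sweedler (coact Y) (\<lambda>Y0 Y1. ?R (1 \<otimes>\<^sub>C 1) (1 \<otimes>\<^sub>C uea_gen Y0) (Y1 \<otimes>\<^sub>C 1))
      + ?R (1 \<otimes>\<^sub>C 1) (1 \<otimes>\<^sub>C 1) (1 \<otimes>\<^sub>C uea_gen Y))"
    by (simp add: hcomul_sweedler comul_one_sweedler cbilinear_def lin)
  also have "\<dots> = sweedler (coactV v) (\<lambda>v0 v1.
      sweedler (coact Y) (\<lambda>Y0 Y1. \<delta> (uea_gen Y0) *\<^sub>C (((S Y1 * (\<sigma> * S v1)) \<otimes>\<^sub>C 1) \<otimes>\<^sub>C v0))
      - sweedler (coact Y) (\<lambda>Y0 Y1. ((S Y1 * (\<sigma> * S v1)) \<otimes>\<^sub>C 1) \<otimes>\<^sub>C actV Y0 v0)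
      - (sweedler (coact Y) (\<lambda>Y0 Y1. act Y0 (S Y1 * (\<sigma> * S v1))) \<otimes>\<^sub>C 1) \<otimes>\<^sub>C v0)"
    unfolding R1 R2 R3
    by (simp add: sweedler_add sweedler_diff pure_linear push) (simp add: sweedler_minus)
  also have "\<dots> = sweedler (coactV v) (\<lambda>v0 v1.
      \<delta> (uea_gen Y) *\<^sub>C (((\<sigma> * S v1) \<otimes>\<^sub>C 1) \<otimes>\<^sub>C v0)
      - sweedler (coact Y) (\<lambda>Y0 Y1. ((\<sigma> * (S Y1 * S v1)) \<otimes>\<^sub>C 1) \<otimes>\<^sub>C actV Y0 v0)
      - ((\<sigma> * S (act Y v1)) \<otimes>\<^sub>C 1) \<otimes>\<^sub>C v0)"
    unfolding div_coact_sigma_mult antipode_act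
    by (simp add: pure_linear push sweedler_diff sweedler_add mult_ac)
  also have "\<dots> = tcoact (tact v (1 \<otimes>\<^sub>C uea_gen Y))"
    unfolding tact_one_gen clinear_diff[OF tcoact_linear] clinear_scale[OF tcoact_linear]
    unfolding twisted_coact_def
    by (simp add: coactV_actV_sweedler cbilinear_def lin sweedler_scale sweedler_diff antipode_mul
        sweedler_swap[of "coact Y"] mult_ac)
  finally show ?thesis ..
qed

lemma ayd: "tcoact (tact v h) =
  sweedler (hcomul h) (\<lambda>h1 h'. sweedler (hcomul h') (\<lambda>h2 h3. sweedler (tcoact v) (\<lambda>w v0.
    hmul (hmul (hantipode h3) w) h1 \<otimes>\<^sub>C tact v0 h2)))"
proof (induction h arbitrary: v rule: bicrossed_induct)
  case one
  show ?case by (rule ayd_pure_one)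
next
  case (pure a y)
  show ?case
    by (rule H.ayd_mul[OF tact_bilinear tact_mult tcoact_linear ayd_pure_one pure])
next
  case (gen Y y)
  show ?case
    by (rule H.ayd_mul[OF tact_bilinear tact_mult tcoact_linear ayd_one_gen gen])
next
  case (add x y)
  then show ?case
    by (simp add: tact_linear clinear_add[OF tcoact_linear] clinear_add[OF hcomul_linear]
        sweedler_tensor_linear cbilinear_def lin)
qed

theorem twisted_sayd_module:
  "right_left_sayd_module hmul bicrossed_one hcomul hcounit hantipode tact tcoact"
proof (intro right_left_sayd_module.intro right_left_ayd_module.intro right_left_ayd_module_axioms.intro
    right_left_sayd_module_axioms.intro right_module.intro right_module_axioms.intro
    left_comodule.intro left_comodule_axioms.intro)
  show "hopf_algebra hmul bicrossed_one hcomul hcounit hantipode" by (rule bicrossed_hopf_algebra)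
  show "algebra_over_complex hmul bicrossed_one" by (rule hmul_algebra)
  show "coalgebra_over_complex hcomul hcounit" by (rule H.coalgebra_over_complex_axioms)
  show "cbilinear tact" by (rule tact_bilinear)
  show "tact v (hmul x y) = tact (tact v x) y" for v x y by (rule tact_mult)
  show "tact v bicrossed_one = v" for v
    by (simp add: bicrossed_one_def tact_pure_one counit_one scaleC_one)
  show "clinear tcoact" by (rule tcoact_linear)
  show "sweedler (tcoact v) (\<lambda>x y. sweedler (hcomul x) (\<lambda>a b. a \<otimes>\<^sub>C b \<otimes>\<^sub>C y))
      = sweedler (tcoact v) (\<lambda>x y. sweedler (tcoact y) (\<lambda>b c. x \<otimes>\<^sub>C b \<otimes>\<^sub>C c))" for v
  proof -
    have "sweedler (tcoact v) (\<lambda>x y. sweedler (hcomul x) (\<lambda>a b. a \<otimes>\<^sub>C b \<otimes>\<^sub>C y))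
        = sweedler (coactV v) (\<lambda>v0 c. sweedler (\<Delta> c) (\<lambda>c1 c2.
            ((\<sigma> * S c2) \<otimes>\<^sub>C 1) \<otimes>\<^sub>C ((\<sigma> * S c1) \<otimes>\<^sub>C 1) \<otimes>\<^sub>C v0))"
      by (simp add: tcoact_sweedler hcomul_sweedler comul_sigma_antipode cbilinear_def lin)
    also have "\<dots> = sweedler (coactV v) (\<lambda>v' c2. sweedler (coactV v') (\<lambda>v0 c1.
            ((\<sigma> * S c2) \<otimes>\<^sub>C 1) \<otimes>\<^sub>C ((\<sigma> * S c1) \<otimes>\<^sub>C 1) \<otimes>\<^sub>C v0))"
      by (rule V.coact_coassoc_sweedler[symmetric]) (intro lin)+
    also have "\<dots> = sweedler (tcoact v) (\<lambda>x y. sweedler (tcoact y) (\<lambda>b c. x \<otimes>\<^sub>C b \<otimes>\<^sub>C c))"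
      by (simp add: tcoact_sweedler cbilinear_def lin)
    finally show ?thesis .
  qed
  show "sweedler (tcoact v) (\<lambda>x y. hcounit x *\<^sub>C y) = v" for v
    by (simp add: tcoact_sweedler cbilinear_def lin hcounit_pure counit_mul counit_sigma counit_antipode
        uea_counit_one V.coact_counit)
  show "tcoact (tact v h) = sweedler (hcomul h) (\<lambda>h1 h'. sweedler (hcomul h') (\<lambda>h2 h3.
      sweedler (tcoact v) (\<lambda>w v0. hmul (hmul (hantipode h3) w) h1 \<otimes>\<^sub>C tact v0 h2)))" for v h
    by (rule ayd)
  show "sweedler (tcoact v) (\<lambda>w v0. tact v0 w) = v" for v
    by (simp add: tcoact_sweedler cbilinear_def lin tact_pure_one counit_mul counit_sigma counit_antipode
        V.coact_counit)
qed

end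

theorem theorem4p1p6:
  fixes N :: nat and X :: "nat \<Rightarrow> 'g::lie_algebra"
    and \<Delta> :: "'f::{comm_ring_1, complex_vector} \<Rightarrow> ('f, 'f) tensor"
    and \<epsilon> :: "'f \<Rightarrow> complex" and S :: "'f \<Rightarrow> 'f"
    and act :: "'g \<Rightarrow> 'f \<Rightarrow> 'f" and coact :: "'g \<Rightarrow> ('g, 'f) tensor"
    and f :: "nat \<Rightarrow> nat \<Rightarrow> 'f"
    and actV :: "'g \<Rightarrow> 'v::complex_vector \<Rightarrow> 'v" and coactV :: "'v \<Rightarrow> ('v, 'f) tensor"
  assumes "g_hopf_algebra N X \<Delta> \<epsilon> S act coact f"
    and "induced_module \<Delta> \<epsilon> act coact actV coactV"
  shows "right_left_sayd_module
      (bicrossed_mult act) bicrossed_one (bicrossed_comult \<Delta> act coact) (bicrossed_counit \<epsilon>)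
      (bicrossed_antipode S act coact)
      (twisted_act N X \<epsilon> actV) (twisted_coact N f S coactV)
    \<and> modular_pair_in_involution
      (bicrossed_mult act) bicrossed_one (bicrossed_comult \<Delta> act coact) (bicrossed_counit \<epsilon>)
      (bicrossed_antipode S act coact)
      (canonical_delta N X \<epsilon>) (canonical_sigma N f)"
proof -
  interpret module_over_g_hopf_algebra N X \<Delta> \<epsilon> S act coact f actV coactV
    by (rule module_over_g_hopf_algebra.intro) fact+
  show ?thesis
    using twisted_sayd_module canonical_modular_pair by blast
qed

end
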